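(* Let $\Bbbk$ be a field, let $S=\Bbbk[x_1,\dots,x_n]$, let $\Bbbk[\Delta]$ be the Stanley-Reisner ring of a simplicial complex $\Delta$ with vertex set $[n]=\{1,\dots,n\}$, and let $\mathbb{F}_\bullet$ denote its minimal free resolution over $S$. The linear part $\operatorname{lin}(\mathbb{F}_\bullet)$ of $\mathbb{F}_\bullet$ is isomorphic to the complex with modules $$\operatorname{lin}(\mathbb{F}_i)=\bigoplus_{U\subseteq[n]}\widetilde{H}^{\#U-i-1}(\Delta_U;\Bbbk)\otimes_{\Bbbk}S(-U),$$ and whose differential has the components, for $U\subseteq[n]$, $u\in U$ and $j=\#U-i-1$, $$\widetilde{H}^{j}(\Delta_U;\Bbbk)\otimes_{\Bbbk}S(-U)\longrightarrow\widetilde{H}^{j}(\Delta_{U\setminus\{u\}};\Bbbk)\otimes_{\Bbbk}S(-(U\setminus\{u\})),\qquad \omega\otimes s\longmapsto(-1)^{\alpha(u,U)}\,\omega|_{U\setminus\{u\}}\otimes x_u s.$$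
   Context: A simplicial complex $\Delta$ with vertex set $[n]$ is a collection of subsets of $[n]$ closed under taking subsets (the empty set is the unique face of dimension $-1$). The Stanley-Reisner ideal is $I_\Delta=\langle \prod_{i\in U}x_i : U\subseteq[n],\ U\notin\Delta\rangle\subseteq S$ and the Stanley-Reisner ring is $\Bbbk[\Delta]=S/I_\Delta$. $S$-modules are considered with the fine $\mathbb{Z}^n$-grading. Squarefree multidegrees are identified with subsets of $[n]$; for $U\subseteq[n]$, $S(-U)$ is the free cyclic $S$-module whose generator is in degree $U$. For $U\subseteq[n]$, $\Delta_U=\{F\in\Delta: F\subseteq U\}$ is the restriction of $\Delta$ to $U$. For $u\in[n]$ and $U\subseteq[n]$, $\alpha(u,U)=\#\{k\in U: k<u\}$. Reduced simplicial cohomology $\widetilde{H}^*(\Delta;\Bbbk)$ is the cohomology of the augmented oriented cochain complex $\widetilde{C}^\bullet(\Delta)=\operatorname{Hom}_\Bbbk(\widetilde{C}_\bullet(\Delta),\Bbbk)$. Here $\widetilde{C}_d(\Delta)$ has as basis the $d$-dimensional faces of $\Delta$ (including the empty face in dimension $-1$), with differential $\partial(F)=\sum_{i\in F}(-1)^{\alpha(i,F)}F\setminus\{i\}$. For a cohomology class $\omega$ of $\Delta_U$, $\omega|_{U\setminus\{u\}}$ denotes its image under the restriction map $\widetilde{H}^j(\Delta_U;\Bbbk)\to\widetilde{H}^j(\Delta_{U\setminus\{u\}};\Bbbk)$ induced by the inclusion $\Delta_{U\setminus\{u\}}\subseteq\Delta_U$. Linear part: let $\mathfrak{m}=\langle x_1,\dots,x_n\rangle$.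 The minimal free resolution $\mathbb{F}_\bullet$ (with $\mathbb{F}_i$ in homological degree $i$, $\mathbb{F}_0\to\Bbbk[\Delta]$) is filtered by the subcomplexes $\mathcal{F}^j(\mathbb{F}_i)=\mathfrak{m}^{j-i}\mathbb{F}_i$ (with $\mathfrak{m}^k=S$ for $k\le 0$), and $\operatorname{lin}(\mathbb{F}_\bullet)$ is the associated graded complex. Equivalently, $\operatorname{lin}(\mathbb{F}_\bullet)$ has the same modules as $\mathbb{F}_\bullet$, and its differential is obtained by representing the differential of $\mathbb{F}_\bullet$ by matrices in a (homogeneous) basis and deleting all non-linear entries, i.e. replacing the entries lying in $\mathfrak{m}^2$ by $0$. The notation $\operatorname{lin}(\mathbb{F}_i)$ means the module of $\operatorname{lin}(\mathbb{F}_\bullet)$ in homological degree $i$. *)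

theory Defs
  imports "HOL-Library.Poly_Mapping" "HOL-Algebra.Module" "HOL-Algebra.QuotRing" "HOL-Algebra.Ideal_Product"
    "HOL-Algebra.Generated_Groups"
begin

section \<open>The polynomial ring and Stanley-Reisner ideals\<close>

type_synonym mon = "nat \<Rightarrow>\<^sub>0 nat"
type_synonym 'k pol = "mon \<Rightarrow>\<^sub>0 'k"

definition mons :: "nat \<Rightarrow> mon set" where
  "mons n = {m. Poly_Mapping.keys m \<subseteq> {1..n}}"

text \<open>\<open>S = k[x\<^sub>1, \<dots>, x\<^sub>n]\<close>, as the subring of polynomials of the monoid algebra
  \<open>(nat \<Rightarrow>\<^sub>0 nat) \<Rightarrow>\<^sub>0 'k\<close> that involve only the variables with index in \<open>{1..n}\<close>.\<close>

definition pol_ring :: "nat \<Rightarrow> 'k::field pol ring" where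
  "pol_ring n = \<lparr>carrier = {p. Poly_Mapping.keys p \<subseteq> mons n}, mult = (*), one = 1, zero = 0, add = (+)\<rparr>"

definition var :: "nat \<Rightarrow> 'k::field pol" where
  "var i = Poly_Mapping.single (Poly_Mapping.single i 1) 1"

definition max_ideal :: "nat \<Rightarrow> 'k::field pol set" where
  "max_ideal n = genideal (pol_ring n) (var ` {1..n})"

definition simplicial_complex :: "nat \<Rightarrow> nat set set \<Rightarrow> bool" where
  "simplicial_complex n \<Delta> \<longleftrightarrow> \<Delta> \<subseteq> Pow {1..n} \<and> (\<forall>F\<in>\<Delta>. \<forall>G. G \<subseteq> F \<longrightarrow> G \<in> \<Delta>)"

definition restriction :: "nat set set \<Rightarrow> nat set \<Rightarrow> nat set set" where
  "restriction \<Delta> U = {F \<in> \<Delta>. F \<subseteq> U}"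

definition SR_ideal :: "nat \<Rightarrow> nat set set \<Rightarrow> 'k::field pol set" where
  "SR_ideal n \<Delta> = genideal (pol_ring n) {\<Prod>i\<in>U. var i | U. U \<subseteq> {1..n} \<and> U \<notin> \<Delta>}"

definition SR_ring :: "nat \<Rightarrow> nat set set \<Rightarrow> 'k::field pol set ring" where
  "SR_ring n \<Delta> = pol_ring n Quot SR_ideal n \<Delta>"


section \<open>Graded modules\<close>

text \<open>Elements of \<open>\<int>\<^sup>n\<close> are functions vanishing outside \<open>{1..n}\<close>. The components of a graded
  module in indices outside \<open>mdegs n\<close> are never used.\<close>

type_synonym mdeg = "nat \<Rightarrow> int"

definition mdegs :: "nat \<Rightarrow> mdeg set" where
  "mdegs n = {a. \<forall>i. i \<notin> {1..n} \<longrightarrow> a i = 0}"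

definition mon_deg :: "mon \<Rightarrow> mdeg" where
  "mon_deg m = (\<lambda>i. int (Poly_Mapping.lookup m i))"

definition sqfree_deg :: "nat set \<Rightarrow> mdeg" where
  "sqfree_deg U = (\<lambda>i. if i \<in> U then 1 else 0)"

definition deg_plus :: "mdeg \<Rightarrow> mdeg \<Rightarrow> mdeg" where
  "deg_plus a b = (\<lambda>i. a i + b i)"

definition pol_comp :: "nat \<Rightarrow> mdeg \<Rightarrow> 'k::field pol set" where
  "pol_comp n a = {p \<in> carrier (pol_ring n). \<forall>m\<in>Poly_Mapping.keys p. mon_deg m = a}"

record ('a, 'b) graded_module = "('a, 'b) module" +
  hcomp :: "mdeg \<Rightarrow> 'b set"

text \<open>A module record also has the fields \<^const>\<open>mult\<close> and \<^const>\<open>one\<close>, which play no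
  role for modules.\<close>

definition mk_module ::
    "'b set \<Rightarrow> 'b \<Rightarrow> ('b \<Rightarrow> 'b \<Rightarrow> 'b) \<Rightarrow> ('a \<Rightarrow> 'b \<Rightarrow> 'b) \<Rightarrow> ('a, 'b) module" where
  "mk_module C z pl sm = \<lparr>carrier = C, mult = (\<lambda>_ _. undefined), one = undefined,
     zero = z, add = pl, smult = sm\<rparr>"

definition with_grading :: "('a, 'b) module \<Rightarrow> (mdeg \<Rightarrow> 'b set) \<Rightarrow> ('a, 'b) graded_module" where
  "with_grading M h = module.extend M (graded_module.fields h)"

definition is_graded_module :: "nat \<Rightarrow> ('k::field pol, 'm) graded_module \<Rightarrow> bool" where
  "is_graded_module n M \<longleftrightarrow>
     module (pol_ring n) M \<and>
     (\<forall>a\<in>mdegs n. subgroup (hcomp M a) (add_monoid M)) \<and>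
     (\<forall>x\<in>carrier M. \<exists>!c. c \<in> (\<Pi>\<^sub>E a\<in>mdegs n. hcomp M a) \<and>
        finite {a \<in> mdegs n. c a \<noteq> \<zero>\<^bsub>M\<^esub>} \<and>
        x = (\<Oplus>\<^bsub>M\<^esub> a \<in> {a \<in> mdegs n. c a \<noteq> \<zero>\<^bsub>M\<^esub>}. c a)) \<and>
     (\<forall>a\<in>mdegs n. \<forall>b\<in>mdegs n. \<forall>p\<in>pol_comp n a. \<forall>x\<in>hcomp M b.
        p \<odot>\<^bsub>M\<^esub> x \<in> hcomp M (deg_plus a b))"

definition graded_hom ::
    "nat \<Rightarrow> ('k::field pol, 'm) graded_module \<Rightarrow> ('k pol, 'l) graded_module \<Rightarrow> ('m \<Rightarrow> 'l) set" where
  "graded_hom n M N = {f. f \<in> carrier M \<rightarrow> carrier N \<and>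
     (\<forall>x\<in>carrier M. \<forall>y\<in>carrier M. f (x \<oplus>\<^bsub>M\<^esub> y) = f x \<oplus>\<^bsub>N\<^esub> f y) \<and>
     (\<forall>p\<in>carrier (pol_ring n). \<forall>x\<in>carrier M. f (p \<odot>\<^bsub>M\<^esub> x) = p \<odot>\<^bsub>N\<^esub> f x) \<and>
     (\<forall>a\<in>mdegs n. f ` hcomp M a \<subseteq> hcomp N a)}"

text \<open>\<open>f i\<close> is the map from homological degree \<open>i + 1\<close> to homological degree \<open>i\<close>.\<close>

definition is_graded_complex ::
    "nat \<Rightarrow> (nat \<Rightarrow> ('k::field pol, 'm) graded_module) \<Rightarrow> (nat \<Rightarrow> 'm \<Rightarrow> 'm) \<Rightarrow> bool" where
  "is_graded_complex n C f \<longleftrightarrow>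
     (\<forall>i. is_graded_module n (C i)) \<and>
     (\<forall>i. f i \<in> graded_hom n (C (Suc i)) (C i)) \<and>
     (\<forall>i. \<forall>x\<in>carrier (C (Suc (Suc i))). f i (f (Suc i) x) = \<zero>\<^bsub>C i\<^esub>)"

definition complexes_isomorphic ::
    "nat \<Rightarrow> (nat \<Rightarrow> ('k::field pol, 'm) graded_module) \<Rightarrow> (nat \<Rightarrow> 'm \<Rightarrow> 'm) \<Rightarrow>
     (nat \<Rightarrow> ('k pol, 'l) graded_module) \<Rightarrow> (nat \<Rightarrow> 'l \<Rightarrow> 'l) \<Rightarrow> bool" where
  "complexes_isomorphic n C f D g \<longleftrightarrow>
     (\<exists>\<phi>. (\<forall>i. \<phi> i \<in> graded_hom n (C i) (D i)) \<and>
          (\<forall>i. bij_betw (\<phi> i) (carrier (C i)) (carrier (D i))) \<and>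
          (\<forall>i. \<forall>a\<in>mdegs n. \<phi> i ` hcomp (C i) a = hcomp (D i) a) \<and>
          (\<forall>i. \<forall>x\<in>carrier (C (Suc i)). \<phi> i (f i x) = g i (\<phi> (Suc i) x)))"

text \<open>Scalars act through \<open>S \<rightarrow> S/I\<close>, so \<open>r \<cdot> (y + I) = (r + I) (y + I)\<close>.\<close>

definition SR_module :: "nat \<Rightarrow> nat set set \<Rightarrow> ('k::field pol, 'k pol set) graded_module" where
  "SR_module n \<Delta> = with_grading
     (ring.extend (SR_ring n \<Delta>) (module.fields
       (\<lambda>r C. (SR_ideal n \<Delta> +>\<^bsub>pol_ring n\<^esub> r) \<otimes>\<^bsub>SR_ring n \<Delta>\<^esub> C)))
     (\<lambda>a. (\<lambda>p. SR_ideal n \<Delta> +>\<^bsub>pol_ring n\<^esub> p) ` pol_comp n a)"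


section \<open>Minimal free resolutions and their linear part\<close>

text \<open>Free modules have finite rank. A graded module has a homogeneous basis iff it is
  isomorphic to a finite direct sum of modules \<open>S(-a)\<close> with \<open>a \<in> \<int>\<^sup>n\<close>.\<close>

definition homogeneous_basis :: "nat \<Rightarrow> ('k::field pol, 'm) graded_module \<Rightarrow> 'm set \<Rightarrow> bool" where
  "homogeneous_basis n M B \<longleftrightarrow>
     finite B \<and> B \<subseteq> (\<Union>a\<in>mdegs n. hcomp M a) \<and>
     (\<forall>x\<in>carrier M. \<exists>!c. c \<in> B \<rightarrow>\<^sub>E carrier (pol_ring n) \<and>
        x = (\<Oplus>\<^bsub>M\<^esub> b\<in>B. c b \<odot>\<^bsub>M\<^esub> b))"

definition coords :: "nat \<Rightarrow> ('k::field pol, 'm) graded_module \<Rightarrow> 'm set \<Rightarrow> 'm \<Rightarrow> 'm \<Rightarrow> 'k pol" where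
  "coords n M B x = (THE c. c \<in> B \<rightarrow>\<^sub>E carrier (pol_ring n) \<and>
     x = (\<Oplus>\<^bsub>M\<^esub> b\<in>B. c b \<odot>\<^bsub>M\<^esub> b))"

definition ideal_times_module :: "'k::field pol set \<Rightarrow> ('k pol, 'm) graded_module \<Rightarrow> 'm set" where
  "ideal_times_module I M = generate (add_monoid M) {r \<odot>\<^bsub>M\<^esub> x | r x. r \<in> I \<and> x \<in> carrier M}"

text \<open>\<open>\<epsilon>\<close> is the augmentation from homological degree \<open>0\<close> onto the resolved module \<open>N\<close>.\<close>

definition minimal_free_resolution ::
    "nat \<Rightarrow> ('k::field pol, 'l) graded_module \<Rightarrow> (nat \<Rightarrow> ('k pol, 'm) graded_module) \<Rightarrow>
     (nat \<Rightarrow> 'm \<Rightarrow> 'm) \<Rightarrow> ('m \<Rightarrow> 'l) \<Rightarrow> bool" where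
  "minimal_free_resolution n N F d \<epsilon> \<longleftrightarrow>
     is_graded_complex n F d \<and>
     (\<forall>i. \<exists>B. homogeneous_basis n (F i) B) \<and>
     \<epsilon> \<in> graded_hom n (F 0) N \<and>
     \<epsilon> ` carrier (F 0) = carrier N \<and>
     {x \<in> carrier (F 0). \<epsilon> x = \<zero>\<^bsub>N\<^esub>} = d 0 ` carrier (F 1) \<and>
     (\<forall>i. {x \<in> carrier (F (Suc i)). d i x = \<zero>\<^bsub>F i\<^esub>} = d (Suc i) ` carrier (F (Suc (Suc i)))) \<and>
     (\<forall>i. d i ` carrier (F (Suc i)) \<subseteq> ideal_times_module (max_ideal n) (F i))"

definition lin_entry :: "nat \<Rightarrow> 'k::field pol \<Rightarrow> 'k pol" where
  "lin_entry n p = (if p \<in> max_ideal n \<cdot>\<^bsub>pol_ring n\<^esub> max_ideal n then 0 else p)"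

text \<open>The complex \<open>lin F\<close> has the modules of \<open>F\<close>; its differential is given by the matrix of
  \<open>d i\<close> with respect to the bases \<open>B (i + 1)\<close> and \<open>B i\<close> after deletion of the entries in the
  square of the maximal ideal.\<close>

definition lin_diff ::
    "nat \<Rightarrow> (nat \<Rightarrow> ('k::field pol, 'm) graded_module) \<Rightarrow> (nat \<Rightarrow> 'm \<Rightarrow> 'm) \<Rightarrow> (nat \<Rightarrow> 'm set) \<Rightarrow>
     nat \<Rightarrow> 'm \<Rightarrow> 'm" where
  "lin_diff n F d B i x = (\<Oplus>\<^bsub>F i\<^esub> c \<in> B i.
     (\<Sum>b\<in>B (Suc i). lin_entry n (coords n (F i) (B i) (d i b) c) * coords n (F (Suc i)) (B (Suc i)) x b)
       \<odot>\<^bsub>F i\<^esub> c)"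


section \<open>Reduced simplicial cohomology\<close>

definition faces :: "nat set set \<Rightarrow> int \<Rightarrow> nat set set" where
  "faces \<Delta> j = {F \<in> \<Delta>. int (card F) - 1 = j}"

definition alpha :: "nat \<Rightarrow> nat set \<Rightarrow> nat" where
  "alpha u U = card {k \<in> U. k < u}"

text \<open>A linear functional on the space of \<open>j\<close>-chains is given by its values on the basis of
  \<open>j\<close>-dimensional faces; composition with \<open>\<partial> F = (\<Sum>i\<in>F. (-1)\<^bsup>\<alpha>(i,F)\<^esup> F - {i})\<close> becomes
  \<open>coboundary\<close>.\<close>

definition cochains :: "nat set set \<Rightarrow> int \<Rightarrow> (nat set \<Rightarrow> 'k::field) set" where
  "cochains \<Delta> j = {\<phi>. \<forall>F. F \<notin> faces \<Delta> j \<longrightarrow> \<phi> F = 0}"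

definition coboundary :: "nat set set \<Rightarrow> int \<Rightarrow> (nat set \<Rightarrow> 'k::field) \<Rightarrow> nat set \<Rightarrow> 'k" where
  "coboundary \<Delta> j \<phi> F =
     (if F \<in> faces \<Delta> (j + 1) then \<Sum>i\<in>F. (-1) ^ alpha i F * \<phi> (F - {i}) else 0)"

definition cocycles :: "nat set set \<Rightarrow> int \<Rightarrow> (nat set \<Rightarrow> 'k::field) set" where
  "cocycles \<Delta> j = {\<phi> \<in> cochains \<Delta> j. coboundary \<Delta> j \<phi> = (\<lambda>_. 0)}"

definition coboundaries :: "nat set set \<Rightarrow> int \<Rightarrow> (nat set \<Rightarrow> 'k::field) set" where
  "coboundaries \<Delta> j = coboundary \<Delta> (j - 1) ` cochains \<Delta> (j - 1)"

definition cocycle_space :: "nat set set \<Rightarrow> int \<Rightarrow> ('k::field, nat set \<Rightarrow> 'k) module" where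
  "cocycle_space \<Delta> j = mk_module (cocycles \<Delta> j) (\<lambda>_. 0) (\<lambda>\<phi> \<psi> F. \<phi> F + \<psi> F) (\<lambda>c \<phi> F. c * \<phi> F)"

definition quot_module :: "('a, 'b) module \<Rightarrow> 'b set \<Rightarrow> ('a, 'b set) module" where
  "quot_module M N = mk_module (a_rcosets\<^bsub>M\<^esub> N) N (set_add M)
     (\<lambda>r C. \<Union>x\<in>C. N +>\<^bsub>M\<^esub> (r \<odot>\<^bsub>M\<^esub> x))"

definition cohomology :: "nat set set \<Rightarrow> int \<Rightarrow> ('k::field, (nat set \<Rightarrow> 'k) set) module" where
  "cohomology \<Delta> j = quot_module (cocycle_space \<Delta> j) (coboundaries \<Delta> j)"

text \<open>The map induced by the inclusion of a subcomplex \<open>\<Gamma>\<close> into the complex carrying the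
  class \<open>\<omega>\<close>: cochains are restricted to the faces of \<open>\<Gamma>\<close>.\<close>

definition restrict_class ::
    "nat set set \<Rightarrow> int \<Rightarrow> (nat set \<Rightarrow> 'k::field) set \<Rightarrow> (nat set \<Rightarrow> 'k) set" where
  "restrict_class \<Gamma> j \<omega> =
     (\<Union>\<phi>\<in>\<omega>. coboundaries \<Gamma> j +>\<^bsub>cocycle_space \<Gamma> j\<^esub> (\<lambda>F. if F \<in> faces \<Gamma> j then \<phi> F else 0))"


section \<open>The complex built from the cohomology of restrictions\<close>

text \<open>For a \<open>k\<close>-vector space \<open>V\<close>, the tensor product of \<open>V\<close> with \<open>S\<close> over \<open>k\<close> is the module of
  polynomials with coefficients in \<open>V\<close>: since the monomials are a \<open>k\<close>-basis of \<open>S\<close>, each of its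
  elements is a unique finite sum of tensors \<open>v\<^sub>m \<otimes> m\<close>, recorded as the function sending \<open>m\<close> to
  \<open>v\<^sub>m\<close>.\<close>

definition tensor_S :: "nat \<Rightarrow> ('k::field, 'v) module \<Rightarrow> ('k pol, mon \<Rightarrow> 'v) module" where
  "tensor_S n V = mk_module
     {f. (\<forall>m. f m \<in> carrier V) \<and> {m. f m \<noteq> \<zero>\<^bsub>V\<^esub>} \<subseteq> mons n \<and> finite {m. f m \<noteq> \<zero>\<^bsub>V\<^esub>}}
     (\<lambda>_. \<zero>\<^bsub>V\<^esub>)
     (\<lambda>f g m. f m \<oplus>\<^bsub>V\<^esub> g m)
     (\<lambda>p f m. \<Oplus>\<^bsub>V\<^esub> a \<in> {a \<in> Poly_Mapping.keys p. \<exists>b. m = a + b}.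
        Poly_Mapping.lookup p a \<odot>\<^bsub>V\<^esub> f (m - a))"

definition pure_tensor :: "('k::field, 'v) module \<Rightarrow> 'v \<Rightarrow> 'k pol \<Rightarrow> mon \<Rightarrow> 'v" where
  "pure_tensor V v s = (\<lambda>m. Poly_Mapping.lookup s m \<odot>\<^bsub>V\<^esub> v)"

definition direct_sum :: "'i set \<Rightarrow> ('i \<Rightarrow> ('a, 'b) module) \<Rightarrow> ('a, 'i \<Rightarrow> 'b) module" where
  "direct_sum I M = mk_module
     {f \<in> \<Pi>\<^sub>E i\<in>I. carrier (M i). finite {i \<in> I. f i \<noteq> \<zero>\<^bsub>M i\<^esub>}}
     (\<lambda>i\<in>I. \<zero>\<^bsub>M i\<^esub>)
     (\<lambda>f g. \<lambda>i\<in>I. f i \<oplus>\<^bsub>M i\<^esub> g i)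
     (\<lambda>r f. \<lambda>i\<in>I. r \<odot>\<^bsub>M i\<^esub> f i)"

definition summand_inj :: "'i set \<Rightarrow> ('i \<Rightarrow> ('a, 'b) module) \<Rightarrow> 'i \<Rightarrow> 'b \<Rightarrow> 'i \<Rightarrow> 'b" where
  "summand_inj I M k x = (\<lambda>i\<in>I. if i = k then x else \<zero>\<^bsub>M i\<^esub>)"

definition coh :: "nat set set \<Rightarrow> nat \<Rightarrow> nat set \<Rightarrow> ('k::field, (nat set \<Rightarrow> 'k) set) module" where
  "coh \<Delta> i U = cohomology (restriction \<Delta> U) (int (card U) - int i - 1)"

text \<open>The summand of \<open>U\<close> is \<^term>\<open>tensor_S n (coh \<Delta> i U)\<close>; the shift in \<open>S(-U)\<close> only affects
  the grading: a monomial \<open>m\<close> in this summand has degree \<open>m + U\<close>.\<close>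

definition coh_complex ::
    "nat \<Rightarrow> nat set set \<Rightarrow> nat \<Rightarrow>
     ('k::field pol, nat set \<Rightarrow> mon \<Rightarrow> (nat set \<Rightarrow> 'k) set) graded_module" where
  "coh_complex n \<Delta> i =
     (let T = direct_sum (Pow {1..n}) (\<lambda>U. tensor_S n (coh \<Delta> i U)) in
      with_grading T (\<lambda>a. {f \<in> carrier T. \<forall>U\<in>Pow {1..n}. \<forall>m.
        f U m \<noteq> \<zero>\<^bsub>coh \<Delta> i U\<^esub> \<longrightarrow> deg_plus (mon_deg m) (sqfree_deg U) = a}))"

text \<open>The element \<open>\<omega> \<otimes> s\<close> of the summand of \<open>U\<close> in homological degree \<open>i\<close>.\<close>

definition coh_elem ::
    "nat \<Rightarrow> nat set set \<Rightarrow> nat \<Rightarrow> nat set \<Rightarrow> (nat set \<Rightarrow> 'k::field) set \<Rightarrow> 'k pol \<Rightarrow>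
     nat set \<Rightarrow> mon \<Rightarrow> (nat set \<Rightarrow> 'k) set" where
  "coh_elem n \<Delta> i U \<omega> s =
     summand_inj (Pow {1..n}) (\<lambda>U. tensor_S n (coh \<Delta> i U)) U (pure_tensor (coh \<Delta> i U) \<omega> s)"

text \<open>Pure tensors generate, so this determines the linear maps \<open>D i\<close>. Restriction to
  \<open>U - {u}\<close> maps the summand of \<open>U\<close> in homological degree \<open>i + 1\<close> to that of \<open>U - {u}\<close> in
  homological degree \<open>i\<close>, both with cohomology in degree \<open>card U - i - 2\<close>.\<close>

definition has_restriction_components ::
    "nat \<Rightarrow> nat set set \<Rightarrow>
     (nat \<Rightarrow> (nat set \<Rightarrow> mon \<Rightarrow> (nat set \<Rightarrow> 'k::field) set) \<Rightarrow>
             (nat set \<Rightarrow> mon \<Rightarrow> (nat set \<Rightarrow> 'k) set)) \<Rightarrow> bool" where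
  "has_restriction_components n \<Delta> D \<longleftrightarrow>
     (\<forall>i. \<forall>U\<in>Pow {1..n}. \<forall>\<omega>\<in>carrier (coh \<Delta> (Suc i) U). \<forall>s\<in>carrier (pol_ring n).
        D i (coh_elem n \<Delta> (Suc i) U \<omega> s) =
        (\<Oplus>\<^bsub>coh_complex n \<Delta> i\<^esub> u\<in>U.
           coh_elem n \<Delta> i (U - {u})
             ((-1) ^ alpha u U \<odot>\<^bsub>coh \<Delta> i (U - {u})\<^esub>
                restrict_class (restriction \<Delta> (U - {u})) (int (card U) - int i - 2) \<omega>)
             (var u * s)))"

end

theory Submission
  imports Defs "HOL-Library.Function_Algebras"
begin

text \<open>In a fixed multidegree \<open>a\<close>, tensor the Koszul complex with the resolution \<open>F\<close>. This is a
  double complex with exact rows and columns except at the two edges, which are the Koszul complex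
  of \<open>k[\<Delta>]\<close> and \<open>F / m F\<close>. A zigzag \<open>w\<^sub>0, \<dots>, w\<^sub>i\<close> with \<open>d w\<^sub>p\<^sub>+\<^sub>1 = \<kappa> w\<^sub>p\<close> relates the Koszul cycle
  \<open>\<epsilon> w\<^sub>0\<close> to the class of \<open>w\<^sub>i\<close> in \<open>F\<^sub>i / m F\<^sub>i\<close>, and the diagram chases show that this is an isomorphism
  from Koszul homology to \<open>F\<^sub>i / m F\<^sub>i\<close>. In degree \<open>U \<subseteq> [n]\<close> the Koszul complex of \<open>k[\<Delta>]\<close> is the
  cochain complex of \<open>\<Delta>\<^sub>U\<close>, with \<open>e\<^sub>A\<close> corresponding to the face \<open>U - A\<close>; in degrees that are not
  squarefree it is exact.

  Writing \<open>w\<^sub>i\<^sub>-\<^sub>1 = \<Sum>\<^sub>u e\<^sub>u \<otimes> f\<^sub>u\<close>, the last zigzag equation reads \<open>d w\<^sub>i = \<Sum>\<^sub>u x\<^sub>u f\<^sub>u\<close>, so modulo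
  \<open>m\<^sup>2\<close> the differential is \<open>\<Sum>\<^sub>u x\<^sub>u [f\<^sub>u]\<close>. Contracting the zigzag with \<open>e\<^sub>u\<close> gives, up to sign, a zigzag
  from the contraction of \<open>\<epsilon> w\<^sub>0\<close> to \<open>[f\<^sub>u]\<close>, and on cochains this contraction is the restriction to
  \<open>U - {u}\<close>.\<close>

section \<open>Double complexes\<close>

text \<open>Every step of a zigzag chooses a preimage, so the correspondence between the two edges
  is multivalued. It is kept as the relation \<open>tor\<close>, and a function is extracted from it
  only once both boundary lemmas are known. Minimality enters through one fact: the differential
  induced on the edge F / m F is zero, so every element of that edge is a cycle and only 0 is a
  boundary. A multidegree contains at most one monomial, so fixing it replaces each polynomial entry
  by a scalar; polynomials return when the degrees are reassembled in \<open>phi\<close>. Squarefree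
  degrees suffice because, where some coordinate of a is at least 2, the corresponding variable
  contracts the Koszul complex of k[\<Delta>]; hence every basis degree is some U. Contraction with
  e_u anticommutes with the Koszul differential. The alternating signs that repair this leave a
  factor (-1)^i at the end of the zigzag, which is absorbed when the cochain sign for U is replaced
  by that for U - {u}; what remains is (-1)^\<alpha>(u,U).\<close>

locale double_complex =
  fixes X :: "nat \<Rightarrow> nat \<Rightarrow> 'x::ab_group_add set"
    and d k :: "nat \<Rightarrow> nat \<Rightarrow> 'x \<Rightarrow> 'x"
    and E :: "nat \<Rightarrow> 'e::ab_group_add set"
    and \<epsilon> :: "nat \<Rightarrow> 'x \<Rightarrow> 'e"
    and kE :: "nat \<Rightarrow> 'e \<Rightarrow> 'e"
  assumes X_diff: "x \<in> X p q \<Longrightarrow> y \<in> X p q \<Longrightarrow> x - y \<in> X p q"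
    and d_closed: "x \<in> X (Suc p) q \<Longrightarrow> d p q x \<in> X p q"
    and k_closed: "x \<in> X p (Suc q) \<Longrightarrow> k p q x \<in> X p q"
    and d_diff: "x \<in> X (Suc p) q \<Longrightarrow> y \<in> X (Suc p) q \<Longrightarrow> d p q (x - y) = d p q x - d p q y"
    and k_diff: "x \<in> X p (Suc q) \<Longrightarrow> y \<in> X p (Suc q) \<Longrightarrow> k p q (x - y) = k p q x - k p q y"
    and dk: "x \<in> X (Suc p) (Suc q) \<Longrightarrow> d p q (k (Suc p) q x) = k p q (d p (Suc q) x)"
    and kk: "x \<in> X p (Suc (Suc q)) \<Longrightarrow> k p q (k p (Suc q) x) = 0"
    and \<epsilon>_closed: "x \<in> X 0 q \<Longrightarrow> \<epsilon> q x \<in> E q"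
    and \<epsilon>_diff: "x \<in> X 0 q \<Longrightarrow> y \<in> X 0 q \<Longrightarrow> \<epsilon> q (x - y) = \<epsilon> q x - \<epsilon> q y"
    and \<epsilon>k: "x \<in> X 0 (Suc q) \<Longrightarrow> \<epsilon> q (k 0 q x) = kE q (\<epsilon> (Suc q) x)"
    and \<epsilon>d: "x \<in> X (Suc 0) q \<Longrightarrow> \<epsilon> q (d 0 q x) = 0"
    and \<epsilon>_surj: "e \<in> E q \<Longrightarrow> \<exists>x\<in>X 0 q. \<epsilon> q x = e"
    and exact_0: "x \<in> X 0 q \<Longrightarrow> \<epsilon> q x = 0 \<Longrightarrow> \<exists>y\<in>X (Suc 0) q. d 0 q y = x"
    and exact_Suc: "x \<in> X (Suc p) q \<Longrightarrow> d p q x = 0 \<Longrightarrow> \<exists>y\<in>X (Suc (Suc p)) q. d (Suc p) q y = x"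
begin

text \<open>Only the \<open>d\<close> direction is assumed exact in this locale. Exactness in the
  \<open>k\<close> direction is exploited through a second interpretation in which the two
  directions are exchanged.\<close>

definition zigzag :: "nat \<Rightarrow> (nat \<Rightarrow> 'x) \<Rightarrow> bool" where
  "zigzag i w \<longleftrightarrow> (\<forall>p q. p + q = i \<longrightarrow> w p \<in> X p q) \<and>
     (\<forall>p q. Suc (p + q) = i \<longrightarrow> d p q (w (Suc p)) = k p q (w p))"

text \<open>Apply \<epsilon> to \<open>d w_1 = k w_0\<close>: \<epsilon> kills the image of
  \<open>d\<close>. The length \<open>Suc i\<close> guarantees that \<open>w_1\<close>
  exists.\<close>

lemma zigzag_cycle:
  assumes "zigzag (Suc i) w"
  shows "kE i (\<epsilon> (Suc i) (w 0)) = 0"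
proof -
  have "w 0 \<in> X 0 (Suc i)" "w (Suc 0) \<in> X (Suc 0) i" "d 0 i (w (Suc 0)) = k 0 i (w 0)"
    using assms unfolding zigzag_def by auto
  then show ?thesis using \<epsilon>k \<epsilon>d by metis
qed

text \<open>The terms are constructed one at a time, each step lifting \<open>k w_m\<close> through
  \<open>d\<close>. The hypothesis \<open>cyc\<close> is conditional on \<open>i = Suc q\<close>
  because in degree 0 there is no Koszul differential to apply.\<close>

lemma zigzag_extend:
  assumes e: "e \<in> E i" and cyc: "\<And>q. i = Suc q \<Longrightarrow> kE q e = 0"
  obtains w where "zigzag i w" "\<epsilon> i (w 0) = e"
proof -
  have "\<exists>w. \<epsilon> i (w 0) = e \<and> (\<forall>p q. p + q = i \<and> p \<le> m \<longrightarrow> w p \<in> X p q) \<and>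
     (\<forall>p q. Suc (p + q) = i \<and> Suc p \<le> m \<longrightarrow> d p q (w (Suc p)) = k p q (w p))" if "m \<le> i" for m
    using that
  proof (induction m)
    case 0
    obtain x where "x \<in> X 0 i" "\<epsilon> i x = e" using \<epsilon>_surj[OF e] by blast
    then show ?case by (intro exI[of _ "\<lambda>_. x"]) auto
  next
    case (Suc m)
    then obtain w where w: "\<epsilon> i (w 0) = e" "\<And>p q. p + q = i \<Longrightarrow> p \<le> m \<Longrightarrow> w p \<in> X p q"
      "\<And>p q. Suc (p + q) = i \<Longrightarrow> Suc p \<le> m \<Longrightarrow> d p q (w (Suc p)) = k p q (w p)"
      by auto
    from Suc.prems obtain q where q: "i = Suc (m + q)" by (metis le_Suc_ex add_Suc)
    have wm: "w m \<in> X m (Suc q)" using w(2) q by auto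
    \<comment> \<open>The obstruction vanishes because
      \<open>d k w_m = k d w_m = k k w_(m-1) = 0\<close>. For m = 0 the previous term is missing,
      and the cycle condition on \<open>e\<close> takes its place.\<close>
    have "\<exists>y\<in>X (Suc m) q. d m q y = k m q (w m)"
    proof (cases m)
      case 0
      have "\<epsilon> q (k m q (w m)) = 0" using \<epsilon>k wm 0 w(1) cyc q by auto
      then show ?thesis using exact_0[OF _] k_closed[OF wm] 0 by auto
    next
      case (Suc m')
      have 1: "w m' \<in> X m' (Suc (Suc q))" using w(2)[of m' "Suc (Suc q)"] q Suc by auto
      have "d m' (Suc q) (w m) = k m' (Suc q) (w m')" using w(3)[of m' "Suc q"] q Suc by auto
      then have "d m' q (k m q (w m)) = 0" using dk wm Suc kk[OF 1] by auto
      then show ?thesis using exact_Suc k_closed[OF wm] Suc by auto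
    qed
    then obtain y where y: "y \<in> X (Suc m) q" "d m q y = k m q (w m)" by blast
    have "\<epsilon> i ((w(Suc m := y)) 0) = e" using w(1) by simp
    moreover have "(w(Suc m := y)) p' \<in> X p' q'" if "p' + q' = i" "p' \<le> Suc m" for p' q'
      using that w(2)[of p' q'] y(1) q by (cases "p' = Suc m") auto
    moreover have "d p' q' ((w(Suc m := y)) (Suc p')) = k p' q' ((w(Suc m := y)) p')"
      if "Suc (p' + q') = i" "Suc p' \<le> Suc m" for p' q'
      using that w(3)[of p' q'] y(2) q by (cases "p' = m") auto
    ultimately show ?case by blast
  qed
  from this[of i] obtain w where w: "\<epsilon> i (w 0) = e" "\<And>p q. p + q = i \<Longrightarrow> w p \<in> X p q"
    "\<And>p q. Suc (p + q) = i \<Longrightarrow> d p q (w (Suc p)) = k p q (w p)"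
    by auto
  show thesis by (rule that[of w]) (use w in \<open>auto simp: zigzag_def\<close>)
qed

text \<open>The conclusion says that \<open>w i\<close> vanishes in the other edge of the double complex.\<close>

lemma zigzag_boundary:
  assumes w: "zigzag i w" and e: "e \<in> E (Suc i)" "kE i e = \<epsilon> i (w 0)"
  shows "\<exists>x\<in>X i (Suc 0). \<exists>y\<in>X (Suc i) 0. w i = k i 0 x + d i 0 y"
proof -
  \<comment> \<open>Induction along the antidiagonal: the witness \<open>y\<close> of stage p serves
    as the witness \<open>x\<close> of stage p + 1, since
    \<open>d (k y) = k (d y) = k w_p = d w_(p+1)\<close> makes \<open>w_(p+1) - k y\<close> a
    \<open>d\<close>-cycle.\<close>
  have "\<exists>x\<in>X p (Suc q). \<exists>y\<in>X (Suc p) q. w p = k p q x + d p q y" if "p + q = i" for p q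
    using that
  proof (induction p arbitrary: q)
    case 0
    obtain v where v: "v \<in> X 0 (Suc i)" "\<epsilon> (Suc i) v = e" using \<epsilon>_surj[OF e(1)] by blast
    have w0: "w 0 \<in> X 0 i" using w by (auto simp: zigzag_def)
    have "\<epsilon> i (w 0 - k 0 i v) = 0" using \<epsilon>_diff[OF w0 k_closed[OF v(1)]] \<epsilon>k[OF v(1)] v(2) e(2) by simp
    then obtain y where "y \<in> X (Suc 0) i" "d 0 i y = w 0 - k 0 i v"
      using exact_0 X_diff[OF w0 k_closed[OF v(1)]] by blast
    then show ?case using v 0 by (intro bexI[of _ v] bexI[of _ y]) auto
  next
    case (Suc p)
    have pq: "p + Suc q = i" using Suc.prems by simp
    from Suc.IH[OF pq] obtain x y where xy: "x \<in> X p (Suc (Suc q))" "y \<in> X (Suc p) (Suc q)"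
      "w p = k p (Suc q) x + d p (Suc q) y" by blast
    have wp: "w (Suc p) \<in> X (Suc p) q" "d p q (w (Suc p)) = k p q (w p)" "w p \<in> X p (Suc q)"
      using w pq by (auto simp: zigzag_def)
    have ky: "k (Suc p) q y \<in> X (Suc p) q" using k_closed xy by blast
    have "k p q (w p) - k p q (d p (Suc q) y) = k p q (w p - d p (Suc q) y)"
      using k_diff[OF wp(3) d_closed[OF xy(2)]] by simp
    also have "\<dots> = 0" using xy(3) kk[OF xy(1)] by simp
    finally have "d p q (w (Suc p) - k (Suc p) q y) = 0"
      using d_diff[OF wp(1) ky] wp(2) dk[OF xy(2)] by simp
    then obtain z where "z \<in> X (Suc (Suc p)) q" "d (Suc p) q z = w (Suc p) - k (Suc p) q y"
      using exact_Suc X_diff[OF wp(1) ky] by blast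
    then show ?case using xy by (intro bexI[of _ y] bexI[of _ z]) auto
  qed
  from this[of i 0] show ?thesis by simp
qed

end

text \<open>The Koszul differential \<open>e\<^sub>A \<mapsto> \<Sum>\<^sub>u\<^sub>\<in>\<^sub>A \<plusminus> x\<^sub>u e\<^bsub>A - u\<^esub>\<close> on coefficient functions. In a fixed degree the
  power of \<open>x\<close> accompanying \<open>e\<^sub>A\<close> is determined, and \<open>\<A>\<close> collects the sets \<open>A\<close> for which it is present.\<close>

definition koszul :: "nat \<Rightarrow> nat set set \<Rightarrow> (nat set \<Rightarrow> 'k::comm_ring_1) \<Rightarrow> nat set \<Rightarrow> 'k" where
  "koszul n \<A> c A = (if A \<in> \<A> then \<Sum>u\<in>{1..n} - A. (-1) ^ alpha u A * c (insert u A) else 0)"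

section \<open>Signs, square zero and contraction for the Koszul differential\<close>

lemma alpha_insert:
  assumes "finite A" "u \<notin> A"
  shows "alpha t (insert u A) = alpha t A + (if u < t then 1 else 0)"
proof -
  have "{k \<in> insert u A. k < t} = (if u < t then insert u {k \<in> A. k < t} else {k \<in> A. k < t})" by auto
  then show ?thesis using assms by (auto simp: alpha_def)
qed

lemma koszul_0 [simp]: "koszul n \<A> (\<lambda>_. 0) A = 0"
  by (simp add: koszul_def)

lemma koszul_diff: "koszul n \<A> (c - c') A = koszul n \<A> c A - koszul n \<A> c' A"
  by (simp add: koszul_def sum_subtractf algebra_simps)

lemma koszul_smult: "koszul n \<A> (\<lambda>A. r * c A) A = r * koszul n \<A> c A"
  by (simp add: koszul_def sum_distrib_left mult_ac)

text \<open>The summands for (u,v) and (v,u) cancel, because inserting the smaller index shifts the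
  sign of the larger one and not conversely. The hypothesis \<open>conv\<close> ensures that a
  summand lost when the intermediate set leaves \<A> had coefficient 0 anyway.\<close>

lemma koszul_koszul:
  assumes fin: "\<And>A. A \<in> \<A> \<Longrightarrow> A \<subseteq> {1..n}"
    and conv: "\<And>A u v. A \<in> \<A> \<Longrightarrow> insert u (insert v A) \<in> \<A> \<Longrightarrow> insert v A \<in> \<A>"
    and supp: "\<And>A. c A \<noteq> 0 \<Longrightarrow> A \<in> \<A>"
  shows "koszul n \<A> (koszul n \<A> c) A = 0"
proof (cases "A \<in> \<A>")
  case True
  define g where "g u v = (-1) ^ alpha u A * (-1) ^ alpha v (insert u A) * c (insert v (insert u A))" for u v
  have finA: "finite A" using fin[OF True] finite_subset by blast
  have "koszul n \<A> (koszul n \<A> c) A =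
      (\<Sum>u\<in>{1..n} - A. \<Sum>v\<in>{1..n} - insert u A. g u v)"
    unfolding koszul_def[of n \<A> _ A] using True
  proof (simp, intro sum.cong refl)
    fix u assume u: "u \<in> {Suc 0..n} - A"
    show "(-1) ^ alpha u A * koszul n \<A> c (insert u A) = (\<Sum>v\<in>{Suc 0..n} - insert u A. g u v)"
    proof (cases "insert u A \<in> \<A>")
      case False
      then have "c (insert v (insert u A)) = 0" for v using supp conv True by blast
      then show ?thesis using False by (simp add: koszul_def g_def)
    qed (simp add: koszul_def g_def sum_distrib_left mult.assoc)
  qed
  also have "\<dots> = (\<Sum>u\<in>{1..n} - A. \<Sum>v\<in>{v\<in>{1..n} - A. v \<noteq> u}. g u v)"
    by (intro sum.cong) auto
  also have "\<dots> = (\<Sum>u\<in>{1..n} - A. (\<Sum>v\<in>{v\<in>{1..n} - A. v < u}. g u v)) + (\<Sum>u\<in>{1..n} - A. (\<Sum>v\<in>{v\<in>{1..n} - A. u < v}. g u v))"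
    unfolding sum.distrib[symmetric]
  proof (intro sum.cong refl)
    fix u assume "u \<in> {1..n} - A"
    have "{v\<in>{1..n} - A. v \<noteq> u} = {v\<in>{1..n} - A. v < u} \<union> {v\<in>{1..n} - A. u < v}" by auto
    then show "(\<Sum>v\<in>{v\<in>{1..n} - A. v \<noteq> u}. g u v) = (\<Sum>v\<in>{v\<in>{1..n} - A. v < u}. g u v) + (\<Sum>v\<in>{v\<in>{1..n} - A. u < v}. g u v)"
      using sum.union_disjoint[of "{v\<in>{1..n} - A. v < u}" "{v\<in>{1..n} - A. u < v}" "g u"] by fastforce
  qed
  also have "(\<Sum>u\<in>{1..n} - A. (\<Sum>v\<in>{v\<in>{1..n} - A. u < v}. g u v)) = (\<Sum>v\<in>{1..n} - A. (\<Sum>u\<in>{u\<in>{1..n} - A. u < v}. g u v))"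
    by (rule sum.swap_restrict) auto
  also have "(\<Sum>u\<in>{1..n} - A. (\<Sum>v\<in>{v\<in>{1..n} - A. v < u}. g u v)) + (\<Sum>v\<in>{1..n} - A. (\<Sum>u\<in>{u\<in>{1..n} - A. u < v}. g u v)) =
      (\<Sum>u\<in>{1..n} - A. (\<Sum>v\<in>{v\<in>{1..n} - A. v < u}. g u v + g v u))"
    by (simp add: sum.distrib)
  also have "\<dots> = 0"
  proof (intro sum.neutral ballI)
    fix u v assume "u \<in> {1..n} - A" "v \<in> {v\<in>{1..n} - A. v < u}"
    then show "g u v + g v u = 0"
      by (simp add: g_def alpha_insert[OF finA] insert_commute)
  qed
  finally show ?thesis .
qed (simp add: koszul_def)

text \<open>Multiplication by e_t is a homotopy between the identity and 0, so it produces a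
  primitive of every cycle. Closure of \<A> under inserting and deleting t says that multiplication
  by x_t is invertible wherever the homotopy requires it.\<close>

lemma koszul_contraction:
  fixes c :: "nat set \<Rightarrow> 'k::comm_ring_1"
  assumes fin: "\<And>A. A \<in> \<A> \<Longrightarrow> A \<subseteq> {1..n}" and t: "t \<in> {1..n}"
    and ins: "\<And>A. A \<in> \<A> \<Longrightarrow> insert t A \<in> \<A>" and del: "\<And>A. A \<in> \<A> \<Longrightarrow> A - {t} \<in> \<A>"
    and supp: "\<And>A. c A \<noteq> 0 \<Longrightarrow> A \<in> \<A>"
    and cyc: "koszul n \<A> c = (\<lambda>_. 0)"
  shows "koszul n \<A> (\<lambda>A. if t \<in> A then (-1) ^ alpha t A * c (A - {t}) else 0) = c"
proof
  fix A
  let ?h = "\<lambda>A. if t \<in> A then (-1) ^ alpha t A * c (A - {t}) else 0"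
  show "koszul n \<A> ?h A = c A"
  proof (cases "A \<in> \<A>")
    case True
    have finA: "finite A" using fin[OF True] finite_subset by blast
    show ?thesis
    proof (cases "t \<in> A")
      case False
      have *: "insert t A - {t} = A" using False by auto
      \<comment> \<open>The primitive is supported on sets containing t, so for t outside A only the
        summand u = t survives.\<close>
      have "koszul n \<A> ?h A = (\<Sum>u\<in>{1..n} - A. if u = t then (-1) ^ alpha t A * ((-1) ^ alpha t (insert t A) * c A) else 0)"
        unfolding koszul_def using True by (simp only: if_True) (intro sum.cong refl, use False * in auto)
      also have "\<dots> = c A" using False t finA by (simp add: alpha_insert flip: mult.assoc power_add)
      finally show ?thesis .
    next
      case tA: True
      define A' where "A' = A - {t}"
      have A: "A = insert t A'" "t \<notin> A'" "finite A'" "A' \<in> \<A>" using tA finA del[OF True] by (auto simp: A'_def)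
      \<comment> \<open>The cycle condition is evaluated at A - {t}, and multiplied by the sign of
        its t-summand so that it can be solved for \<open>c A\<close>.\<close>
      have "0 = (-1) ^ alpha t A' * koszul n \<A> c A'" by (simp add: cyc)
      also have "\<dots> = (-1) ^ alpha t A' * (\<Sum>u\<in>insert t ({1..n} - A). (-1) ^ alpha u A' * c (insert u A'))"
      proof -
        have "{1..n} - A' = insert t ({1..n} - A)" using A t by auto
        then show ?thesis using A(4) by (simp add: koszul_def)
      qed
      also have "\<dots> = c A + (\<Sum>u\<in>{1..n} - A. (-1) ^ alpha t A' * ((-1) ^ alpha u A' * c (insert u A')))"
        using A by (simp add: distrib_left sum_distrib_left flip: mult.assoc power_add)
      finally have "c A = - (\<Sum>u\<in>{1..n} - A. (-1) ^ alpha t A' * ((-1) ^ alpha u A' * c (insert u A')))"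
        by (simp add: eq_neg_iff_add_eq_0)
      also have "\<dots> = (\<Sum>u\<in>{1..n} - A. (-1) ^ alpha u A * ?h (insert u A))"
        unfolding sum_negf[symmetric]
      proof (intro sum.cong refl)
        fix u assume u: "u \<in> {1..n} - A"
        then have "u \<noteq> t" "u \<notin> A'" using A by auto
        moreover have "insert u (insert t A') - {t} = insert u A'" using A \<open>u \<noteq> t\<close> by auto
        ultimately show "- ((-1) ^ alpha t A' * ((-1) ^ alpha u A' * c (insert u A'))) = (-1) ^ alpha u A * ?h (insert u A)"
          using A by (simp add: alpha_insert)
      qed
      also have "\<dots> = koszul n \<A> ?h A" using True by (simp add: koszul_def)
      finally show ?thesis by simp
    qed
  qed (auto simp: koszul_def dest: supp)
qed

section \<open>The Koszul double complex of a resolution\<close>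

text \<open>The degrees a for which x^a is a nonzero monomial of k[\<Delta>].\<close>

definition sr_degree :: "nat set set \<Rightarrow> mdeg \<Rightarrow> bool" where
  "sr_degree \<Delta> a \<longleftrightarrow> 0 \<le> a \<and> {u. 0 < a u} \<in> \<Delta>"

lemma sqfree_deg_empty [simp]: "sqfree_deg {} = 0"
  by (simp add: sqfree_deg_def fun_eq_iff)

lemma sqfree_deg_insert: "u \<notin> A \<Longrightarrow> sqfree_deg (insert u A) = sqfree_deg A + sqfree_deg {u}"
  by (auto simp: sqfree_deg_def fun_eq_iff)

lemma sqfree_deg_mono: "A \<subseteq> A' \<Longrightarrow> sqfree_deg A \<le> sqfree_deg A'"
  by (auto simp: sqfree_deg_def le_fun_def)

lemma sqfree_deg_in_mdegs: "A \<subseteq> {1..n} \<Longrightarrow> sqfree_deg A \<in> mdegs n"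
  by (auto simp: sqfree_deg_def mdegs_def)

lemma mdegs_diff: "a \<in> mdegs n \<Longrightarrow> b \<in> mdegs n \<Longrightarrow> a - b \<in> mdegs n"
  by (auto simp: mdegs_def)

text \<open>In a homogeneous basis the differential is \<open>b \<mapsto> \<Sum>\<^sub>c M(b,c) x\<^bsup>dg b - dg c\<^esup> c\<close> with scalars \<open>M(b,c)\<close>,
  and the augmentation is \<open>b \<mapsto> e(b) x\<^bsup>dg b\<^esup>\<close>. In degree \<open>a\<close> the resolution is therefore the complex of
  functions supported on the basis elements with \<open>dg b \<le> a\<close>, and \<open>k[\<Delta>]\<close> is \<open>k\<close> or \<open>0\<close> according to
  \<^const>\<open>sr_degree\<close>. The last three assumptions are exactness in degree \<open>a\<close>.\<close>

locale resolution_frame =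
  fixes n :: nat and \<Delta> :: "nat set set"
    and B :: "nat \<Rightarrow> 'm set" and dg :: "nat \<Rightarrow> 'm \<Rightarrow> mdeg"
    and M :: "nat \<Rightarrow> 'm \<Rightarrow> 'm \<Rightarrow> 'k::field" and e :: "'m \<Rightarrow> 'k"
  assumes complex: "simplicial_complex n \<Delta>"
    and fin: "finite (B i)"
    and dg: "b \<in> B i \<Longrightarrow> dg i b \<in> mdegs n"
    and M_nz: "M i b c \<noteq> 0 \<Longrightarrow> b \<in> B (Suc i) \<and> c \<in> B i \<and> dg i c \<le> dg (Suc i) b \<and> dg i c \<noteq> dg (Suc i) b"
    and MM: "(\<Sum>c'\<in>B (Suc i). M (Suc i) b c' * M i c' c) = 0"
    and e_nz: "e b \<noteq> 0 \<Longrightarrow> 0 \<le> dg 0 b"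
    and Me: "a \<in> mdegs n \<Longrightarrow> sr_degree \<Delta> a \<Longrightarrow> b \<in> B (Suc 0) \<Longrightarrow> dg (Suc 0) b \<le> a \<Longrightarrow> (\<Sum>c\<in>B 0. M 0 b c * e c) = 0"
    and surj: "a \<in> mdegs n \<Longrightarrow> sr_degree \<Delta> a \<Longrightarrow>
      \<exists>y. (\<forall>b. y b \<noteq> 0 \<longrightarrow> b \<in> B 0 \<and> dg 0 b \<le> a) \<and> (\<Sum>b\<in>B 0. y b * e b) = 1"
    and exact0: "a \<in> mdegs n \<Longrightarrow> (\<And>b. y b \<noteq> 0 \<Longrightarrow> b \<in> B 0 \<and> dg 0 b \<le> a) \<Longrightarrow>
      (sr_degree \<Delta> a \<Longrightarrow> (\<Sum>b\<in>B 0. y b * e b) = 0) \<Longrightarrow>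
      \<exists>y'. (\<forall>b. y' b \<noteq> 0 \<longrightarrow> b \<in> B (Suc 0) \<and> dg (Suc 0) b \<le> a) \<and> (\<forall>c. (\<Sum>b\<in>B (Suc 0). y' b * M 0 b c) = y c)"
    and exactS: "a \<in> mdegs n \<Longrightarrow> (\<And>b. y b \<noteq> 0 \<Longrightarrow> b \<in> B (Suc i) \<and> dg (Suc i) b \<le> a) \<Longrightarrow>
      (\<And>c. (\<Sum>b\<in>B (Suc i). y b * M i b c) = 0) \<Longrightarrow>
      \<exists>y'. (\<forall>b. y' b \<noteq> 0 \<longrightarrow> b \<in> B (Suc (Suc i)) \<and> dg (Suc (Suc i)) b \<le> a) \<and>
        (\<forall>c. (\<Sum>b\<in>B (Suc (Suc i)). y' b * M (Suc i) b c) = y c)"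
begin

text \<open>The degree \<open>a\<close> part of the double complex: a basis of \<open>X a p q\<close> is given by the elements
  \<open>e\<^sub>A \<otimes> x\<^bsup>a - A - dg b\<^esup> b\<close> with \<open>card A = q\<close> and \<open>b \<in> B p\<close>. Its edges are \<open>E\<close>, the Koszul complex of
  \<open>k[\<Delta>]\<close>, and \<open>P\<close>, the part of \<open>F / m F\<close>.\<close>

definition FA :: "mdeg \<Rightarrow> nat \<Rightarrow> 'm \<Rightarrow> nat set set" where
  "FA a p b = {A. A \<subseteq> {1..n} \<and> dg p b + sqfree_deg A \<le> a}"

definition EA :: "mdeg \<Rightarrow> nat set set" where
  "EA a = {A. A \<subseteq> {1..n} \<and> sr_degree \<Delta> (a - sqfree_deg A)}"

definition X :: "mdeg \<Rightarrow> nat \<Rightarrow> nat \<Rightarrow> ('m \<Rightarrow> nat set \<Rightarrow> 'k) set" where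
  "X a p q = {w. \<forall>b A. w b A \<noteq> 0 \<longrightarrow> b \<in> B p \<and> A \<in> FA a p b \<and> card A = q}"

definition dX :: "nat \<Rightarrow> nat \<Rightarrow> ('m \<Rightarrow> nat set \<Rightarrow> 'k) \<Rightarrow> 'm \<Rightarrow> nat set \<Rightarrow> 'k" where
  "dX p q w c A = (\<Sum>b\<in>B (Suc p). w b A * M p b c)"

definition kX :: "mdeg \<Rightarrow> nat \<Rightarrow> nat \<Rightarrow> ('m \<Rightarrow> nat set \<Rightarrow> 'k) \<Rightarrow> 'm \<Rightarrow> nat set \<Rightarrow> 'k" where
  "kX a p q w b = koszul n (FA a p b) (w b)"

definition E :: "mdeg \<Rightarrow> nat \<Rightarrow> (nat set \<Rightarrow> 'k) set" where
  "E a q = {c. \<forall>A. c A \<noteq> 0 \<longrightarrow> A \<in> EA a \<and> card A = q}"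

definition \<epsilon>X :: "mdeg \<Rightarrow> nat \<Rightarrow> ('m \<Rightarrow> nat set \<Rightarrow> 'k) \<Rightarrow> nat set \<Rightarrow> 'k" where
  "\<epsilon>X a q w A = (if A \<in> EA a then \<Sum>b\<in>B 0. w b A * e b else 0)"

definition P :: "mdeg \<Rightarrow> nat \<Rightarrow> ('m \<Rightarrow> 'k) set" where
  "P a p = {y. \<forall>b. y b \<noteq> 0 \<longrightarrow> b \<in> B p \<and> dg p b = a}"

text \<open>Reduction modulo m: a basis element of degree properly below a occurs in degree a with a
  nonconstant monomial and dies. When its degree equals a there is no room left for any e_A with A
  nonempty.\<close>

definition \<pi>X :: "mdeg \<Rightarrow> nat \<Rightarrow> ('m \<Rightarrow> nat set \<Rightarrow> 'k) \<Rightarrow> 'm \<Rightarrow> 'k" where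
  "\<pi>X a p w b = (if dg p b = a then w b {} else 0)"

section \<open>Exactness of rows and columns in a fixed multidegree\<close>

lemma FA_mono: "A \<in> FA a p b \<Longrightarrow> A' \<subseteq> A \<Longrightarrow> A' \<in> FA a p b"
  using sqfree_deg_mono[of A' A] unfolding FA_def by (auto simp: le_fun_def) (meson add_left_mono order_trans)

lemma FA_iff: "A \<in> FA a p b \<longleftrightarrow> A \<subseteq> {1..n} \<and> dg p b \<le> a - sqfree_deg A"
  by (simp add: FA_def le_fun_def le_diff_eq)

lemma FA_M: "M p b c \<noteq> 0 \<Longrightarrow> A \<in> FA a (Suc p) b \<Longrightarrow> A \<in> FA a p c"
  using M_nz[of p b c] unfolding FA_def by (auto simp: le_fun_def) (meson add_right_mono order_trans)

lemma FA_finite: "A \<in> FA a p b \<Longrightarrow> finite A"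
  by (auto simp: FA_def intro: finite_subset)

lemma FA_card_0: "A \<in> FA a p b \<Longrightarrow> card A = 0 \<longleftrightarrow> A = {}"
  using FA_finite by auto

text \<open>\<open>FA a p b\<close> is closed under subsets, so the guard in \<open>koszul\<close>
  never cuts off a nonzero sum. On \<open>X\<close> the differential is therefore a sum whose index
  set does not depend on b.\<close>

lemma kX_eq:
  assumes "w \<in> X a p q"
  shows "kX a p q' w b A = (\<Sum>u\<in>{1..n} - A. (-1) ^ alpha u A * w b (insert u A))"
proof (cases "A \<in> FA a p b")
  case False
  have "w b (insert u A) = 0" for u
    using assms False FA_mono[of "insert u A" a p b A] by (auto simp: X_def)
  then show ?thesis using False by (simp add: kX_def koszul_def)
qed (simp add: kX_def koszul_def)

text \<open>For fixed A the coefficients form an element of the resolution in degree a - A; all row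
  arguments apply the frame assumptions in that degree.\<close>

lemma X_slice:
  assumes "w \<in> X a p q" "w b A \<noteq> 0"
  shows "b \<in> B p \<and> dg p b \<le> a - sqfree_deg A"
  using assms by (simp add: X_def FA_iff)

lemma X_diff: "x \<in> X a p q \<Longrightarrow> y \<in> X a p q \<Longrightarrow> x - y \<in> X a p q"
  unfolding X_def by (simp add: fun_diff_def) (metis diff_0 neg_equal_0_iff_equal diff_zero)

lemma dX_closed: assumes "x \<in> X a (Suc p) q" shows "dX p q x \<in> X a p q"
  unfolding X_def
proof (clarify)
  fix c A assume "dX p q x c A \<noteq> 0"
  then obtain b where "x b A * M p b c \<noteq> 0" unfolding dX_def by (metis (mono_tags, lifting) sum.neutral)
  then show "c \<in> B p \<and> A \<in> FA a p c \<and> card A = q"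
    using assms M_nz[of p b c] FA_M[of p b c A a] by (auto simp: X_def)
qed

lemma kX_closed: assumes "x \<in> X a p (Suc q)" shows "kX a p q x \<in> X a p q"
  unfolding X_def
proof (clarify)
  fix b A assume nz: "kX a p q x b A \<noteq> 0"
  then have A: "A \<in> FA a p b" by (auto simp: kX_def koszul_def split: if_splits)
  from nz obtain u where u: "u \<in> {1..n} - A" "(-1) ^ alpha u A * x b (insert u A) \<noteq> 0"
    unfolding kX_eq[OF assms] by (metis (mono_tags, lifting) sum.neutral)
  then have "x b (insert u A) \<noteq> 0" by auto
  then have "b \<in> B p" "card (insert u A) = Suc q" using assms by (auto simp: X_def)
  then show "b \<in> B p \<and> A \<in> FA a p b \<and> card A = q" using A FA_finite[OF A] u by auto
qed

lemma FA_sub: "A \<in> FA a p b \<Longrightarrow> A \<subseteq> {1..n}"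
  by (simp add: FA_def)

text \<open>After \<open>kX_eq\<close> the two differentials sum over independent indices, so they
  commute by exchanging finite sums.\<close>

lemma dX_kX: assumes "x \<in> X a (Suc p) (Suc q)"
  shows "dX p q (kX a (Suc p) q x) = kX a p q (dX p (Suc q) x)"
proof (intro ext)
  fix c A
  have "dX p q (kX a (Suc p) q x) c A = (\<Sum>b\<in>B (Suc p). \<Sum>u\<in>{1..n} - A. (-1) ^ alpha u A * x b (insert u A) * M p b c)"
    by (simp add: dX_def kX_eq[OF assms] sum_distrib_right)
  also have "\<dots> = (\<Sum>u\<in>{1..n} - A. \<Sum>b\<in>B (Suc p). (-1) ^ alpha u A * x b (insert u A) * M p b c)"
    by (rule sum.swap)
  also have "\<dots> = kX a p q (dX p (Suc q) x) c A"
    by (simp add: kX_eq[OF dX_closed[OF assms]] dX_def sum_distrib_left mult.assoc)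
  finally show "dX p q (kX a (Suc p) q x) c A = kX a p q (dX p (Suc q) x) c A" .
qed

lemma kX_kX: assumes "x \<in> X a p q" shows "kX a p q' (kX a p q'' x) = 0"
proof (intro ext)
  fix b A
  have "koszul n (FA a p b) (koszul n (FA a p b) (x b)) A = 0"
  proof (rule koszul_koszul)
    show "insert v A' \<in> FA a p b" if "insert u (insert v A') \<in> FA a p b" for A' u v
      using FA_mono[OF that] by blast
    show "A' \<in> FA a p b" if "x b A' \<noteq> 0" for A' using assms that by (simp add: X_def)
  qed (rule FA_sub)
  then show "kX a p q' (kX a p q'' x) b A = 0 b A" by (simp add: kX_def)
qed

lemma dX_dX: "dX p q (dX (Suc p) q x) = 0"
proof (intro ext)
  fix c A
  have "dX p q (dX (Suc p) q x) c A = (\<Sum>b\<in>B (Suc p). \<Sum>b'\<in>B (Suc (Suc p)). x b' A * (M (Suc p) b' b * M p b c))"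
    by (simp add: dX_def sum_distrib_right mult.assoc)
  also have "\<dots> = (\<Sum>b'\<in>B (Suc (Suc p)). \<Sum>b\<in>B (Suc p). x b' A * (M (Suc p) b' b * M p b c))"
    by (rule sum.swap)
  also have "\<dots> = 0" by (simp add: MM flip: sum_distrib_left)
  finally show "dX p q (dX (Suc p) q x) c A = 0 c A" by simp
qed

text \<open>Enlarging A shrinks the support of a - A, which keeps it a face; only nonnegativity can
  be lost.\<close>

lemma EA_conv:
  assumes "A \<in> EA a" "insert u A \<subseteq> {1..n}" "0 \<le> a - sqfree_deg (insert u A)"
  shows "insert u A \<in> EA a"
proof -
  have "{v. 0 < (a - sqfree_deg (insert u A)) v} \<subseteq> {v. 0 < (a - sqfree_deg A) v}"
    by (auto simp: sqfree_deg_def split: if_splits)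
  then show ?thesis using assms complex by (auto simp: EA_def sr_degree_def simplicial_complex_def)
qed

lemma EA_sub: "A \<in> EA a \<Longrightarrow> A \<subseteq> {1..n}"
  by (simp add: EA_def)

text \<open>The guard in \<open>\<epsilon>X\<close> must be harmless at \<open>insert u A\<close>.
  If that set is outside \<open>EA\<close>, then by \<open>EA_conv\<close> the remaining degree has
  a negative entry, whereas a nonzero term needs a basis element b with 0 \<le> dg b \<le> that
  degree.\<close>

lemma \<epsilon>X_kX: assumes "x \<in> X a 0 (Suc q)"
  shows "\<epsilon>X a q (kX a 0 q x) = koszul n (EA a) (\<epsilon>X a (Suc q) x)"
proof
  fix A
  show "\<epsilon>X a q (kX a 0 q x) A = koszul n (EA a) (\<epsilon>X a (Suc q) x) A"
  proof (cases "A \<in> EA a")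
    case True
    have *: "\<epsilon>X a (Suc q) x (insert u A) = (\<Sum>b\<in>B 0. x b (insert u A) * e b)" if "u \<in> {1..n}" for u
    proof (cases "insert u A \<in> EA a")
      case False
      then have F: "\<not> 0 \<le> a - sqfree_deg (insert u A)" using EA_conv True that EA_sub[OF True] by auto
      have "x b (insert u A) * e b = 0" for b
      proof (rule ccontr)
        assume "x b (insert u A) * e b \<noteq> 0"
        then have "dg 0 b \<le> a - sqfree_deg (insert u A)" "0 \<le> dg 0 b" using X_slice[OF assms] e_nz by auto
        then show False using F order_trans by blast
      qed
      then have "(\<Sum>b\<in>B 0. x b (insert u A) * e b) = 0" by (rule sum.neutral[OF ballI])
      then show ?thesis using False by (simp add: \<epsilon>X_def)
    qed (simp add: \<epsilon>X_def)
    have "\<epsilon>X a q (kX a 0 q x) A = (\<Sum>b\<in>B 0. \<Sum>u\<in>{1..n} - A. (-1) ^ alpha u A * x b (insert u A) * e b)"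
      using True by (simp add: \<epsilon>X_def kX_eq[OF assms] sum_distrib_right)
    also have "\<dots> = (\<Sum>u\<in>{1..n} - A. \<Sum>b\<in>B 0. (-1) ^ alpha u A * x b (insert u A) * e b)"
      by (rule sum.swap)
    also have "\<dots> = koszul n (EA a) (\<epsilon>X a (Suc q) x) A"
      using True * by (simp add: koszul_def sum_distrib_left mult.assoc)
    finally show ?thesis .
  qed (simp add: \<epsilon>X_def koszul_def)
qed

lemma \<epsilon>X_dX: assumes a: "a \<in> mdegs n" and x: "x \<in> X a (Suc 0) q"
  shows "\<epsilon>X a q (dX 0 q x) = 0"
proof
  fix A
  show "\<epsilon>X a q (dX 0 q x) A = 0 A"
  proof (cases "A \<in> EA a")
    case True
    have "\<epsilon>X a q (dX 0 q x) A = (\<Sum>c\<in>B 0. \<Sum>b\<in>B (Suc 0). x b A * (M 0 b c * e c))"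
      using True by (simp add: \<epsilon>X_def dX_def sum_distrib_right mult.assoc)
    also have "\<dots> = (\<Sum>b\<in>B (Suc 0). \<Sum>c\<in>B 0. x b A * (M 0 b c * e c))"
      by (rule sum.swap)
    also have "\<dots> = (\<Sum>b\<in>B (Suc 0). x b A * (\<Sum>c\<in>B 0. M 0 b c * e c))"
      by (simp add: sum_distrib_left)
    also have "\<dots> = 0"
    proof (intro sum.neutral ballI)
      fix b assume "b \<in> B (Suc 0)"
      show "x b A * (\<Sum>c\<in>B 0. M 0 b c * e c) = 0"
      proof (cases "x b A = 0")
        case False
        have "a - sqfree_deg A \<in> mdegs n" using a sqfree_deg_in_mdegs EA_sub[OF True] mdegs_diff by blast
        then show ?thesis using Me[of "a - sqfree_deg A" b] True X_slice[OF x False] by (auto simp: EA_def)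
      qed simp
    qed
    finally show ?thesis by simp
  qed (simp add: \<epsilon>X_def)
qed

lemma \<epsilon>X_surj: assumes a: "a \<in> mdegs n" and c: "c \<in> E a q"
  shows "\<exists>x\<in>X a 0 q. \<epsilon>X a q x = c"
proof -
  \<comment> \<open>For each A a preimage of 1 is chosen in degree a - A; scaling it by
    \<open>c A\<close> assembles a preimage of \<open>c\<close>.\<close>
  have "\<exists>y. (\<forall>b. y b \<noteq> 0 \<longrightarrow> b \<in> B 0 \<and> dg 0 b \<le> a - sqfree_deg A) \<and> (\<Sum>b\<in>B 0. y b * e b) = 1"
    if "A \<in> EA a" for A
    using that a surj[of "a - sqfree_deg A"] EA_sub[OF that] mdegs_diff[OF a sqfree_deg_in_mdegs]
    by (auto simp: EA_def)
  then obtain y where y: "\<And>A b. A \<in> EA a \<Longrightarrow> y A b \<noteq> 0 \<Longrightarrow> b \<in> B 0 \<and> dg 0 b \<le> a - sqfree_deg A"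
    "\<And>A. A \<in> EA a \<Longrightarrow> (\<Sum>b\<in>B 0. y A b * e b) = 1" by metis
  have cE: "c A \<noteq> 0 \<Longrightarrow> A \<in> EA a \<and> card A = q" for A using c by (auto simp: E_def)
  show ?thesis
  proof (intro bexI)
    show "\<epsilon>X a q (\<lambda>b A. c A * y A b) = c"
      using y(2) cE by (auto simp: \<epsilon>X_def fun_eq_iff mult.assoc simp flip: sum_distrib_left)
    show "(\<lambda>b A. c A * y A b) \<in> X a 0 q"
      unfolding X_def
    proof clarify
      fix b A assume "c A * y A b \<noteq> 0"
      then have "c A \<noteq> 0" "y A b \<noteq> 0" by auto
      then have "A \<in> EA a" "card A = q" "b \<in> B 0" "dg 0 b \<le> a - sqfree_deg A" using cE y(1) by blast+
      then show "b \<in> B 0 \<and> A \<in> FA a 0 b \<and> card A = q"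
        using EA_sub[of A a] by (simp add: FA_iff)
    qed
  qed
qed

text \<open>The differential \<open>dX\<close> leaves A unchanged, so a preimage can be chosen for
  each A separately, by exactness of the resolution in degree a - A.\<close>

lemma rows_exact_0: assumes a: "a \<in> mdegs n" and x: "x \<in> X a 0 q" "\<epsilon>X a q x = 0"
  shows "\<exists>y\<in>X a (Suc 0) q. dX 0 q y = x"
proof -
  have "\<exists>y. (\<forall>b. y b \<noteq> 0 \<longrightarrow> b \<in> B (Suc 0) \<and> dg (Suc 0) b \<le> a - sqfree_deg A) \<and> (\<forall>c. (\<Sum>b\<in>B (Suc 0). y b * M 0 b c) = x c A)"
    if "A \<subseteq> {1..n}" for A
  proof (rule exact0)
    show "a - sqfree_deg A \<in> mdegs n" by (rule mdegs_diff[OF a sqfree_deg_in_mdegs[OF that]])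
    show "b \<in> B 0 \<and> dg 0 b \<le> a - sqfree_deg A" if "x b A \<noteq> 0" for b using X_slice[OF x(1) that] .
    show "(\<Sum>b\<in>B 0. x b A * e b) = 0" if "sr_degree \<Delta> (a - sqfree_deg A)"
    proof -
      have "\<epsilon>X a q x A = 0" using x(2) by simp
      then show ?thesis using \<open>A \<subseteq> {1..n}\<close> that by (simp add: \<epsilon>X_def EA_def)
    qed
  qed
  then obtain y where y: "\<And>A b. A \<subseteq> {1..n} \<Longrightarrow> y A b \<noteq> 0 \<Longrightarrow> b \<in> B (Suc 0) \<and> dg (Suc 0) b \<le> a - sqfree_deg A"
    "\<And>A c. A \<subseteq> {1..n} \<Longrightarrow> (\<Sum>b\<in>B (Suc 0). y A b * M 0 b c) = x c A" by metis
  \<comment> \<open>At sets of the wrong cardinality the chosen \<open>y A\<close> may be a nonzero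
    kernel element, so it is replaced by 0.\<close>
  define w where "w b A = (if A \<subseteq> {1..n} \<and> card A = q then y A b else 0)" for b A
  have "w \<in> X a (Suc 0) q" using y(1) by (auto simp: w_def X_def FA_iff split: if_splits)
  moreover have "dX 0 q w = x"
  proof (intro ext)
    fix c A
    have "x c A = 0" if "\<not> (A \<subseteq> {1..n} \<and> card A = q)"
      using that x(1) FA_sub[of A a 0 c] unfolding X_def by blast
    then show "dX 0 q w c A = x c A" proof (cases "A \<subseteq> {1..n} \<and> card A = q")
      case True
      then have "w b A = y A b" for b by (simp add: w_def)
      then show ?thesis using y(2)[of A c] True by (simp add: dX_def)
    next
      case False
      then have "w b A = 0" for b unfolding w_def by (rule if_not_P)
      then show ?thesis using False \<open>\<not> (A \<subseteq> {1..n} \<and> card A = q) \<Longrightarrow> x c A = 0\<close> by (simp add: dX_def)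
    qed
  qed
  ultimately show ?thesis by blast
qed

lemma rows_exact_Suc: assumes a: "a \<in> mdegs n" and x: "x \<in> X a (Suc p) q" "dX p q x = 0"
  shows "\<exists>y\<in>X a (Suc (Suc p)) q. dX (Suc p) q y = x"
proof -
  have "\<exists>y. (\<forall>b. y b \<noteq> 0 \<longrightarrow> b \<in> B (Suc (Suc p)) \<and> dg (Suc (Suc p)) b \<le> a - sqfree_deg A) \<and> (\<forall>c. (\<Sum>b\<in>B (Suc (Suc p)). y b * M (Suc p) b c) = x c A)"
    if "A \<subseteq> {1..n}" for A
  proof (rule exactS)
    show "a - sqfree_deg A \<in> mdegs n" by (rule mdegs_diff[OF a sqfree_deg_in_mdegs[OF that]])
    show "b \<in> B (Suc p) \<and> dg (Suc p) b \<le> a - sqfree_deg A" if "x b A \<noteq> 0" for b using X_slice[OF x(1) that] .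
    show "(\<Sum>b\<in>B (Suc p). x b A * M p b c) = 0" for c
      using x(2) by (simp add: dX_def fun_eq_iff)
  qed
  then obtain y where y: "\<And>A b. A \<subseteq> {1..n} \<Longrightarrow> y A b \<noteq> 0 \<Longrightarrow> b \<in> B (Suc (Suc p)) \<and> dg (Suc (Suc p)) b \<le> a - sqfree_deg A"
    "\<And>A c. A \<subseteq> {1..n} \<Longrightarrow> (\<Sum>b\<in>B (Suc (Suc p)). y A b * M (Suc p) b c) = x c A" by metis
  define w where "w b A = (if A \<subseteq> {1..n} \<and> card A = q then y A b else 0)" for b A
  have "w \<in> X a (Suc (Suc p)) q" using y(1) by (auto simp: w_def X_def FA_iff split: if_splits)
  moreover have "dX (Suc p) q w = x"
  proof (intro ext)
    fix c A
    have "x c A = 0" if "\<not> (A \<subseteq> {1..n} \<and> card A = q)"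
      using that x(1) FA_sub[of A a "Suc p" c] unfolding X_def by blast
    then show "dX (Suc p) q w c A = x c A" proof (cases "A \<subseteq> {1..n} \<and> card A = q")
      case True
      then have "w b A = y A b" for b by (simp add: w_def)
      then show ?thesis using y(2)[of A c] True by (simp add: dX_def)
    next
      case False
      then have "w b A = 0" for b unfolding w_def by (rule if_not_P)
      then show ?thesis using False \<open>\<not> (A \<subseteq> {1..n} \<and> card A = q) \<Longrightarrow> x c A = 0\<close> by (simp add: dX_def)
    qed
  qed
  ultimately show ?thesis by blast
qed

text \<open>Each basis element b gives its own Koszul complex. If dg b is smaller than a at a
  coordinate t, there is room to insert t into every A of \<open>FA a p b\<close>, and contraction
  by t applies. If dg b = a, only A = {} is available and \<open>top\<close> removes it.\<close>

lemma columns_exact: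
  assumes a: "a \<in> mdegs n" and x: "x \<in> X a p q" and top: "\<And>b. dg p b = a \<Longrightarrow> x b {} = 0"
    and cyc: "kX a p q' x = 0"
  shows "\<exists>y\<in>X a p (Suc q). kX a p q y = x"
proof -
  define t where "t b = (SOME t. t \<in> {1..n} \<and> dg p b t < a t)" for b
  \<comment> \<open>The test \<open>x b \<noteq> 0\<close> matters: for other b a coordinate with
    room need not exist and \<open>t b\<close> is arbitrary.\<close>
  define y where "y b A = (if x b \<noteq> 0 \<and> t b \<in> A then (-1) ^ alpha (t b) A * x b (A - {t b}) else 0)" for b A
  have t: "t b \<in> {1..n} \<and> dg p b (t b) < a (t b)" if nz: "x b \<noteq> 0" for b
  proof -
    from nz obtain A where A: "x b A \<noteq> 0" by (auto simp: fun_eq_iff)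
    then have bA: "b \<in> B p" "A \<in> FA a p b" using x by (auto simp: X_def)
    then have "{} \<in> FA a p b" using FA_mono by blast
    then have le: "dg p b \<le> a" by (simp add: FA_def sqfree_deg_def zero_fun_def[symmetric] le_fun_def)
    have "dg p b \<noteq> a"
    proof
      assume eq: "dg p b = a"
      then have "sqfree_deg A u \<le> 0" for u using bA(2) by (auto simp: FA_def le_fun_def)
      then have "A = {}" by (force simp: sqfree_deg_def split: if_splits)
      then show False using A top eq by auto
    qed
    then obtain u where u: "dg p b u \<noteq> a u" by blast
    then have "u \<in> {1..n}" using a dg[OF bA(1)] by (auto simp: mdegs_def) (metis)+
    then have "u \<in> {1..n} \<and> dg p b u < a u" using u le by (simp add: le_fun_def order_less_le)
    then show ?thesis unfolding t_def by (rule someI)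
  qed
  have ins: "insert (t b) A \<in> FA a p b" if "x b \<noteq> 0" "A \<in> FA a p b" for b A
    using that t[OF that(1)] unfolding FA_def le_fun_def
    by (auto simp: sqfree_deg_def) (smt (verit, best))+
  have "y \<in> X a p (Suc q)"
    unfolding X_def
  proof clarify
    fix b A assume "y b A \<noteq> 0"
    then have nz: "x b \<noteq> 0" "t b \<in> A" "x b (A - {t b}) \<noteq> 0" by (auto simp: y_def split: if_splits)
    then have 1: "b \<in> B p" "A - {t b} \<in> FA a p b" "card (A - {t b}) = q" using x by (auto simp: X_def)
    have "insert (t b) (A - {t b}) \<in> FA a p b" using ins[OF nz(1) 1(2)] .
    then have "A \<in> FA a p b" using nz(2) by (simp add: insert_absorb)
    moreover have "card A = Suc q" using FA_finite[OF calculation] nz(2) 1(3)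
      by (metis card.remove)
    ultimately show "b \<in> B p \<and> A \<in> FA a p b \<and> card A = Suc q" using 1 by auto
  qed
  moreover have "kX a p q y = x"
  proof
    fix b
    show "kX a p q y b = x b"
    proof (cases "x b = 0")
      case True
      then have "y b = (\<lambda>_. 0)" by (auto simp: y_def)
      then have "kX a p q y b A = 0" for A unfolding kX_def by simp
      then show ?thesis using True by (auto simp: fun_eq_iff)
    next
      case False
      have "koszul n (FA a p b) (x b) = (\<lambda>_. 0)" using cyc by (auto simp: kX_def fun_eq_iff)
      then have "koszul n (FA a p b) (\<lambda>A. if t b \<in> A then (-1) ^ alpha (t b) A * x b (A - {t b}) else 0) = x b"

      proof (intro koszul_contraction)
        show "A \<in> FA a p b" if "x b A \<noteq> 0" for A using x that by (simp add: X_def)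
        show "A - {t b} \<in> FA a p b" if "A \<in> FA a p b" for A using FA_mono[OF that] by blast
      qed (use t[OF False] ins[OF False] FA_sub in blast)+
      moreover have "y b = (\<lambda>A. if t b \<in> A then (-1) ^ alpha (t b) A * x b (A - {t b}) else 0)"
        using False by (intro ext) (simp add: y_def)
      ultimately show ?thesis by (simp add: kX_def)
    qed
  qed
  ultimately show ?thesis by blast
qed

lemma dX_diff: "dX p q (x - y) = dX p q x - dX p q y"
  by (auto simp: fun_eq_iff dX_def left_diff_distrib sum_subtractf)

lemma kX_diff: "kX a p q (x - y) = kX a p q x - kX a p q y"
  by (auto simp: fun_eq_iff kX_def koszul_diff)

lemma \<epsilon>X_diff: "\<epsilon>X a q (x - y) = \<epsilon>X a q x - \<epsilon>X a q y"
  by (auto simp: fun_eq_iff \<epsilon>X_def left_diff_distrib sum_subtractf)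

lemma \<epsilon>X_closed: assumes "x \<in> X a 0 q" shows "\<epsilon>X a q x \<in> E a q"
proof -
  have "card A = q" if "(\<Sum>b\<in>B 0. x b A * e b) \<noteq> 0" for A
  proof -
    have "\<exists>b\<in>B 0. x b A * e b \<noteq> 0" using that by (rule sum.not_neutral_contains_not_neutral) blast
    then show ?thesis using assms by (auto simp: X_def)
  qed
  then show ?thesis by (auto simp: E_def \<epsilon>X_def)
qed

text \<open>This is minimality: a nonzero entry strictly lowers the degree, so nothing of degree at
  most a is mapped onto a basis element of degree a.\<close>

lemma \<pi>X_dX: assumes "x \<in> X a (Suc p) 0" shows "\<pi>X a p (dX p 0 x) = 0"
proof
  fix c
  have "x b {} * M p b c = 0" if "dg p c = a" for b
  proof (rule ccontr)
    assume "x b {} * M p b c \<noteq> 0"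
    then have "dg (Suc p) b \<le> a" "dg p c \<le> dg (Suc p) b" "dg p c \<noteq> dg (Suc p) b"
      using X_slice[OF assms, of b "{}"] M_nz[of p b c] by simp_all
    then show False using that by auto
  qed
  then have "dg p c = a \<Longrightarrow> (\<Sum>b\<in>B (Suc p). x b {} * M p b c) = 0" by (intro sum.neutral) blast
  then show "\<pi>X a p (dX p 0 x) c = 0 c" by (simp add: \<pi>X_def dX_def)
qed

lemma kX_0: assumes "x \<in> X a p 0" shows "kX a p q x = 0"
proof (intro ext)
  fix b A
  have "x b (insert u A) = 0" for u
  proof (rule ccontr)
    assume "x b (insert u A) \<noteq> 0"
    then have "insert u A \<in> FA a p b" "card (insert u A) = 0" using assms unfolding X_def by blast+
    then show False using FA_card_0 by blast
  qed
  then show "kX a p q x b A = 0 b A" by (simp add: kX_eq[OF assms])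
qed

text \<open>A coefficient at e_u requires dg b \<le> a - {u}, so b does not have degree a. In other
  words, every term of the Koszul differential carries a variable.\<close>

lemma \<pi>X_kX: assumes "x \<in> X a p (Suc 0)" shows "\<pi>X a p (kX a p 0 x) = 0"
proof
  fix b
  have "x b {u} = 0" if "dg p b = a" for u
  proof (rule ccontr)
    assume "x b {u} \<noteq> 0"
    then have "dg p b \<le> a - sqfree_deg {u}" using X_slice[OF assms] by blast
    then have "dg p b u \<le> a u - 1" unfolding le_fun_def by (drule_tac x = u in spec) (simp add: sqfree_deg_def)
    then show False using that by simp
  qed
  then show "\<pi>X a p (kX a p 0 x) b = 0 b" by (simp add: \<pi>X_def kX_eq[OF assms])
qed

section \<open>The two orientations of the double complex\<close>

lemma double_complex:
  assumes "a \<in> mdegs n"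
  shows "double_complex (X a) dX (kX a) (E a) (\<epsilon>X a) (\<lambda>q. koszul n (EA a))"
proof
  show "\<exists>y\<in>X a (Suc 0) q. dX 0 q y = x" if "x \<in> X a 0 q" "\<epsilon>X a q x = 0" for x q
    using rows_exact_0[OF assms that] .
  show "\<exists>y\<in>X a (Suc (Suc p)) q. dX (Suc p) q y = x" if "x \<in> X a (Suc p) q" "dX p q x = 0" for x p q
    using rows_exact_Suc[OF assms that] .
  show "\<exists>x\<in>X a 0 q. \<epsilon>X a q x = c" if "c \<in> E a q" for c q
    using \<epsilon>X_surj[OF assms that] .
qed (erule (1) X_diff | erule dX_closed kX_closed dX_kX kX_kX \<epsilon>X_closed \<epsilon>X_kX \<epsilon>X_dX[OF assms] |
    rule dX_diff kX_diff \<epsilon>X_diff)+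

text \<open>With rows and columns exchanged the augmentation is reduction modulo m. The edge
  differential is the zero map, by \<open>\<pi>X_dX\<close>.\<close>

lemma double_complex_transposed:
  assumes "a \<in> mdegs n"
  shows "double_complex (\<lambda>p q. X a q p) (\<lambda>p q. kX a q p) (\<lambda>p q. dX q p) (P a) (\<pi>X a) (\<lambda>_ _. 0)"
proof
  show "\<exists>y\<in>X a q (Suc 0). kX a q 0 y = x" if "x \<in> X a q 0" "\<pi>X a q x = 0" for x q
  proof (rule columns_exact[OF assms that(1) _ kX_0[OF that(1)]])
    fix b assume "dg q b = a"
    then show "x b {} = 0" using fun_cong[OF that(2), of b] by (simp add: \<pi>X_def)
  qed
  show "\<exists>y\<in>X a q (Suc (Suc p)). kX a q (Suc p) y = x" if "x \<in> X a q (Suc p)" "kX a q p x = 0" for x p q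
  proof (rule columns_exact[OF assms that(1) _ that(2)], rule ccontr)
    fix b assume "x b {} \<noteq> 0"
    then have "card ({} :: nat set) = Suc p" using that(1) unfolding X_def by blast
    then show False by simp
  qed
  show "\<exists>x\<in>X a q 0. \<pi>X a q x = y" if y: "y \<in> P a q" for y q
  proof (intro bexI)
    show "\<pi>X a q (\<lambda>b A. if A = {} then y b else 0) = y" using y by (auto simp: \<pi>X_def P_def fun_eq_iff)
    show "(\<lambda>b A. if A = {} then y b else 0) \<in> X a q 0"
      using y by (simp add: X_def P_def FA_def)
  qed
  show "\<pi>X a q x \<in> P a q" if "x \<in> X a q 0" for x q
    using that by (simp add: \<pi>X_def P_def X_def)
  show "\<pi>X a q (x - y) = \<pi>X a q x - \<pi>X a q y" for x y q
    by (simp add: \<pi>X_def fun_eq_iff)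
qed (erule (1) X_diff | erule dX_closed kX_closed dX_kX[symmetric] \<pi>X_kX \<pi>X_dX |
    rule dX_diff kX_diff dX_dX)+

end

section \<open>Zigzags\<close>

context resolution_frame
begin

text \<open>The correspondence between the two computations of Tor_i(k[\<Delta>], k) in degree a: y
  is a class in F_i / m F_i and c a Koszul cycle over k[\<Delta>].\<close>

definition tor :: "mdeg \<Rightarrow> nat \<Rightarrow> ('m \<Rightarrow> 'k) \<Rightarrow> (nat set \<Rightarrow> 'k) \<Rightarrow> bool" where
  "tor a i y c \<longleftrightarrow> (\<exists>w. (\<forall>p q. p + q = i \<longrightarrow> w p \<in> X a p q) \<and>
     (\<forall>p q. Suc (p + q) = i \<longrightarrow> dX p q (w (Suc p)) = kX a p q (w p)) \<and>
     \<pi>X a i (w i) = y \<and> \<epsilon>X a i (w 0) = c)"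

lemma tor_zigzag:
  assumes "a \<in> mdegs n"
  shows "tor a i y c \<longleftrightarrow> (\<exists>w. double_complex.zigzag (X a) dX (kX a) i w \<and> \<pi>X a i (w i) = y \<and> \<epsilon>X a i (w 0) = c)"
  unfolding tor_def double_complex.zigzag_def[OF double_complex[OF assms]] by blast

text \<open>Reading a zigzag backwards exchanges the roles of the two edges, so every chase is used twice.\<close>

lemma tor_zigzag_transposed:
  assumes "a \<in> mdegs n"
  shows "tor a i y c \<longleftrightarrow> (\<exists>w. double_complex.zigzag (\<lambda>p q. X a q p) (\<lambda>p q. kX a q p) (\<lambda>p q. dX q p) i w \<and>
    \<pi>X a i (w 0) = y \<and> \<epsilon>X a i (w i) = c)"
proof
  assume "tor a i y c"
  then obtain w where w: "\<And>p q. p + q = i \<Longrightarrow> w p \<in> X a p q"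
    "\<And>p q. Suc (p + q) = i \<Longrightarrow> dX p q (w (Suc p)) = kX a p q (w p)"
    "\<pi>X a i (w i) = y" "\<epsilon>X a i (w 0) = c" unfolding tor_def by blast
  show "\<exists>w. double_complex.zigzag (\<lambda>p q. X a q p) (\<lambda>p q. kX a q p) (\<lambda>p q. dX q p) i w \<and>
    \<pi>X a i (w 0) = y \<and> \<epsilon>X a i (w i) = c"
    unfolding double_complex.zigzag_def[OF double_complex_transposed[OF assms]]
  proof (intro exI[of _ "\<lambda>p. w (i - p)"] conjI allI impI)
    show "w (i - p) \<in> X a q p" if "p + q = i" for p q
      using w(1)[of q p] that by (auto simp: add.commute)
    show "kX a q p (w (i - Suc p)) = dX q p (w (i - p))" if "Suc (p + q) = i" for p q
    proof -
      have "i - p = Suc q" "i - Suc p = q" using that by auto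
      then show ?thesis using w(2)[of q p] that by (simp add: add.commute)
    qed
  qed (use w in auto)
next
  assume "\<exists>w. double_complex.zigzag (\<lambda>p q. X a q p) (\<lambda>p q. kX a q p) (\<lambda>p q. dX q p) i w \<and>
    \<pi>X a i (w 0) = y \<and> \<epsilon>X a i (w i) = c"
  then obtain w where w: "\<And>p q. p + q = i \<Longrightarrow> w p \<in> X a q p"
    "\<And>p q. Suc (p + q) = i \<Longrightarrow> kX a q p (w (Suc p)) = dX q p (w p)"
    "\<pi>X a i (w 0) = y" "\<epsilon>X a i (w i) = c"
    unfolding double_complex.zigzag_def[OF double_complex_transposed[OF assms]] by blast
  show "tor a i y c"
    unfolding tor_def
  proof (intro exI[of _ "\<lambda>p. w (i - p)"] conjI allI impI)
    show "w (i - p) \<in> X a p q" if "p + q = i" for p q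
      using w(1)[of q p] that by (auto simp: add.commute)
    show "dX p q (w (i - Suc p)) = kX a p q (w (i - p))" if "Suc (p + q) = i" for p q
    proof -
      have "i - p = Suc q" "i - Suc p = q" using that by auto
      then show ?thesis using w(2)[of q p] that by (simp add: add.commute)
    qed
  qed (use w in auto)
qed

lemma tor_E_total:
  assumes a: "a \<in> mdegs n" and c: "c \<in> E a i" "koszul n (EA a) c = 0"
  shows "\<exists>y. tor a i y c"
proof -
  obtain w where "double_complex.zigzag (X a) dX (kX a) i w" "\<epsilon>X a i (w 0) = c"
    using double_complex.zigzag_extend[OF double_complex[OF a] c(1)] c(2) by metis
  then show ?thesis using tor_zigzag[OF a] by blast
qed

text \<open>No cycle condition on y appears because the differential on its edge is zero.\<close>

lemma tor_P_total:
  assumes a: "a \<in> mdegs n" and y: "y \<in> P a i"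
  shows "\<exists>c. tor a i y c"
proof -
  obtain w where "double_complex.zigzag (\<lambda>p q. X a q p) (\<lambda>p q. kX a q p) (\<lambda>p q. dX q p) i w" "\<pi>X a i (w 0) = y"
    using double_complex.zigzag_extend[OF double_complex_transposed[OF a] y] by metis
  then show ?thesis using tor_zigzag_transposed[OF a] by blast
qed

lemma koszul_E_0: "c \<in> E a 0 \<Longrightarrow> koszul n (EA a) c = 0"
proof (intro ext)
  fix A assume c: "c \<in> E a 0"
  have "c (insert u A) = 0" for u
  proof (rule ccontr)
    assume "c (insert u A) \<noteq> 0"
    then have "insert u A \<in> EA a" "card (insert u A) = 0" using c unfolding E_def by blast+
    then show False using EA_sub finite_subset by (metis card_0_eq finite_atLeastAtMost insert_not_empty)
  qed
  then show "koszul n (EA a) c A = 0 A" by (simp add: koszul_def)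
qed

lemma tor_closed:
  assumes a: "a \<in> mdegs n" and t: "tor a i y c"
  shows "y \<in> P a i" "c \<in> E a i" "koszul n (EA a) c = 0"
proof -
  obtain w where z: "double_complex.zigzag (X a) dX (kX a) i w" and w: "\<pi>X a i (w i) = y" "\<epsilon>X a i (w 0) = c"
    using t tor_zigzag[OF a] by blast
  have wX: "w i \<in> X a i 0" "w 0 \<in> X a 0 i" using z double_complex.zigzag_def[OF double_complex[OF a]] by auto
  show "y \<in> P a i" using double_complex.\<epsilon>_closed[OF double_complex_transposed[OF a] wX(1)] w by simp
  show cE: "c \<in> E a i" using \<epsilon>X_closed[OF wX(2)] w by simp
  show "koszul n (EA a) c = 0"
  proof (cases i)
    case 0
    then show ?thesis using koszul_E_0 cE by simp
  next
    case (Suc j)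
    then show ?thesis using double_complex.zigzag_cycle[OF double_complex[OF a]] z w by metis
  qed
qed

text \<open>The end of the zigzag is a Koszul boundary plus an image of the resolution differential,
  and both vanish modulo m. Together with \<open>tor_diff\<close> this shows that y depends only on
  the homology class of c.\<close>

lemma tor_boundary_E:
  assumes a: "a \<in> mdegs n" and t: "tor a i y (koszul n (EA a) c)" and c: "c \<in> E a (Suc i)"
  shows "y = 0"
proof -
  obtain w where z: "double_complex.zigzag (X a) dX (kX a) i w" and w: "\<pi>X a i (w i) = y" "\<epsilon>X a i (w 0) = koszul n (EA a) c"
    using t tor_zigzag[OF a] by blast
  obtain x v where "x \<in> X a i (Suc 0)" "v \<in> X a (Suc i) 0" "w i = kX a i 0 x + dX i 0 v"
    using double_complex.zigzag_boundary[OF double_complex[OF a] z c] w by metis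
  moreover have "\<pi>X a i (f + g) = \<pi>X a i f + \<pi>X a i g" for f g by (auto simp: \<pi>X_def)
  ultimately show ?thesis using w(1) \<pi>X_kX \<pi>X_dX by simp
qed

lemma tor_boundary_P:
  assumes a: "a \<in> mdegs n" and t: "tor a i 0 c"
  shows "\<exists>c'\<in>E a (Suc i). koszul n (EA a) c' = c"
proof -
  obtain w where z: "double_complex.zigzag (\<lambda>p q. X a q p) (\<lambda>p q. kX a q p) (\<lambda>p q. dX q p) i w"
    and w: "\<pi>X a i (w 0) = 0" "\<epsilon>X a i (w i) = c"
    using t tor_zigzag_transposed[OF a] by blast
  \<comment> \<open>On this edge 0 is the only boundary, and it is the image of 0.\<close>
  have "0 \<in> P a (Suc i)" by (simp add: P_def)
  then obtain v x where "v \<in> X a (Suc 0) i" "x \<in> X a 0 (Suc i)" "w i = dX 0 i v + kX a 0 i x"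
    using double_complex.zigzag_boundary[OF double_complex_transposed[OF a] z, of 0] w by metis
  moreover have "\<epsilon>X a i (f + g) = \<epsilon>X a i f + \<epsilon>X a i g" for f g
    by (auto simp: \<epsilon>X_def fun_eq_iff sum.distrib distrib_right)
  ultimately have "koszul n (EA a) (\<epsilon>X a (Suc i) x) = c" using w(2) \<epsilon>X_kX \<epsilon>X_dX[OF a] by simp
  then show ?thesis using \<epsilon>X_closed[OF \<open>x \<in> X a 0 (Suc i)\<close>] by blast
qed

lemma tor_diff:
  assumes "tor a i y c" "tor a i y' c'"
  shows "tor a i (y - y') (c - c')"
proof -
  from assms obtain w w' where w: "\<And>p q. p + q = i \<Longrightarrow> w p \<in> X a p q"
    "\<And>p q. Suc (p + q) = i \<Longrightarrow> dX p q (w (Suc p)) = kX a p q (w p)"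
    "\<pi>X a i (w i) = y" "\<epsilon>X a i (w 0) = c"
    and w': "\<And>p q. p + q = i \<Longrightarrow> w' p \<in> X a p q"
    "\<And>p q. Suc (p + q) = i \<Longrightarrow> dX p q (w' (Suc p)) = kX a p q (w' p)"
    "\<pi>X a i (w' i) = y'" "\<epsilon>X a i (w' 0) = c'" unfolding tor_def by blast
  show ?thesis unfolding tor_def
  proof (intro exI[of _ "\<lambda>p. w p - w' p"] conjI allI impI)
    show "w p - w' p \<in> X a p q" if "p + q = i" for p q by (rule X_diff[OF w(1)[OF that] w'(1)[OF that]])
    show "dX p q (w (Suc p) - w' (Suc p)) = kX a p q (w p - w' p)" if "Suc (p + q) = i" for p q
      by (simp only: dX_diff kX_diff w(2)[OF that] w'(2)[OF that])
    show "\<pi>X a i (w i - w' i) = y - y'" by (auto simp: \<pi>X_def fun_eq_iff simp flip: w w')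
    show "\<epsilon>X a i (w 0 - w' 0) = c - c'" by (simp only: \<epsilon>X_diff w w')
  qed
qed

lemma tor_smult:
  assumes "tor a i y c"
  shows "tor a i (\<lambda>b. r * y b) (\<lambda>A. r * c A)"
proof -
  from assms obtain w where w: "\<And>p q. p + q = i \<Longrightarrow> w p \<in> X a p q"
    "\<And>p q. Suc (p + q) = i \<Longrightarrow> dX p q (w (Suc p)) = kX a p q (w p)"
    "\<pi>X a i (w i) = y" "\<epsilon>X a i (w 0) = c" unfolding tor_def by blast
  show ?thesis unfolding tor_def
  proof (intro exI[of _ "\<lambda>p b A. r * w p b A"] conjI allI impI)
    show "(\<lambda>b A. r * w p b A) \<in> X a p q" if "p + q = i" for p q using w(1)[OF that] by (simp add: X_def) blast
    show "dX p q (\<lambda>b A. r * w (Suc p) b A) = kX a p q (\<lambda>b A. r * w p b A)" if "Suc (p + q) = i" for p q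
    proof (intro ext)
      fix b A
      have "dX p q (\<lambda>b A. r * w (Suc p) b A) b A = r * dX p q (w (Suc p)) b A"
        by (simp add: dX_def sum_distrib_left mult.assoc)
      then show "dX p q (\<lambda>b A. r * w (Suc p) b A) b A = kX a p q (\<lambda>b A. r * w p b A) b A"
        by (simp add: w(2)[OF that] kX_def koszul_smult)
    qed
    show "\<pi>X a i (\<lambda>b A. r * w i b A) = (\<lambda>b. r * y b)" by (auto simp: \<pi>X_def fun_eq_iff simp flip: w(3))
    show "\<epsilon>X a i (\<lambda>b A. r * w 0 b A) = (\<lambda>A. r * c A)"
      by (auto simp: \<epsilon>X_def fun_eq_iff sum_distrib_left mult.assoc simp flip: w(4))
  qed
qed

lemma tor_add:
  assumes "tor a i y c" "tor a i y' c'"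
  shows "tor a i (y + y') (c + c')"
  using tor_diff[OF assms(1) tor_smult[OF assms(2), of "-1"]] by (simp add: fun_diff_def plus_fun_def)

text \<open>Contraction with e_u commutes with the differential of the resolution and anticommutes
  with the Koszul differential. With signs (-1)^p on the terms it carries zigzags in degree a to
  zigzags in degree a - {u}. The last zigzag equation identifies the new end with the entries of the
  differential that are multiples of x_u, applied to y.\<close>

lemma tor_contract:
  assumes t: "tor a (Suc i) y c" and u: "u \<in> {1..n}"
  defines "a' \<equiv> a - sqfree_deg {u}"
  shows "tor a' i (\<lambda>b. (-1) ^ i * (if dg i b = a' then \<Sum>b'\<in>B (Suc i). y b' * M i b' b else 0))
    (\<lambda>A. if u \<in> A then 0 else (-1) ^ alpha u A * c (insert u A))"
proof -
  from t obtain w where w: "\<And>p q. p + q = Suc i \<Longrightarrow> w p \<in> X a p q"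
    "\<And>p q. p + q = i \<Longrightarrow> dX p q (w (Suc p)) = kX a p q (w p)"
    "\<pi>X a (Suc i) (w (Suc i)) = y" "\<epsilon>X a (Suc i) (w 0) = c" unfolding tor_def by blast
  \<comment> \<open>The factor (-1)^p compensates for the anticommutation; at p = i it is the sign
    in front of the resulting class.\<close>
  define v where "v p b A = (-1) ^ p * (if u \<in> A then 0 else (-1) ^ alpha u A * w p b (insert u A))" for p b A
  have ins: "a' - sqfree_deg A = a - sqfree_deg (insert u A)" if "u \<notin> A" for A
    using sqfree_deg_insert[OF that] by (simp add: a'_def algebra_simps)
  have vX: "v p \<in> X a' p q" if pq: "p + q = i" for p q
    unfolding X_def
  proof clarify
    fix b A assume "v p b A \<noteq> 0"
    then have uA: "u \<notin> A" "w p b (insert u A) \<noteq> 0" by (auto simp: v_def split: if_splits)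
    then have 1: "b \<in> B p" "insert u A \<in> FA a p b" "card (insert u A) = Suc q"
      using w(1)[of p "Suc q"] pq by (simp_all add: X_def)
    have "finite A" using FA_finite[OF 1(2)] by simp
    then show "b \<in> B p \<and> A \<in> FA a' p b \<and> card A = q" using 1 uA(1) ins[OF uA(1)] by (simp add: FA_iff)
  qed
  show ?thesis unfolding tor_def
  proof (intro exI[of _ v] conjI allI impI)
    show "v p \<in> X a' p q" if "p + q = i" for p q by (rule vX[OF that])
    show "dX p q (v (Suc p)) = kX a' p q (v p)" if pq: "Suc (p + q) = i" for p q
    proof (intro ext)
      fix b A
      have kv: "kX a' p q (v p) b A = (\<Sum>z\<in>{1..n} - A. (-1) ^ alpha z A * v p b (insert z A))"
        using pq by (intro kX_eq[OF vX[of p "Suc q"]]) simp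
      show "dX p q (v (Suc p)) b A = kX a' p q (v p) b A"
      proof (cases "u \<in> A")
        case True
        then show ?thesis unfolding kv by (simp add: dX_def v_def)
      next
        case False
        show ?thesis
        proof (cases "finite A")
          \<comment> \<open>The sign rule for \<open>alpha\<close> counts elements of a finite set.
            At infinite sets all coefficients vanish, so both sides are 0.\<close>
          case infA: False
          have "w p' b' (insert u A') = 0" if "p' \<le> Suc p" "A \<subseteq> A'" for b' A' p'
          proof (rule ccontr)
            assume "w p' b' (insert u A') \<noteq> 0"
            then have "insert u A' \<in> FA a p' b'" using w(1)[of p' "Suc i - p'"] pq that(1) by (simp add: X_def)
            then have "finite (insert u A')" by (rule FA_finite)
            then show False using infA that(2) finite_subset[of A A'] by simp
          qed
          then have "v p' b' A' = 0" if "p' \<le> Suc p" "A \<subseteq> A'" for b' A' p' using that by (simp add: v_def)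
          then show ?thesis unfolding kv by (simp add: dX_def subset_insertI)
        next
          case finA: True
          have "dX p q (v (Suc p)) b A = (-1) ^ Suc p * ((-1) ^ alpha u A * dX p (Suc q) (w (Suc p)) b (insert u A))"
            using False by (simp add: dX_def v_def sum_distrib_left mult_ac sum_negf)
          also have "dX p (Suc q) (w (Suc p)) b (insert u A) = (\<Sum>z\<in>{1..n} - insert u A. (-1) ^ alpha z (insert u A) * w p b (insert z (insert u A)))"
            using w(2)[of p "Suc q"] kX_eq[OF w(1)[of p "Suc (Suc q)"]] pq by simp
          finally have "dX p q (v (Suc p)) b A = (\<Sum>z\<in>{1..n} - insert u A.
              (-1) ^ Suc p * ((-1) ^ alpha u A * ((-1) ^ alpha z (insert u A) * w p b (insert z (insert u A)))))"
            by (simp add: sum_distrib_left)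
          also have "\<dots> = (\<Sum>z\<in>{1..n} - insert u A. (-1) ^ alpha z A * v p b (insert z A))"
          proof (intro sum.cong refl)
            fix z assume z: "z \<in> {1..n} - insert u A"
            \<comment> \<open>Exactly one of the two insertions shifts an \<open>alpha\<close>, in
              either order. This gives the additional sign that turns (-1)^(p+1) into
              (-1)^p.\<close>
            then have "z < u \<or> u < z" by auto
            then show "(-1) ^ Suc p * ((-1) ^ alpha u A * ((-1) ^ alpha z (insert u A) * w p b (insert z (insert u A)))) =
              (-1) ^ alpha z A * v p b (insert z A)"
              using z False finA by (auto simp: v_def alpha_insert insert_commute)
          qed
          also have "\<dots> = (\<Sum>z\<in>{1..n} - A. (-1) ^ alpha z A * v p b (insert z A))"
            by (rule sum.mono_neutral_left) (auto simp: v_def)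
          finally show ?thesis unfolding kv .
        qed
      qed
    qed
    show "\<pi>X a' i (v i) = (\<lambda>b. (-1) ^ i * (if dg i b = a' then \<Sum>b'\<in>B (Suc i). y b' * M i b' b else 0))"
    proof
      fix b
      have "v i b {} = (-1) ^ i * (\<Sum>b'\<in>B (Suc i). y b' * M i b' b)" if b: "dg i b = a'"
      proof -
        have "(\<Sum>b'\<in>B (Suc i). y b' * M i b' b) = dX i 0 (w (Suc i)) b {}"
          unfolding dX_def
        proof (intro sum.cong refl)
          fix b' assume "b' \<in> B (Suc i)"
          show "y b' * M i b' b = w (Suc i) b' {} * M i b' b"
          proof (cases "w (Suc i) b' {} = 0 \<or> M i b' b = 0")
            case True
            then show ?thesis by (auto simp: \<pi>X_def simp flip: w(3))
          next
            case False
            \<comment> \<open>The degree of b' lies between a - {u} and a and differs from a - {u},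
              so it equals a. Hence the coefficient of w at b' is already recorded in y.\<close>
            have "dg (Suc i) b' \<le> a" using X_slice[OF w(1)[of "Suc i" 0], of b' "{}"] False by simp
            moreover have "a' \<le> dg (Suc i) b'" "a' \<noteq> dg (Suc i) b'" using M_nz[of i b' b] False b by auto
            ultimately have le: "dg (Suc i) b' x \<le> a x" "a' x \<le> dg (Suc i) b' x" for x by (auto simp: le_fun_def)
            have eq: "dg (Suc i) b' x = a x" if "x \<noteq> u" for x using le[of x] that by (simp add: a'_def sqfree_deg_def)
            have "dg (Suc i) b' u \<noteq> a' u"
            proof
              assume "dg (Suc i) b' u = a' u"
              then have "a' = dg (Suc i) b'" using eq by (auto simp: a'_def sqfree_deg_def fun_eq_iff)
              then show False using \<open>a' \<noteq> dg (Suc i) b'\<close> by simp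
            qed
            then have "dg (Suc i) b' u = a u" using le[of u] by (simp add: a'_def sqfree_deg_def)
            then have "dg (Suc i) b' = a" using eq by (metis ext)
            then show ?thesis by (simp add: \<pi>X_def flip: w(3))
          qed
        qed
        also have "\<dots> = (\<Sum>z\<in>{1..n}. (-1) ^ alpha z {} * w i b {z})"
          using w(2)[of i 0] kX_eq[OF w(1)[of i "Suc 0"]] by simp
        \<comment> \<open>A basis element of degree a - {u} has room in degree a only for
          e_u.\<close>
        also have "\<dots> = (\<Sum>z\<in>{1..n}. if z = u then w i b {u} else 0)"
        proof (intro sum.cong refl)
          fix z assume "z \<in> {1..n}"
          have "w i b {z} = 0" if "z \<noteq> u"
          proof (rule ccontr)
            assume "w i b {z} \<noteq> 0"
            then have "a' \<le> a - sqfree_deg {z}" using X_slice[OF w(1)[of i "Suc 0"], of b "{z}"] b by simp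
            then have "a' z \<le> a z - 1" by (simp add: le_fun_def sqfree_deg_def split: if_splits)
            then show False using that by (simp add: a'_def sqfree_deg_def)
          qed
          then show "(-1) ^ alpha z {} * w i b {z} = (if z = u then w i b {u} else 0)" by (auto simp: alpha_def)
        qed
        also have "\<dots> = w i b {u}" using u by simp
        finally show ?thesis by (simp add: v_def alpha_def)
      qed
      then show "\<pi>X a' i (v i) b = (-1) ^ i * (if dg i b = a' then \<Sum>b'\<in>B (Suc i). y b' * M i b' b else 0)"
        by (simp add: \<pi>X_def)
    qed
    show "\<epsilon>X a' i (v 0) = (\<lambda>A. if u \<in> A then 0 else (-1) ^ alpha u A * c (insert u A))"
    proof
      fix A
      show "\<epsilon>X a' i (v 0) A = (if u \<in> A then 0 else (-1) ^ alpha u A * c (insert u A))"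
      proof (cases "u \<in> A")
        case False
        then have "A \<in> EA a' \<longleftrightarrow> insert u A \<in> EA a" using ins[OF False] u by (simp add: EA_def)
        then show ?thesis using False
          by (simp add: \<epsilon>X_def v_def sum_distrib_left mult.assoc flip: w(4))
      qed (simp add: \<epsilon>X_def v_def)
    qed
  qed
qed

text \<open>A degree that is not squarefree has a negative entry, and then the complex is empty, or
  an entry a_t \<ge> 2. In the second case both a_t and a_t - 1 are positive, so membership of A in
  \<open>EA a\<close> is independent of t and contraction by t applies.\<close>

lemma E_acyclic:
  assumes a: "a \<in> mdegs n" and nsq: "\<And>U. U \<subseteq> {1..n} \<Longrightarrow> a \<noteq> sqfree_deg U"
    and c: "c \<in> E a i" "koszul n (EA a) c = 0"
  shows "\<exists>c'\<in>E a (Suc i). koszul n (EA a) c' = c"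
proof (cases "0 \<le> a")
  case False
  have "0 \<le> a" if "0 \<le> a - sqfree_deg A" for A
  proof -
    have "0 \<le> sqfree_deg A" by (auto simp: le_fun_def sqfree_deg_def)
    then show ?thesis using that by (auto simp: le_fun_def) (meson order_trans)
  qed
  then have "EA a = {}" using False by (auto simp: EA_def sr_degree_def)
  then have "c = 0" using c(1) by (auto simp: E_def fun_eq_iff)
  then show ?thesis by (intro bexI[of _ 0]) (auto simp: E_def fun_eq_iff koszul_def)
next
  case True
  have "\<exists>t. a t \<ge> 2"
  proof (rule ccontr)
    assume "\<not> (\<exists>t. a t \<ge> 2)"
    then have le: "a t \<in> {0, 1}" for t using True by (auto simp: le_fun_def not_le) (smt (verit))
    have "a = sqfree_deg {t. a t = 1}" using le by (auto simp: sqfree_deg_def fun_eq_iff)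
    moreover have "{t. a t = 1} \<subseteq> {1..n}" using a by (force simp: mdegs_def)
    ultimately show False using nsq by blast
  qed
  then obtain t where t: "a t \<ge> 2" by blast
  have tn: "t \<in> {1..n}" using t a by (force simp: mdegs_def)
  have EA: "A \<in> EA a \<longleftrightarrow> A - {t} \<in> EA a" "insert t A \<in> EA a \<longleftrightarrow> A - {t} \<in> EA a" for A
  proof -
    have *: "A \<in> EA a \<longleftrightarrow> A' \<in> EA a" if AA: "A - {t} = A' - {t}" for A A'
    proof -
      have s: "sqfree_deg A v = sqfree_deg A' v" if "v \<noteq> t" for v using AA that by (auto simp: sqfree_deg_def)
      have p: "0 < a t - sqfree_deg A t" "0 < a t - sqfree_deg A' t" using t by (auto simp: sqfree_deg_def)
      have "{v. 0 < (a - sqfree_deg A) v} = {v. 0 < (a - sqfree_deg A') v}" using s p by (auto, metis+)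
      moreover have "0 \<le> a - sqfree_deg A \<longleftrightarrow> 0 \<le> a - sqfree_deg A'" using s p unfolding le_fun_def
        by (metis fun_diff_def less_imp_le zero_fun_apply)
      moreover have "A \<subseteq> {1..n} \<longleftrightarrow> A' \<subseteq> {1..n}" using AA tn by blast
      ultimately show ?thesis by (simp add: EA_def sr_degree_def)
    qed
    show "A \<in> EA a \<longleftrightarrow> A - {t} \<in> EA a" "insert t A \<in> EA a \<longleftrightarrow> A - {t} \<in> EA a" by (rule *, blast)+
  qed
  let ?c' = "\<lambda>A. if t \<in> A then (-1) ^ alpha t A * c (A - {t}) else 0"
  have "koszul n (EA a) ?c' = c"
  proof (rule koszul_contraction[OF EA_sub tn])
    show "insert t A \<in> EA a" if "A \<in> EA a" for A using EA that by blast
    show "A - {t} \<in> EA a" if "A \<in> EA a" for A using EA that by blast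
    show "A \<in> EA a" if "c A \<noteq> 0" for A using c(1) that by (simp add: E_def)
    show "koszul n (EA a) c = (\<lambda>_. 0)" using c(2) by (simp add: fun_eq_iff)
  qed
  moreover have "?c' \<in> E a (Suc i)"
    unfolding E_def
  proof clarify
    fix A assume nz: "?c' A \<noteq> 0"
    then have "t \<in> A" "c (A - {t}) \<noteq> 0" by (auto split: if_splits)
    then have "A - {t} \<in> EA a" "card (A - {t}) = i" using c by (auto simp: E_def)
    then have "A \<in> EA a" using EA by blast
    then have "finite A" using EA_sub finite_subset by blast
    then show "A \<in> EA a \<and> card A = Suc i" using \<open>t \<in> A\<close> \<open>A \<in> EA a\<close> \<open>card (A - {t}) = i\<close> by (metis card.remove)
  qed
  ultimately show ?thesis by blast
qed

text \<open>The basis element b is a nonzero class of F / m F in its own degree. By the zigzag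
  correspondence the Koszul homology there cannot vanish, whereas \<open>E_acyclic\<close> makes it
  vanish outside squarefree degrees.\<close>

lemma degrees_squarefree:
  assumes b: "b \<in> B i"
  shows "\<exists>U\<subseteq>{1..n}. dg i b = sqfree_deg U"
proof (rule ccontr)
  assume "\<not> ?thesis"
  then have nsq: "\<And>U. U \<subseteq> {1..n} \<Longrightarrow> dg i b \<noteq> sqfree_deg U" by blast
  have a: "dg i b \<in> mdegs n" using dg[OF b] .
  define y where "y b' = (if b' = b then 1 else 0 :: 'k)" for b'
  have "y \<in> P (dg i b) i" using b by (auto simp: P_def y_def)
  then obtain c where c: "tor (dg i b) i y c" using tor_P_total[OF a] by blast
  obtain c' where "c' \<in> E (dg i b) (Suc i)" "koszul n (EA (dg i b)) c' = c"
    using E_acyclic[OF a nsq tor_closed(2,3)[OF a c]] by blast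
  then have "y = 0" using tor_boundary_E[OF a] c by blast
  then have "y b = 0" by simp
  then show False by (simp add: y_def)
qed

end

section \<open>Koszul cycles and cohomology classes\<close>

text \<open>The coset is formed for an arbitrary function, so that sums, multiples and equality of
  classes can be computed without cocycle hypotheses.\<close>

definition coh_class :: "nat set set \<Rightarrow> int \<Rightarrow> (nat set \<Rightarrow> 'k::field) \<Rightarrow> (nat set \<Rightarrow> 'k) set" where
  "coh_class \<Gamma> j \<phi> = coboundaries \<Gamma> j +>\<^bsub>cocycle_space \<Gamma> j\<^esub> \<phi>"

section \<open>Cohomology classes as cosets, and their restriction\<close>

lemma coboundary_diff: "coboundary \<Gamma> j (\<phi> - \<psi>) = coboundary \<Gamma> j \<phi> - coboundary \<Gamma> j \<psi>"
  by (auto simp: coboundary_def fun_eq_iff sum_subtractf algebra_simps)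

lemma coboundary_smult: "coboundary \<Gamma> j (\<lambda>F. r * \<phi> F) = (\<lambda>F. r * coboundary \<Gamma> j \<phi> F)"
  by (auto simp: coboundary_def fun_eq_iff sum_distrib_left mult_ac)

lemma cochains_diff: "\<phi> \<in> cochains \<Gamma> j \<Longrightarrow> \<psi> \<in> cochains \<Gamma> j \<Longrightarrow> \<phi> - \<psi> \<in> cochains \<Gamma> j"
  by (auto simp: cochains_def)

lemma cochains_smult: "\<phi> \<in> cochains \<Gamma> j \<Longrightarrow> (\<lambda>F. r * \<phi> F) \<in> cochains \<Gamma> j"
  by (auto simp: cochains_def)

lemma coboundaries_diff:
  assumes "\<phi> \<in> coboundaries \<Gamma> j" "\<psi> \<in> coboundaries \<Gamma> j"
  shows "\<phi> - \<psi> \<in> coboundaries \<Gamma> j"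
  using assms cochains_diff unfolding coboundaries_def by (force simp flip: coboundary_diff)

lemma coboundaries_smult:
  assumes "\<phi> \<in> coboundaries \<Gamma> j"
  shows "(\<lambda>F. r * \<phi> F) \<in> coboundaries \<Gamma> j"
  using assms cochains_smult unfolding coboundaries_def by (force simp flip: coboundary_smult)

lemma coboundaries_0: "0 \<in> coboundaries \<Gamma> j"
proof -
  have "0 \<in> cochains \<Gamma> (j - 1)" "coboundary \<Gamma> (j - 1) 0 = 0" by (auto simp: cochains_def coboundary_def fun_eq_iff)
  then show ?thesis unfolding coboundaries_def by (metis image_eqI)
qed

lemma coboundaries_uminus: "\<phi> \<in> coboundaries \<Gamma> j \<Longrightarrow> - \<phi> \<in> coboundaries \<Gamma> j"
  using coboundaries_diff[OF coboundaries_0] by fastforce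

lemma coboundaries_add: "\<phi> \<in> coboundaries \<Gamma> j \<Longrightarrow> \<psi> \<in> coboundaries \<Gamma> j \<Longrightarrow> \<phi> + \<psi> \<in> coboundaries \<Gamma> j"
  using coboundaries_diff[OF _ coboundaries_uminus] by fastforce

lemma in_coh_class: "\<psi> \<in> coh_class \<Gamma> j \<phi> \<longleftrightarrow> \<psi> - \<phi> \<in> coboundaries \<Gamma> j"
proof -
  have "coh_class \<Gamma> j \<phi> = {\<beta> + \<phi> | \<beta>. \<beta> \<in> coboundaries \<Gamma> j}"
    by (auto simp: coh_class_def a_r_coset_def' cocycle_space_def mk_module_def plus_fun_def)
  then show ?thesis by (auto simp: diff_eq_eq)
qed

lemma coh_class_eq: "coh_class \<Gamma> j \<phi> = coh_class \<Gamma> j \<psi> \<longleftrightarrow> \<phi> - \<psi> \<in> coboundaries \<Gamma> j"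
proof
  assume "coh_class \<Gamma> j \<phi> = coh_class \<Gamma> j \<psi>"
  moreover have "\<phi> \<in> coh_class \<Gamma> j \<phi>" by (simp add: in_coh_class coboundaries_0)
  ultimately show "\<phi> - \<psi> \<in> coboundaries \<Gamma> j" by (simp add: in_coh_class)
next
  assume *: "\<phi> - \<psi> \<in> coboundaries \<Gamma> j"
  show "coh_class \<Gamma> j \<phi> = coh_class \<Gamma> j \<psi>"
  proof (rule Set.set_eqI)
    fix \<chi>
    have "\<chi> - \<psi> = (\<chi> - \<phi>) + (\<phi> - \<psi>)" "\<chi> - \<phi> = (\<chi> - \<psi>) - (\<phi> - \<psi>)" by simp_all
    then show "\<chi> \<in> coh_class \<Gamma> j \<phi> \<longleftrightarrow> \<chi> \<in> coh_class \<Gamma> j \<psi>"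
      unfolding in_coh_class using * coboundaries_add coboundaries_diff by metis
  qed
qed

lemma cohomology_carrier: "carrier (cohomology \<Gamma> j) = coh_class \<Gamma> j ` cocycles \<Gamma> j"
  by (auto simp: cohomology_def quot_module_def mk_module_def A_RCOSETS_def' coh_class_def cocycle_space_def)

lemma cohomology_zero: "\<zero>\<^bsub>cohomology \<Gamma> j\<^esub> = coh_class \<Gamma> j 0"
  by (auto simp: cohomology_def quot_module_def mk_module_def in_coh_class)

lemma cohomology_add:
  "coh_class \<Gamma> j \<phi> \<oplus>\<^bsub>cohomology \<Gamma> j\<^esub> coh_class \<Gamma> j \<psi> = coh_class \<Gamma> j (\<phi> + \<psi>)"
proof -
  have "coh_class \<Gamma> j \<phi> \<oplus>\<^bsub>cohomology \<Gamma> j\<^esub> coh_class \<Gamma> j \<psi> = {x + y | x y. x \<in> coh_class \<Gamma> j \<phi> \<and> y \<in> coh_class \<Gamma> j \<psi>}"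
    by (auto simp: cohomology_def quot_module_def mk_module_def set_add_def' cocycle_space_def plus_fun_def)
  also have "\<dots> = coh_class \<Gamma> j (\<phi> + \<psi>)"
  proof (intro Set.set_eqI iffI)
    fix \<chi> assume "\<chi> \<in> {x + y | x y. x \<in> coh_class \<Gamma> j \<phi> \<and> y \<in> coh_class \<Gamma> j \<psi>}"
    then obtain x y where "\<chi> = x + y" "x - \<phi> \<in> coboundaries \<Gamma> j" "y - \<psi> \<in> coboundaries \<Gamma> j"
      by (auto simp: in_coh_class)
    moreover have "x + y - (\<phi> + \<psi>) = (x - \<phi>) + (y - \<psi>)" by simp
    ultimately show "\<chi> \<in> coh_class \<Gamma> j (\<phi> + \<psi>)" unfolding in_coh_class using coboundaries_add by metis
  next
    fix \<chi> assume "\<chi> \<in> coh_class \<Gamma> j (\<phi> + \<psi>)"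
    then have "\<chi> - \<psi> \<in> coh_class \<Gamma> j \<phi>" by (simp add: in_coh_class algebra_simps)
    moreover have "\<psi> \<in> coh_class \<Gamma> j \<psi>" by (simp add: in_coh_class coboundaries_0)
    moreover have "\<chi> = (\<chi> - \<psi>) + \<psi>" by simp
    ultimately show "\<chi> \<in> {x + y | x y. x \<in> coh_class \<Gamma> j \<phi> \<and> y \<in> coh_class \<Gamma> j \<psi>}" by blast
  qed
  finally show ?thesis .
qed

text \<open>Scalar multiplication is defined as a union over all representatives; these cosets
  coincide because coboundaries are closed under scalars.\<close>

lemma cohomology_smult:
  "r \<odot>\<^bsub>cohomology \<Gamma> j\<^esub> coh_class \<Gamma> j \<phi> = coh_class \<Gamma> j (\<lambda>F. r * \<phi> F)"
proof -
  have "r \<odot>\<^bsub>cohomology \<Gamma> j\<^esub> coh_class \<Gamma> j \<phi> = (\<Union>\<psi>\<in>coh_class \<Gamma> j \<phi>. coh_class \<Gamma> j (\<lambda>F. r * \<psi> F))"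
    by (simp add: cohomology_def quot_module_def mk_module_def coh_class_def[of _ _ "\<lambda>F. r * _ F"]) (simp add: cocycle_space_def mk_module_def)
  also have "\<phi> \<in> coh_class \<Gamma> j \<phi>" by (simp add: in_coh_class coboundaries_0)
  have "coh_class \<Gamma> j (\<lambda>F. r * \<psi> F) = coh_class \<Gamma> j (\<lambda>F. r * \<phi> F)" if "\<psi> \<in> coh_class \<Gamma> j \<phi>" for \<psi>
    using coboundaries_smult[OF that[unfolded in_coh_class], of r]
    by (simp add: coh_class_eq fun_diff_def right_diff_distrib)
  then have "(\<Union>\<psi>\<in>coh_class \<Gamma> j \<phi>. coh_class \<Gamma> j (\<lambda>F. r * \<psi> F)) = coh_class \<Gamma> j (\<lambda>F. r * \<phi> F)"
    using \<open>\<phi> \<in> coh_class \<Gamma> j \<phi>\<close> by blast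
  finally show ?thesis .
qed

lemma int_card_Diff: "finite F \<Longrightarrow> i \<in> F \<Longrightarrow> int (card (F - {i})) = int (card F) - 1"
  using card_Suc_Diff1[of F i] by simp

text \<open>Restriction is a cochain map: \<Gamma> is closed under subsets, so every facet of a face
  of \<Gamma> is still visible after restricting.\<close>

lemma coboundary_restrict:
  assumes "\<Gamma> \<subseteq> \<Gamma>'" and down: "\<And>F G. F \<in> \<Gamma> \<Longrightarrow> G \<subseteq> F \<Longrightarrow> G \<in> \<Gamma>" and fin: "\<And>F. F \<in> \<Gamma> \<Longrightarrow> finite F"
  shows "(\<lambda>F. if F \<in> faces \<Gamma> (j + 1) then coboundary \<Gamma>' j \<phi> F else 0) =
    coboundary \<Gamma> j (\<lambda>F. if F \<in> faces \<Gamma> j then \<phi> F else 0)"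
proof
  fix F
  have "F - {i} \<in> faces \<Gamma> j" if "F \<in> faces \<Gamma> (j + 1)" "i \<in> F" for i
    using that down[of F "F - {i}"] fin[of F] int_card_Diff[of F i] by (auto simp: faces_def)
  moreover have "F \<in> faces \<Gamma>' (j + 1)" if "F \<in> faces \<Gamma> (j + 1)" using that assms(1) by (auto simp: faces_def)
  ultimately show "(if F \<in> faces \<Gamma> (j + 1) then coboundary \<Gamma>' j \<phi> F else 0) =
    coboundary \<Gamma> j (\<lambda>F. if F \<in> faces \<Gamma> j then \<phi> F else 0) F"
    by (simp add: coboundary_def)
qed

text \<open>Two representatives differ by a coboundary, whose restriction is again a coboundary. The
  union in \<open>restrict_class\<close> is thus a union of equal cosets.\<close>

lemma restrict_class_coh_class:
  assumes "\<Gamma> \<subseteq> \<Gamma>'" and "\<And>F G. F \<in> \<Gamma> \<Longrightarrow> G \<subseteq> F \<Longrightarrow> G \<in> \<Gamma>" and "\<And>F. F \<in> \<Gamma> \<Longrightarrow> finite F"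
  shows "restrict_class \<Gamma> j (coh_class \<Gamma>' j \<phi>) = coh_class \<Gamma> j (\<lambda>F. if F \<in> faces \<Gamma> j then \<phi> F else 0)"
proof -
  let ?r = "\<lambda>\<psi> F. if F \<in> faces \<Gamma> j then \<psi> F else (0::'a)"
  have "coh_class \<Gamma> j (?r \<psi>) = coh_class \<Gamma> j (?r \<phi>)" if \<psi>: "\<psi> \<in> coh_class \<Gamma>' j \<phi>" for \<psi>
  proof -
    obtain \<chi> where \<chi>: "\<psi> - \<phi> = coboundary \<Gamma>' (j - 1) \<chi>"
      using \<psi> by (auto simp: in_coh_class coboundaries_def)
    have "?r \<psi> - ?r \<phi> = ?r (\<psi> - \<phi>)" by auto
    also have "\<dots> = coboundary \<Gamma> (j - 1) (\<lambda>F. if F \<in> faces \<Gamma> (j - 1) then \<chi> F else 0)"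
    proof -
      have "(\<lambda>F. if F \<in> faces \<Gamma> (j - 1 + 1) then coboundary \<Gamma>' (j - 1) \<chi> F else 0) =
        coboundary \<Gamma> (j - 1) (\<lambda>F. if F \<in> faces \<Gamma> (j - 1) then \<chi> F else 0)"
        by (rule coboundary_restrict[OF assms(1)]) (fact assms(2) assms(3))+
      then show ?thesis unfolding \<chi> by simp
    qed
    finally show ?thesis unfolding coh_class_eq coboundaries_def by (auto simp: cochains_def)
  qed
  moreover have "\<phi> \<in> coh_class \<Gamma>' j \<phi>" by (simp add: in_coh_class coboundaries_0)
  moreover have "restrict_class \<Gamma> j (coh_class \<Gamma>' j \<phi>) = (\<Union>\<psi>\<in>coh_class \<Gamma>' j \<phi>. coh_class \<Gamma> j (?r \<psi>))"
    by (simp add: restrict_class_def coh_class_def[of \<Gamma>])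
  ultimately show ?thesis by blast
qed

lemma alpha_insert_Diff: "finite U \<Longrightarrow> u \<in> U \<Longrightarrow> alpha t U = alpha t (U - {u}) + (if u < t then 1 else 0)"
  using alpha_insert[of "U - {u}" u t] by (simp add: insert_absorb)

lemma alpha_Un:
  assumes "finite A" "finite A'" "A \<inter> A' = {}"
  shows "alpha t (A \<union> A') = alpha t A + alpha t A'"
proof -
  have "{k \<in> A \<union> A'. k < t} = {k \<in> A. k < t} \<union> {k \<in> A'. k < t}" by auto
  then show ?thesis using assms card_Un_disjoint[of "{k \<in> A. k < t}" "{k \<in> A'. k < t}"] by (auto simp: alpha_def)
qed

text \<open>Each a in A is counted once beyond its value for U - {u}: in \<open>alpha a U\<close> if
  u < a, and in \<open>alpha u A\<close> if a < u. With card A = i this is the parity that cancels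
  the sign (-1)^i of \<open>tor_contract\<close>.\<close>

lemma sum_alpha_Diff:
  assumes "finite U" "u \<in> U" "A \<subseteq> U - {u}"
  shows "(\<Sum>a\<in>A. alpha a U) + alpha u A = (\<Sum>a\<in>A. alpha a (U - {u})) + card A"
proof -
  have finA: "finite A" using assms finite_subset by blast
  have "(\<Sum>a\<in>A. alpha a U) = (\<Sum>a\<in>A. alpha a (U - {u})) + (\<Sum>a\<in>A. if u < a then 1 else 0)"
    unfolding sum.distrib[symmetric] by (intro sum.cong refl alpha_insert_Diff assms)
  also have "(\<Sum>a\<in>A. if u < a then 1 else 0) = card {a \<in> A. u < a}"
    using finA by (simp add: sum.If_cases Int_def)
  finally have "(\<Sum>a\<in>A. alpha a U) = (\<Sum>a\<in>A. alpha a (U - {u})) + card {a \<in> A. u < a}" .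
  moreover have "card {a \<in> A. u < a} + alpha u A = card ({a \<in> A. u < a} \<union> {a \<in> A. a < u})"
    unfolding alpha_def using finA by (subst card_Un_disjoint) auto
  moreover have "{a \<in> A. u < a} \<union> {a \<in> A. a < u} = A" using assms by auto
  ultimately show ?thesis by simp
qed

section \<open>Koszul cycles in squarefree degrees as cochains, and the map to cohomology\<close>

context resolution_frame
begin

text \<open>The sign \<open>(-1)\<^bsup>\<Sum>\<^sub>a \<alpha>(a,U)\<^esup>\<close> over \<open>a \<in> U - F\<close> turns the Koszul differential into the coboundary
  because \<open>\<alpha>(u,F) + \<alpha>(u,U - F) = \<alpha>(u,U)\<close>.\<close>

definition to_cochain :: "nat set \<Rightarrow> (nat set \<Rightarrow> 'k) \<Rightarrow> nat set \<Rightarrow> 'k" where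
  "to_cochain U c F = (if F \<subseteq> U then (-1) ^ (\<Sum>a\<in>U - F. alpha a U) * c (U - F) else 0)"

lemma EA_sqfree:
  assumes "U \<subseteq> {1..n}"
  shows "A \<in> EA (sqfree_deg U) \<longleftrightarrow> A \<subseteq> U \<and> U - A \<in> \<Delta>"
proof -
  have 1: "0 \<le> sqfree_deg U - sqfree_deg A \<longleftrightarrow> A \<subseteq> U" by (auto simp: le_fun_def sqfree_deg_def)
  have 2: "{u. 0 < (sqfree_deg U - sqfree_deg A) u} = U - A" by (auto simp: sqfree_deg_def)
  show ?thesis unfolding EA_def mem_Collect_eq sr_degree_def 1 2 using assms by auto
qed

lemma down: "F \<in> restriction \<Delta> U \<Longrightarrow> G \<subseteq> F \<Longrightarrow> G \<in> restriction \<Delta> U"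
  using complex by (auto simp: restriction_def simplicial_complex_def)

lemma finite_face: "F \<in> restriction \<Delta> U \<Longrightarrow> finite F"
  using complex by (auto simp: restriction_def simplicial_complex_def intro: finite_subset)

lemma EA_faces:
  assumes U: "U \<subseteq> {1..n}" and F: "F \<subseteq> U"
  shows "F \<in> faces (restriction \<Delta> U) (int (card U) - int i - 1) \<longleftrightarrow> U - F \<in> EA (sqfree_deg U) \<and> card (U - F) = i"
proof -
  have "finite U" using U finite_subset by blast
  then have "card (U - F) + card F = card U" using F by (metis card_Diff_subset card_mono finite_subset le_add_diff_inverse2)
  moreover have "U - (U - F) = F" using F by auto
  ultimately show ?thesis using F by (auto simp: faces_def restriction_def EA_sqfree[OF U])
qed

lemma to_cochain_closed:
  assumes U: "U \<subseteq> {1..n}" and c: "c \<in> E (sqfree_deg U) i"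
  shows "to_cochain U c \<in> cochains (restriction \<Delta> U) (int (card U) - int i - 1)"
  using c by (auto simp: cochains_def to_cochain_def E_def EA_faces[OF U])

lemma to_cochain_diff: "to_cochain U (c - c') = to_cochain U c - to_cochain U c'"
  by (auto simp: to_cochain_def right_diff_distrib)

lemma to_cochain_add: "to_cochain U (c + c') = to_cochain U c + to_cochain U c'"
  by (auto simp: to_cochain_def distrib_left)

lemma to_cochain_smult: "to_cochain U (\<lambda>A. r * c A) = (\<lambda>F. r * to_cochain U c F)"
  by (auto simp: to_cochain_def)

lemma to_cochain_0: "to_cochain U 0 = 0"
  by (auto simp: to_cochain_def)

lemma to_cochain_inj:
  assumes U: "U \<subseteq> {1..n}" and c: "c \<in> E (sqfree_deg U) i" and 0: "to_cochain U c = 0"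
  shows "c = 0"
proof (rule ext, rule ccontr)
  fix A assume "c A \<noteq> 0 A"
  then have "c A \<noteq> 0" by simp
  then have "A \<subseteq> U" using c EA_sqfree[OF U] by (auto simp: E_def)
  then have "to_cochain U c (U - A) \<noteq> 0" using \<open>c A \<noteq> 0\<close> by (simp add: to_cochain_def double_diff)
  then show False using 0 by simp
qed

lemma to_cochain_surj:
  assumes U: "U \<subseteq> {1..n}" and \<phi>: "\<phi> \<in> cochains (restriction \<Delta> U) (int (card U) - int i - 1)"
  shows "\<exists>c\<in>E (sqfree_deg U) i. to_cochain U c = \<phi>"
proof
  \<comment> \<open>The signs square to 1, so the inverse passes to complements and multiplies by
    the same sign.\<close>
  let ?c = "\<lambda>A. if A \<subseteq> U then (-1) ^ (\<Sum>a\<in>A. alpha a U) * \<phi> (U - A) else 0"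
  have supp: "\<phi> F \<noteq> 0 \<Longrightarrow> F \<in> faces (restriction \<Delta> U) (int (card U) - int i - 1)" for F
    using \<phi> by (auto simp: cochains_def)
  then have "\<phi> F \<noteq> 0 \<Longrightarrow> F \<subseteq> U" for F by (fastforce simp: faces_def restriction_def)
  then show "to_cochain U ?c = \<phi>"
    by (auto simp: to_cochain_def fun_eq_iff double_diff simp flip: mult.assoc power_add)
  show "?c \<in> E (sqfree_deg U) i"
    unfolding E_def
  proof clarify
    fix A assume "?c A \<noteq> 0"
    then have "A \<subseteq> U" "\<phi> (U - A) \<noteq> 0" by (auto split: if_splits)
    then show "A \<in> EA (sqfree_deg U) \<and> card A = i" using supp[of "U - A"] EA_faces[OF U, of "U - A" i] by (simp add: double_diff)
  qed
qed

lemma koszul_closed: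
  assumes c: "c \<in> E a (Suc i)"
  shows "koszul n (EA a) c \<in> E a i"
  unfolding E_def
proof clarify
  fix A assume nz: "koszul n (EA a) c A \<noteq> 0"
  then have A: "A \<in> EA a" by (auto simp: koszul_def split: if_splits)
  have "\<exists>u\<in>{1..n} - A. (-1) ^ alpha u A * c (insert u A) \<noteq> 0"
    using nz A unfolding koszul_def by (metis (no_types, lifting) sum.neutral)
  then obtain u where u: "u \<in> {1..n} - A" "c (insert u A) \<noteq> 0" by auto
  then have "card (insert u A) = Suc i" using c by (auto simp: E_def)
  moreover have "finite A" using EA_sub[OF A] finite_subset by blast
  ultimately show "A \<in> EA a \<and> card A = i" using A u by auto
qed

lemma coboundary_to_cochain:
  assumes U: "U \<subseteq> {1..n}" and c: "c \<in> E (sqfree_deg U) i"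
  shows "coboundary (restriction \<Delta> U) (int (card U) - int i - 1) (to_cochain U c) =
    to_cochain U (koszul n (EA (sqfree_deg U)) c)"
proof
  fix F
  let ?j = "int (card U) - int i - 1"
  let ?\<A> = "EA (sqfree_deg U)"
  have finU: "finite U" using U finite_subset by blast
  show "coboundary (restriction \<Delta> U) ?j (to_cochain U c) F = to_cochain U (koszul n ?\<A> c) F"
  proof (cases "F \<in> faces (restriction \<Delta> U) (?j + 1)")
    case False
    have "koszul n ?\<A> c (U - F) = 0" if "F \<subseteq> U"
    \<comment> \<open>Off the faces of the target dimension both sides are 0. For i = 0 there is no
      lower Koszul degree, and the differential itself is zero.\<close>
    proof (cases i)
      case 0
      then show ?thesis using koszul_E_0[of c "sqfree_deg U"] c by simp
    next
      case (Suc i')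
      have j: "?j + 1 = int (card U) - int i' - 1" using Suc by simp
      have "\<not> (U - F \<in> ?\<A> \<and> card (U - F) = i')"
        using False[unfolded j] unfolding EA_faces[OF U that] .
      then show ?thesis using koszul_closed[of c "sqfree_deg U" i'] c Suc unfolding E_def by blast
    qed
    then show ?thesis using False by (simp add: coboundary_def to_cochain_def)
  next
    case True
    then have F: "F \<subseteq> U" "F \<in> \<Delta>" by (auto simp: faces_def restriction_def)
    have A: "U - F \<in> ?\<A>" using F EA_sqfree[OF U] by (simp add: double_diff)
    have finF: "finite F" using F finU finite_subset by blast
    have "to_cochain U (koszul n ?\<A> c) F = (\<Sum>u\<in>{1..n} - (U - F). (-1) ^ (\<Sum>a\<in>U - F. alpha a U) * ((-1) ^ alpha u (U - F) * c (insert u (U - F))))"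
      using F A by (simp add: to_cochain_def koszul_def sum_distrib_left)
    \<comment> \<open>An index u outside U contributes nothing, because x_u does not divide the
      monomial of degree U; the remaining indices are the vertices of F.\<close>
    also have "\<dots> = (\<Sum>u\<in>F. (-1) ^ (\<Sum>a\<in>U - F. alpha a U) * ((-1) ^ alpha u (U - F) * c (insert u (U - F))))"
    proof (rule sum.mono_neutral_right)
      show "\<forall>u\<in>{1..n} - (U - F) - F. (-1) ^ (\<Sum>a\<in>U - F. alpha a U) * ((-1) ^ alpha u (U - F) * c (insert u (U - F))) = 0"
      proof
        fix u assume "u \<in> {1..n} - (U - F) - F"
        then have "\<not> insert u (U - F) \<subseteq> U" by blast
        then have "c (insert u (U - F)) = 0" using c EA_sqfree[OF U] by (auto simp: E_def)
        then show "(-1) ^ (\<Sum>a\<in>U - F. alpha a U) * ((-1) ^ alpha u (U - F) * c (insert u (U - F))) = 0" by simp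
      qed
    qed (use F U in auto)
    also have "\<dots> = (\<Sum>u\<in>F. (-1) ^ alpha u F * to_cochain U c (F - {u}))"
    proof (intro sum.cong refl)
      fix u assume u: "u \<in> F"
      have 1: "U - (F - {u}) = insert u (U - F)" "F - {u} \<subseteq> U" using u F by auto
      have 2: "(\<Sum>a\<in>insert u (U - F). alpha a U) = alpha u U + (\<Sum>a\<in>U - F. alpha a U)"
        using u finU by simp
      have "alpha u U = alpha u F + alpha u (U - F)"
        using alpha_Un[of F "U - F" u] F finF finU by (simp add: Un_absorb1)
      then have "(-1::'k) ^ alpha u F * (-1) ^ (\<Sum>a\<in>insert u (U - F). alpha a U) = (-1) ^ (\<Sum>a\<in>U - F. alpha a U) * (-1) ^ alpha u (U - F)"
        unfolding 2 by (simp add: power_add)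
      then show "(-1) ^ (\<Sum>a\<in>U - F. alpha a U) * ((-1) ^ alpha u (U - F) * c (insert u (U - F))) = (-1) ^ alpha u F * to_cochain U c (F - {u})"
        using 1 by (simp add: to_cochain_def flip: mult.assoc)
    qed
    finally show ?thesis using True by (simp add: coboundary_def)
  qed
qed

lemma cocycles_eq:
  assumes U: "U \<subseteq> {1..n}"
  shows "cocycles (restriction \<Delta> U) (int (card U) - int i - 1) =
    to_cochain U ` {c \<in> E (sqfree_deg U) i. koszul n (EA (sqfree_deg U)) c = 0}"
proof (intro Set.set_eqI iffI)
  fix \<phi> :: "nat set \<Rightarrow> 'k" assume \<phi>: "\<phi> \<in> cocycles (restriction \<Delta> U) (int (card U) - int i - 1)"
  then obtain c where c: "c \<in> E (sqfree_deg U) i" "to_cochain U c = \<phi>"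
    using to_cochain_surj[OF U] by (auto simp: cocycles_def)
  have "to_cochain U (koszul n (EA (sqfree_deg U)) c) = 0"
    using \<phi> coboundary_to_cochain[OF U c(1)] c(2) by (simp add: cocycles_def zero_fun_def)
  then have "koszul n (EA (sqfree_deg U)) c = 0"
    using to_cochain_inj[OF U koszul_closed] koszul_E_0 c(1) by (cases i) auto
  then show "\<phi> \<in> to_cochain U ` {c \<in> E (sqfree_deg U) i. koszul n (EA (sqfree_deg U)) c = 0}" using c by blast
next
  fix \<phi> assume "\<phi> \<in> to_cochain U ` {c \<in> E (sqfree_deg U) i. koszul n (EA (sqfree_deg U)) c = 0}"
  then show "\<phi> \<in> cocycles (restriction \<Delta> U) (int (card U) - int i - 1)"
    using to_cochain_closed[OF U] coboundary_to_cochain[OF U] to_cochain_0 by (auto simp: cocycles_def zero_fun_def)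
qed

lemma coboundaries_eq:
  assumes U: "U \<subseteq> {1..n}"
  shows "coboundaries (restriction \<Delta> U) (int (card U) - int i - 1) =
    to_cochain U ` koszul n (EA (sqfree_deg U)) ` E (sqfree_deg U) (Suc i)"
proof -
  \<comment> \<open>Passing to complements reverses degrees: one cochain degree lower is one Koszul
    degree higher.\<close>
  have j: "int (card U) - int i - 1 - 1 = int (card U) - int (Suc i) - 1" by simp
  have E: "cochains (restriction \<Delta> U) (int (card U) - int (Suc i) - 1) = to_cochain U ` E (sqfree_deg U) (Suc i)"
    using to_cochain_surj[OF U] to_cochain_closed[OF U] by blast
  show ?thesis unfolding coboundaries_def j E image_image
    by (rule image_cong[OF refl coboundary_to_cochain[OF U]])
qed

text \<open>The isomorphism from the degree U part of F_i / m F_i to reduced cohomology of the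
  restriction to U. The choice of the related Koszul cycle is immaterial by
  \<open>tor_boundary_P\<close>.\<close>

definition \<Psi> :: "nat \<Rightarrow> nat set \<Rightarrow> ('m \<Rightarrow> 'k) \<Rightarrow> (nat set \<Rightarrow> 'k) set" where
  "\<Psi> i U y = coh_class (restriction \<Delta> U) (int (card U) - int i - 1)
     (to_cochain U (SOME c. tor (sqfree_deg U) i y c))"

lemma \<Psi>_eq:
  assumes U: "U \<subseteq> {1..n}" and t: "tor (sqfree_deg U) i y c"
  shows "\<Psi> i U y = coh_class (restriction \<Delta> U) (int (card U) - int i - 1) (to_cochain U c)"
proof -
  have "tor (sqfree_deg U) i y (SOME c. tor (sqfree_deg U) i y c)" using someI[of "tor (sqfree_deg U) i y", OF t] .
  then have "tor (sqfree_deg U) i 0 ((SOME c. tor (sqfree_deg U) i y c) - c)" using tor_diff[OF _ t] by fastforce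
  then obtain c' where "c' \<in> E (sqfree_deg U) (Suc i)"
    "koszul n (EA (sqfree_deg U)) c' = (SOME c. tor (sqfree_deg U) i y c) - c"
    using tor_boundary_P[OF sqfree_deg_in_mdegs[OF U]] by blast
  then show ?thesis
    unfolding \<Psi>_def coh_class_eq coboundaries_eq[OF U] to_cochain_diff[symmetric] by (metis image_eqI)
qed

text \<open>Equal classes mean that the related cycles differ by a Koszul boundary, and
  \<open>tor_boundary_E\<close> then forces y - y' = 0.\<close>

lemma \<Psi>_diff:
  assumes U: "U \<subseteq> {1..n}" and y: "y \<in> P (sqfree_deg U) i" "y' \<in> P (sqfree_deg U) i" and eq: "\<Psi> i U y = \<Psi> i U y'"
  shows "y = y'"
proof -
  note a = sqfree_deg_in_mdegs[OF U]
  obtain c c' where t: "tor (sqfree_deg U) i y c" "tor (sqfree_deg U) i y' c'" using tor_P_total[OF a] y by metis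
  have "to_cochain U (c - c') \<in> coboundaries (restriction \<Delta> U) (int (card U) - int i - 1)"
    using eq \<Psi>_eq[OF U t(1)] \<Psi>_eq[OF U t(2)] by (simp add: coh_class_eq to_cochain_diff)
  then obtain d where d: "d \<in> E (sqfree_deg U) (Suc i)" "to_cochain U (c - c') = to_cochain U (koszul n (EA (sqfree_deg U)) d)"
    by (auto simp: coboundaries_eq[OF U])
  have td: "tor (sqfree_deg U) i (y - y') (c - c')" using tor_diff t by blast
  have E_diff: "u - v \<in> E (sqfree_deg U) i" if "u \<in> E (sqfree_deg U) i" "v \<in> E (sqfree_deg U) i" for u v
    using that unfolding E_def by (simp add: fun_diff_def) (metis diff_0_right diff_self)
  have "c - c' - koszul n (EA (sqfree_deg U)) d = 0"
    by (rule to_cochain_inj[OF U E_diff[OF tor_closed(2)[OF a td] koszul_closed[OF d(1)]]])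
       (use d(2) in \<open>simp add: to_cochain_diff\<close>)
  then have eqc: "c - c' = koszul n (EA (sqfree_deg U)) d" by simp
  have "y - y' = 0" by (rule tor_boundary_E[OF a td[unfolded eqc] d(1)])
  then show ?thesis by simp
qed

lemma \<Psi>_add:
  assumes U: "U \<subseteq> {1..n}" and y: "y \<in> P (sqfree_deg U) i" "y' \<in> P (sqfree_deg U) i"
  shows "\<Psi> i U (y + y') = \<Psi> i U y \<oplus>\<^bsub>coh \<Delta> i U\<^esub> \<Psi> i U y'"
proof -
  obtain c c' where t: "tor (sqfree_deg U) i y c" "tor (sqfree_deg U) i y' c'"
    using tor_P_total[OF sqfree_deg_in_mdegs[OF U]] y by metis
  show ?thesis using \<Psi>_eq[OF U t(1)] \<Psi>_eq[OF U t(2)] \<Psi>_eq[OF U tor_add[OF t]]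
    by (simp add: coh_def cohomology_add to_cochain_add)
qed

lemma \<Psi>_smult:
  assumes U: "U \<subseteq> {1..n}" and y: "y \<in> P (sqfree_deg U) i"
  shows "\<Psi> i U (\<lambda>b. r * y b) = r \<odot>\<^bsub>coh \<Delta> i U\<^esub> \<Psi> i U y"
proof -
  obtain c where t: "tor (sqfree_deg U) i y c"
    using tor_P_total[OF sqfree_deg_in_mdegs[OF U]] y by metis
  show ?thesis using \<Psi>_eq[OF U t] \<Psi>_eq[OF U tor_smult[OF t]]
    by (simp add: coh_def cohomology_smult to_cochain_smult)
qed

lemma \<Psi>_bij:
  assumes U: "U \<subseteq> {1..n}"
  shows "bij_betw (\<Psi> i U) (P (sqfree_deg U) i) (carrier (coh \<Delta> i U))"
  unfolding bij_betw_def
proof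
  note a = sqfree_deg_in_mdegs[OF U]
  show "inj_on (\<Psi> i U) (P (sqfree_deg U) i)" using \<Psi>_diff[OF U] by (rule inj_onI)
  show "\<Psi> i U ` P (sqfree_deg U) i = carrier (coh \<Delta> i U)"
    unfolding coh_def cohomology_carrier cocycles_eq[OF U]
  proof (intro Set.set_eqI iffI)
    fix \<omega> assume "\<omega> \<in> \<Psi> i U ` P (sqfree_deg U) i"
    then obtain y where y: "y \<in> P (sqfree_deg U) i" "\<omega> = \<Psi> i U y" by blast
    then obtain c where c: "tor (sqfree_deg U) i y c" using tor_P_total[OF a] by blast
    then show "\<omega> \<in> coh_class (restriction \<Delta> U) (int (card U) - int i - 1) `
      to_cochain U ` {c \<in> E (sqfree_deg U) i. koszul n (EA (sqfree_deg U)) c = 0}"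
      using \<Psi>_eq[OF U c] y tor_closed[OF a c] by blast
  next
    fix \<omega> assume "\<omega> \<in> coh_class (restriction \<Delta> U) (int (card U) - int i - 1) `
      to_cochain U ` {c \<in> E (sqfree_deg U) i. koszul n (EA (sqfree_deg U)) c = 0}"
    then obtain c where c: "c \<in> E (sqfree_deg U) i" "koszul n (EA (sqfree_deg U)) c = 0"
      "\<omega> = coh_class (restriction \<Delta> U) (int (card U) - int i - 1) (to_cochain U c)" by blast
    then obtain y where t: "tor (sqfree_deg U) i y c" using tor_E_total[OF a] by blast
    then show "\<omega> \<in> \<Psi> i U ` P (sqfree_deg U) i" using \<Psi>_eq[OF U t] c(3) tor_closed[OF a t] by blast
  qed
qed

text \<open>Contracting the zigzag of y with e_u realizes the x_u-part of the differential on one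
  edge. On the other edge it deletes u from the Koszul sets that contain it, which leaves the
  complementary face F unchanged: this is restriction to U - {u}. Only the signs remain to be
  compared.\<close>

lemma \<Psi>_restrict:
  assumes U: "U \<subseteq> {1..n}" and u: "u \<in> U" and y: "y \<in> P (sqfree_deg U) (Suc i)"
  shows "\<Psi> i (U - {u}) (\<lambda>b. if dg i b = sqfree_deg (U - {u}) then \<Sum>b'\<in>B (Suc i). y b' * M i b' b else 0) =
    (-1) ^ alpha u U \<odot>\<^bsub>coh \<Delta> i (U - {u})\<^esub> restrict_class (restriction \<Delta> (U - {u})) (int (card U) - int i - 2) (\<Psi> (Suc i) U y)"
proof -
  let ?V = "U - {u}"
  let ?\<Gamma> = "restriction \<Delta> ?V"
  let ?j = "int (card U) - int i - 2"
  have finU: "finite U" using U finite_subset by blast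
  have V: "?V \<subseteq> {1..n}" and un: "u \<in> {1..n}" using U u by auto
  have cV: "int (card ?V) - int i - 1 = ?j" using int_card_Diff[OF finU u] by simp
  have cU: "int (card U) - int (Suc i) - 1 = ?j" by simp
  have deg: "sqfree_deg U - sqfree_deg {u} = sqfree_deg ?V" using u by (auto simp: sqfree_deg_def)
  obtain c where t: "tor (sqfree_deg U) (Suc i) y c" using tor_P_total[OF sqfree_deg_in_mdegs[OF U] y] by blast
  have cE: "c \<in> E (sqfree_deg U) (Suc i)" by (rule tor_closed(2)[OF sqfree_deg_in_mdegs[OF U] t])
  define z where "z b = (if dg i b = sqfree_deg ?V then \<Sum>b'\<in>B (Suc i). y b' * M i b' b else 0)" for b
  define c' where "c' A = (if u \<in> A then 0 else (-1) ^ alpha u A * c (insert u A))" for A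
  have "tor (sqfree_deg ?V) i (\<lambda>b. (-1) ^ i * z b) c'"
    using tor_contract[OF t un] unfolding deg z_def c'_def .
  \<comment> \<open>A second factor (-1)^i clears the sign on the y-side and moves it to the
    cocycle.\<close>
  then have "tor (sqfree_deg ?V) i (\<lambda>b. (-1) ^ i * ((-1) ^ i * z b)) (\<lambda>A. (-1) ^ i * c' A)" by (rule tor_smult)
  then have "tor (sqfree_deg ?V) i z (\<lambda>A. (-1) ^ i * c' A)" by (simp flip: mult.assoc power_add)
  then have "\<Psi> i ?V z = coh_class ?\<Gamma> ?j (to_cochain ?V (\<lambda>A. (-1) ^ i * c' A))"
    using \<Psi>_eq[OF V, of i z] unfolding cV by blast
  also have "to_cochain ?V (\<lambda>A. (-1) ^ i * c' A) = (\<lambda>F. (-1) ^ alpha u U * (if F \<in> faces ?\<Gamma> ?j then to_cochain U c F else 0))"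
  proof
    fix F
    show "to_cochain ?V (\<lambda>A. (-1) ^ i * c' A) F = (-1) ^ alpha u U * (if F \<in> faces ?\<Gamma> ?j then to_cochain U c F else 0)"
    proof (cases "F \<subseteq> ?V")
      case False
      then show ?thesis by (auto simp: to_cochain_def faces_def restriction_def)
    next
      case True
      let ?A = "?V - F"
      have A: "u \<notin> ?A" "insert u ?A = U - F" "F \<subseteq> U" using True u by auto
      show ?thesis
      proof (cases "c (U - F) = 0")
        case True
        then show ?thesis using A by (simp add: to_cochain_def c'_def)
      next
        case False
        then have F: "U - F \<in> EA (sqfree_deg U)" "card (U - F) = Suc i" using cE by (auto simp: E_def)
        then have "F \<in> faces (restriction \<Delta> U) ?j" using EA_faces[OF U A(3), of "Suc i"] cU by simp
        then have Ff: "F \<in> faces ?\<Gamma> ?j" using True by (auto simp: faces_def restriction_def)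
        have cA: "card ?A = i" using F(2) A finU by (metis card_insert_disjoint finite_Diff nat.inject)
        \<comment> \<open>This parity trades the cochain sign for U - {u}, with the two signs from
          the contraction, for the cochain sign for U without its term at u. That missing term is
          the factor (-1)^\<alpha>(u,U).\<close>
        have "(\<Sum>a\<in>?A. alpha a U) + alpha u ?A = (\<Sum>a\<in>?A. alpha a ?V) + i"
          using sum_alpha_Diff[OF finU u, of ?A] cA by auto
        then have e: "(-1::'k) ^ (\<Sum>a\<in>?A. alpha a U) * (-1) ^ alpha u ?A = (-1) ^ (\<Sum>a\<in>?A. alpha a ?V) * (-1) ^ i"
          by (simp flip: power_add)
        have "(\<Sum>a\<in>U - F. alpha a U) = alpha u U + (\<Sum>a\<in>?A. alpha a U)"
          using A finU by (metis finite_Diff sum.insert)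
        then have "(-1) ^ alpha u U * to_cochain U c F = (-1) ^ (\<Sum>a\<in>?A. alpha a U) * c (U - F)"
          using A by (simp add: to_cochain_def power_add flip: mult.assoc)
        moreover have "to_cochain ?V (\<lambda>A. (-1) ^ i * c' A) F = ((-1) ^ (\<Sum>a\<in>?A. alpha a ?V) * (-1) ^ i) * (-1) ^ alpha u ?A * c (U - F)"
          using A True by (simp add: to_cochain_def c'_def mult_ac)
        ultimately show ?thesis using Ff unfolding e[symmetric] by (simp flip: power_add mult.assoc) (simp add: power_add flip: mult.assoc)
      qed
    qed
  qed
  also have "coh_class ?\<Gamma> ?j \<dots> = (-1) ^ alpha u U \<odot>\<^bsub>coh \<Delta> i ?V\<^esub> coh_class ?\<Gamma> ?j (\<lambda>F. if F \<in> faces ?\<Gamma> ?j then to_cochain U c F else 0)"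
    by (simp add: coh_def cV cohomology_smult)
  also have "coh_class ?\<Gamma> ?j (\<lambda>F. if F \<in> faces ?\<Gamma> ?j then to_cochain U c F else 0) = restrict_class ?\<Gamma> ?j (\<Psi> (Suc i) U y)"
    unfolding \<Psi>_eq[OF U t] cU
  proof (rule restrict_class_coh_class[symmetric])
    show "?\<Gamma> \<subseteq> restriction \<Delta> U" by (auto simp: restriction_def)
  qed (erule (1) down, erule finite_face)
  finally show ?thesis unfolding z_def .
qed

end

section \<open>Polynomials and monomial ideals\<close>

abbreviation keys where "keys \<equiv> Poly_Mapping.keys"
abbreviation lookup where "lookup \<equiv> Poly_Mapping.lookup"
abbreviation single where "single \<equiv> Poly_Mapping.single"

section \<open>Monomials, their degrees and coefficients of products\<close>

lemma mon_deg_inj: "mon_deg m = mon_deg m' \<longleftrightarrow> m = m'"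
  by (auto simp: mon_deg_def fun_eq_iff intro: poly_mapping_eqI)

lemma mon_deg_add: "mon_deg (m + m') = mon_deg m + mon_deg m'"
  by (auto simp: mon_deg_def fun_eq_iff lookup_add)

lemma mon_deg_ge_0: "0 \<le> mon_deg m"
  by (auto simp: mon_deg_def le_fun_def)

lemma mon_deg_0: "mon_deg 0 = 0"
  by (auto simp: mon_deg_def fun_eq_iff)

lemma mons_iff_mon_deg: "m \<in> mons n \<longleftrightarrow> mon_deg m \<in> mdegs n"
  by (auto simp: mons_def mon_deg_def mdegs_def in_keys_iff)

lemma mdegs_add: "a \<in> mdegs n \<Longrightarrow> b \<in> mdegs n \<Longrightarrow> a + b \<in> mdegs n"
  by (auto simp: mdegs_def)

lemma mdegs_0: "0 \<in> mdegs n"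
  by (auto simp: mdegs_def)

lemma deg_plus_eq: "deg_plus a b = a + b"
  by (auto simp: deg_plus_def)

lemma mons_add: "a \<in> mons n \<Longrightarrow> b \<in> mons n \<Longrightarrow> a + b \<in> mons n"
  by (simp add: mons_iff_mon_deg mon_deg_add mdegs_add)

lemma keys_add_mon: "keys (a + b) = keys a \<union> keys (b :: mon)"
  by (auto simp: in_keys_iff lookup_add)

text \<open>The monomial of degree \<open>a\<close>; unspecified unless \<open>a\<close> is a nonnegative element of some \<open>mdegs n\<close>.\<close>

definition mon_of :: "mdeg \<Rightarrow> mon" where
  "mon_of a = (SOME m. mon_deg m = a)"

lemma mon_of_mon_deg [simp]: "mon_of (mon_deg m) = m"
  unfolding mon_of_def by (simp add: mon_deg_inj)

lemma mon_deg_mon_of: assumes "a \<in> mdegs n" "0 \<le> a" shows "mon_deg (mon_of a) = a"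
proof -
  have "{i. nat (a i) \<noteq> 0} \<subseteq> {1..n}"
  proof
    fix i assume "i \<in> {i. nat (a i) \<noteq> 0}"
    then have "a i \<noteq> 0" by auto
    then show "i \<in> {1..n}" using assms(1) unfolding mdegs_def by blast
  qed
  then have "finite {i. nat (a i) \<noteq> 0}" using finite_subset by blast
  then have "mon_deg (Abs_poly_mapping (\<lambda>i. nat (a i))) = a"
    using assms(2) by (simp add: mon_deg_def fun_eq_iff le_fun_def)
  then show ?thesis by (metis mon_of_mon_deg)
qed

lemma sum_single: "(\<Sum>m\<in>keys p. single m (lookup p m)) = p"
proof (rule poly_mapping_eqI)
  fix k
  have "lookup (\<Sum>m\<in>keys p. single m (lookup p m)) k =
    (\<Sum>m\<in>keys p. if m = k then lookup p k else 0)"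
    unfolding lookup_sum lookup_single by (intro sum.cong) (auto simp: when_def)
  also have "\<dots> = lookup p k" by (simp add: in_keys_iff)
  finally show "lookup (\<Sum>m\<in>keys p. single m (lookup p m)) k = lookup p k" .
qed

text \<open>Subtraction of exponents is truncated, so \<open>k - m\<close> is the quotient monomial
  only under the divisibility guard.\<close>

lemma lookup_single_times:
  fixes q :: "'k::field pol"
  shows "lookup (single m c * q) k =
    (if \<exists>b. k = m + b then c * lookup q (k - m) else 0)"
proof -
  have "single m c * q = (\<Sum>b\<in>keys q. single (m + b) (c * lookup q b))"
    by (subst sum_single[of q, symmetric]) (simp add: sum_distrib_left mult_single)
  then have "lookup (single m c * q) k =
    (\<Sum>b\<in>keys q. if m + b = k then c * lookup q b else 0)"
    by (simp add: lookup_sum lookup_single when_def)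
  also have "\<dots> = (if \<exists>b. k = m + b then c * lookup q (k - m) else 0)"
  proof (cases "\<exists>b. k = m + b")
    case True
    then obtain b where b: "k = m + b" by blast
    have "(\<Sum>b'\<in>keys q. if m + b' = k then c * lookup q b' else 0) =
      (\<Sum>b'\<in>keys q. if b' = b then c * lookup q b else 0)"
      using b by (intro sum.cong) auto
    then show ?thesis using b by (auto simp: in_keys_iff)
  next
    case False
    then have "m + b \<noteq> k" for b by metis
    then show ?thesis using False by simp
  qed
  finally show ?thesis .
qed

lemma lookup_times:
  fixes p q :: "'k::field pol"
  shows "lookup (p * q) k =
    (\<Sum>a\<in>{a \<in> keys p. \<exists>b. k = a + b}. lookup p a * lookup q (k - a))"
proof -
  have "p * q = (\<Sum>a\<in>keys p. single a (lookup p a) * q)"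
    by (simp add: sum_single flip: sum_distrib_right)
  then have "lookup (p * q) k = (\<Sum>a\<in>keys p. if \<exists>b. k = a + b then lookup p a * lookup q (k - a) else 0)"
    by (simp add: lookup_sum lookup_single_times)
  then show ?thesis by (simp add: sum.inter_filter)
qed

text \<open>A monomial is determined by its degree, so a homogeneous polynomial has at most one
  term, and none if the degree has a negative entry.\<close>

lemma homogeneous_single:
  assumes "g \<in> mdegs n" "\<And>m. m \<in> keys p \<Longrightarrow> mon_deg m = g"
  shows "p = (if 0 \<le> g then single (mon_of g) (lookup p (mon_of g)) else 0)"
proof (rule poly_mapping_eqI)
  fix m
  have *: "mon_deg m' = g" if "lookup p m' \<noteq> 0" for m' using assms(2) that by (simp add: in_keys_iff)
  show "lookup p m = lookup (if 0 \<le> g then single (mon_of g) (lookup p (mon_of g)) else 0) m"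
  proof (cases "lookup p m = 0")
    case True
    then show ?thesis by (auto simp: lookup_single when_def)
  next
    case False
    then have "g = mon_deg m" using * by simp
    then show ?thesis using mon_deg_ge_0[of m] by simp
  qed
qed

lemma pol_ring_simps [simp]:
  "p \<in> carrier (pol_ring n) \<longleftrightarrow> keys p \<subseteq> mons n"
  "mult (pol_ring n) = (*)" "one (pol_ring n) = 1" "zero (pol_ring n) = 0" "add (pol_ring n) = (+)"
  by (simp_all add: pol_ring_def)

lemma keys_times_mons: "keys p \<subseteq> mons n \<Longrightarrow> keys q \<subseteq> mons n \<Longrightarrow> keys (p * q) \<subseteq> mons n"
  using keys_mult[of p q] mons_add by blast

lemma keys_plus_mons: "keys p \<subseteq> mons n \<Longrightarrow> keys q \<subseteq> mons n \<Longrightarrow> keys (p + q) \<subseteq> mons n"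
  using keys_add[of p q] by blast

lemma keys_sum_mons:
  "(\<And>i. i \<in> I \<Longrightarrow> keys (p i) \<subseteq> mons n) \<Longrightarrow> keys (\<Sum>i\<in>I. p i) \<subseteq> mons n"
  by (induction I rule: infinite_finite_induct) (simp_all add: keys_plus_mons)

lemma zero_in_mons: "0 \<in> mons n"
  by (simp add: mons_def)

lemma cring_pol_ring: "cring (pol_ring n :: 'k::field pol ring)"
proof (rule cringI)
  show "abelian_group (pol_ring n :: 'k pol ring)"
  proof (rule abelian_groupI)
    show "\<exists>y\<in>carrier (pol_ring n). y \<oplus>\<^bsub>pol_ring n\<^esub> x = \<zero>\<^bsub>pol_ring n\<^esub>" if "x \<in> carrier (pol_ring n)" for x :: "'k pol"
      using that by (intro bexI[of _ "- x"]) (auto simp: in_keys_iff)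
  qed (simp_all add: keys_plus_mons add.commute add.assoc)
  show "comm_monoid (pol_ring n :: 'k pol ring)"
    by (rule comm_monoidI) (simp_all add: mult_ac zero_in_mons keys_times_mons)
qed (simp add: distrib_right)

lemma a_inv_pol_ring: "p \<in> carrier (pol_ring n) \<Longrightarrow> \<ominus>\<^bsub>pol_ring n\<^esub> p = - (p :: 'k::field pol)"
proof -
  interpret cring "pol_ring n :: 'k pol ring" by (rule cring_pol_ring)
  assume "p \<in> carrier (pol_ring n)"
  moreover then have "- p \<in> carrier (pol_ring n)" by (auto simp: in_keys_iff)
  ultimately show ?thesis using minus_equality[of "- p" p] by simp
qed

lemma ideal_pol_ringI:
  fixes I :: "'k::field pol set"
  assumes "I \<subseteq> carrier (pol_ring n)" "0 \<in> I" "\<And>p q. p \<in> I \<Longrightarrow> q \<in> I \<Longrightarrow> p + q \<in> I"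
    "\<And>p q. p \<in> I \<Longrightarrow> q \<in> carrier (pol_ring n) \<Longrightarrow> q * p \<in> I"
  shows "ideal I (pol_ring n)"
proof -
  interpret cring "pol_ring n :: 'k pol ring" by (rule cring_pol_ring)
  show ?thesis
  proof (rule idealI[OF ring_axioms])
    show "subgroup I (add_monoid (pol_ring n))"
    proof (rule group.subgroupI[OF a_group])
      show "inv\<^bsub>add_monoid (pol_ring n)\<^esub> p \<in> I" if "p \<in> I" for p
      proof -
        have p: "p \<in> carrier (pol_ring n)" using that assms(1) by blast
        have "- 1 \<in> carrier (pol_ring n :: 'k pol ring)" by (auto simp: in_keys_iff lookup_one when_def zero_in_mons split: if_splits)
        then have "- 1 * p \<in> I" using assms(4) that by blast
        then show ?thesis using a_inv_pol_ring[OF p] by (simp add: a_inv_def)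
      qed
    qed (use assms in auto)
  qed (use assms in \<open>auto simp: mult.commute\<close>)
qed

section \<open>The Stanley-Reisner ideal as a monomial ideal\<close>

lemma prod_var: "finite U \<Longrightarrow> (\<Prod>i\<in>U. var i) = (single (\<Sum>i\<in>U. single i 1) 1 :: 'k::field pol)"
  by (induction U rule: finite_induct) (auto simp: var_def mult_single)

lemma mon_of_sqfree_deg:
  assumes "finite U" shows "(\<Sum>i\<in>U. single i 1) = mon_of (sqfree_deg U)"
proof -
  have "mon_deg (\<Sum>i\<in>U. single i 1) = sqfree_deg U"
    using assms by (auto simp: mon_deg_def sqfree_deg_def lookup_sum lookup_single when_def fun_eq_iff)
  then show ?thesis by (metis mon_of_mon_deg)
qed

lemma keys_mon_of: assumes "a \<in> mdegs n" "0 \<le> a" shows "keys (mon_of a) = {u. 0 < a u}"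
proof -
  have "keys m = {u. 0 < mon_deg m u}" for m by (auto simp: mon_deg_def in_keys_iff)
  then show ?thesis using mon_deg_mon_of[OF assms] by metis
qed

lemma keys_prod_var:
  assumes "U \<subseteq> {1..n}"
  shows "keys (\<Prod>i\<in>U. var i :: 'k::field pol) = {mon_of (sqfree_deg U)}"
    "keys (mon_of (sqfree_deg U)) = U"
    "mon_of (sqfree_deg U) \<in> mons n"
proof -
  have "finite U" using assms finite_subset by blast
  then show "keys (\<Prod>i\<in>U. var i :: 'k::field pol) = {mon_of (sqfree_deg U)}"
    by (simp add: prod_var mon_of_sqfree_deg del: of_nat_1 One_nat_def)
  have "0 \<le> sqfree_deg U" "{u. 0 < sqfree_deg U u} = U" by (auto simp: sqfree_deg_def le_fun_def)
  then show "keys (mon_of (sqfree_deg U)) = U"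
    using keys_mon_of[OF sqfree_deg_in_mdegs[OF assms]] by simp
  then show "mon_of (sqfree_deg U) \<in> mons n" using assms by (simp add: mons_def)
qed

lemma SR_generators: "{\<Prod>i\<in>U. var i | U. U \<subseteq> {1..n} \<and> U \<notin> \<Delta>} \<subseteq> carrier (pol_ring n :: 'k::field pol ring)"
proof
  fix p :: "'k pol" assume "p \<in> {\<Prod>i\<in>U. var i | U. U \<subseteq> {1..n} \<and> U \<notin> \<Delta>}"
  then obtain U where U: "U \<subseteq> {1..n}" "p = (\<Prod>i\<in>U. var i)" by blast
  show "p \<in> carrier (pol_ring n)"
    unfolding U(2) pol_ring_simps keys_prod_var(1)[OF U(1)] using keys_prod_var(3)[OF U(1)] by blast
qed

lemma ideal_SR_ideal: "ideal (SR_ideal n \<Delta> :: 'k::field pol set) (pol_ring n)"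
  unfolding SR_ideal_def
  by (rule ring.genideal_ideal[OF cring.axioms(1)[OF cring_pol_ring] SR_generators])

text \<open>The polynomials on the right form an ideal containing the generators, since enlarging a
  nonface gives a nonface. Conversely, each of their terms is a multiple of the generator belonging
  to its support.\<close>

lemma SR_ideal_iff:
  fixes p :: "'k::field pol"
  assumes complex: "simplicial_complex n \<Delta>"
  shows "p \<in> SR_ideal n \<Delta> \<longleftrightarrow> p \<in> carrier (pol_ring n) \<and> (\<forall>m\<in>keys p. keys m \<notin> \<Delta>)"
proof
  interpret cring "pol_ring n :: 'k pol ring" by (rule cring_pol_ring)
  let ?J = "{p :: 'k pol. keys p \<subseteq> mons n \<and> (\<forall>m\<in>keys p. keys m \<notin> \<Delta>)}"
  have sub: "keys a \<in> \<Delta>" if "keys (a + b) \<in> \<Delta>" for a b :: mon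
    using that complex by (auto simp: simplicial_complex_def keys_add_mon)
  have "ideal ?J (pol_ring n)"
  proof (rule ideal_pol_ringI)
    show "p + q \<in> ?J" if "p \<in> ?J" "q \<in> ?J" for p q
      using that keys_plus_mons[of p n q] keys_add[of p q] by blast
    show "q * p \<in> ?J" if p: "p \<in> ?J" and q: "q \<in> carrier (pol_ring n)" for p q
    proof -
      have "keys m \<notin> \<Delta>" if m: "m \<in> keys (q * p)" for m
      proof -
        obtain a b where "m = a + b" "b \<in> keys p" using keys_mult[of q p] m by blast
        then have "m = b + a" by (simp add: add.commute)
        then show ?thesis using sub[of b a] p \<open>b \<in> keys p\<close> by blast
      qed
      then show ?thesis using keys_times_mons[of q n p] p q by simp
    qed
  qed auto
  moreover have "{\<Prod>i\<in>U. var i | U. U \<subseteq> {1..n} \<and> U \<notin> \<Delta>} \<subseteq> ?J"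
  proof clarify
    fix U assume U: "U \<subseteq> {1..n}" "U \<notin> \<Delta>"
    then show "keys (\<Prod>i\<in>U. var i :: 'k pol) \<subseteq> mons n \<and> (\<forall>m\<in>keys (\<Prod>i\<in>U. var i :: 'k pol). keys m \<notin> \<Delta>)"
      unfolding keys_prod_var(1)[OF U(1)] using keys_prod_var(2,3)[OF U(1)] U(2) by simp
  qed
  ultimately have "SR_ideal n \<Delta> \<subseteq> ?J" unfolding SR_ideal_def by (rule genideal_minimal)
  then show "p \<in> SR_ideal n \<Delta> \<Longrightarrow> p \<in> carrier (pol_ring n) \<and> (\<forall>m\<in>keys p. keys m \<notin> \<Delta>)" by auto
  let ?G = "{\<Prod>i\<in>U. var i | U. U \<subseteq> {1..n} \<and> U \<notin> \<Delta>} :: 'k pol set"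
  interpret I: ideal "SR_ideal n \<Delta> :: 'k pol set" "pol_ring n" by (rule ideal_SR_ideal)
  assume p: "p \<in> carrier (pol_ring n) \<and> (\<forall>m\<in>keys p. keys m \<notin> \<Delta>)"
  have "single m (lookup p m) \<in> SR_ideal n \<Delta>" if m: "m \<in> keys p" for m
  proof -
    let ?U = "keys m"
    have mn: "m \<in> mons n" using p m by auto
    have U: "?U \<subseteq> {1..n}" "?U \<notin> \<Delta>" "finite ?U" using p m mn by (auto simp: mons_def)
    have "(\<Prod>i\<in>?U. var i) \<in> ?G" by (intro CollectI exI[of _ ?U] conjI refl U(1,2))
    then have g: "(\<Prod>i\<in>?U. var i :: 'k pol) \<in> SR_ideal n \<Delta>"
      unfolding SR_ideal_def by (rule subsetD[OF genideal_self[OF SR_generators]])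
    \<comment> \<open>The cofactor of the generator: the exponent of every variable in the support
      is lowered by one.\<close>
    define m' where "m' = mon_of (mon_deg m - sqfree_deg ?U)"
    have md: "mon_deg m \<in> mdegs n" using mn by (simp add: mons_iff_mon_deg)
    have d: "mon_deg m - sqfree_deg ?U \<in> mdegs n" by (rule mdegs_diff[OF md sqfree_deg_in_mdegs[OF U(1)]])
    have m'd: "mon_deg m' = mon_deg m - sqfree_deg ?U" unfolding m'_def
      by (rule mon_deg_mon_of[OF d]) (auto simp: le_fun_def mon_deg_def sqfree_deg_def in_keys_iff)
    have "0 \<le> sqfree_deg ?U" by (auto simp: sqfree_deg_def le_fun_def)
    then have "mon_deg (mon_of (sqfree_deg ?U)) = sqfree_deg ?U" using mon_deg_mon_of[OF sqfree_deg_in_mdegs[OF U(1)]] by blast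
    then have "mon_deg (m' + mon_of (sqfree_deg ?U)) = mon_deg m" by (simp add: mon_deg_add m'd)
    then have "m' + mon_of (sqfree_deg ?U) = m" by (simp add: mon_deg_inj)
    then have e: "single m (lookup p m) = single m' (lookup p m) * (\<Prod>i\<in>?U. var i)"
      by (simp add: prod_var mon_of_sqfree_deg mult_single del: One_nat_def)
    have "m' \<in> mons n" using d m'd by (simp add: mons_iff_mon_deg)
    then have "single m' (lookup p m) \<in> carrier (pol_ring n)" by simp
    then show ?thesis unfolding e using I.I_l_closed[OF g] by simp
  qed
  moreover have "(\<Sum>i\<in>I. q i) \<in> SR_ideal n \<Delta>" if "finite I" "\<And>i. i \<in> I \<Longrightarrow> q i \<in> SR_ideal n \<Delta>" for q :: "mon \<Rightarrow> 'k pol" and I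
    using that I.zero_closed I.a_closed by (induction I rule: finite_induct) auto
  ultimately have "(\<Sum>m\<in>keys p. single m (lookup p m)) \<in> SR_ideal n \<Delta>" by simp
  then show "p \<in> SR_ideal n \<Delta>" by (simp add: sum_single)
qed

section \<open>The maximal ideal and its square\<close>

lemma var_carrier: "i \<in> {1..n} \<Longrightarrow> var i \<in> carrier (pol_ring n :: 'k::field pol ring)"
  by (auto simp: var_def mons_def)

lemma ideal_max_ideal: "ideal (max_ideal n :: 'k::field pol set) (pol_ring n)"
  unfolding max_ideal_def
  by (rule ring.genideal_ideal[OF cring.axioms(1)[OF cring_pol_ring]]) (use var_carrier in blast)

lemma var_in_max_ideal: "i \<in> {1..n} \<Longrightarrow> var i \<in> (max_ideal n :: 'k::field pol set)"
  unfolding max_ideal_def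
  using ring.genideal_self[OF cring.axioms(1)[OF cring_pol_ring], of "var ` {1..n}" n] var_carrier by blast

text \<open>Polynomials without constant term form an ideal that contains the variables.\<close>

lemma max_ideal_lookup_0:
  fixes p :: "'k::field pol"
  assumes "p \<in> max_ideal n"
  shows "lookup p 0 = 0" "p \<in> carrier (pol_ring n)"
proof -
  interpret cring "pol_ring n :: 'k pol ring" by (rule cring_pol_ring)
  let ?J = "{p :: 'k pol. keys p \<subseteq> mons n \<and> 0 \<notin> keys p}"
  have "ideal ?J (pol_ring n)"
  proof (rule ideal_pol_ringI)
    show "p + q \<in> ?J" if "p \<in> ?J" "q \<in> ?J" for p q
      using that keys_plus_mons[of p n q] keys_add[of p q] by blast
    show "q * p \<in> ?J" if p: "p \<in> ?J" and q: "q \<in> carrier (pol_ring n)" for p q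
    proof -
      have "0 \<notin> keys (q * p)"
      proof
        assume "0 \<in> keys (q * p)"
        then obtain a b where ab: "0 = a + b" "b \<in> keys p" using keys_mult[of q p] by blast
        have "lookup b i = 0" for i using arg_cong[OF ab(1), of "\<lambda>m. lookup m i"] by (simp add: lookup_add)
        then have "b = 0" by (auto intro: poly_mapping_eqI)
        then show False using ab p by simp
      qed
      then show ?thesis using keys_times_mons[of q n p] p q by simp
    qed
  qed auto
  moreover have "var ` {1..n} \<subseteq> ?J"
  proof
    fix p :: "'k pol" assume "p \<in> var ` {1..n}"
    then obtain i where i: "i \<in> {1..n}" "p = var i" by blast
    have "single i (1::nat) \<noteq> 0" by (metis lookup_single_eq lookup_zero zero_neq_one)
    then show "p \<in> ?J" using var_carrier[OF i(1)] i(2) by (auto simp: var_def)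
  qed
  ultimately have "max_ideal n \<subseteq> ?J" unfolding max_ideal_def by (rule genideal_minimal)
  then show "lookup p 0 = 0" "p \<in> carrier (pol_ring n)" using assms by (auto simp: in_keys_iff)
qed

definition tdeg :: "nat \<Rightarrow> mon \<Rightarrow> nat" where
  "tdeg n m = (\<Sum>i\<in>{1..n}. lookup m i)"

lemma tdeg_add: "tdeg n (a + b) = tdeg n a + tdeg n b"
  by (simp add: tdeg_def lookup_add sum.distrib)

lemma tdeg_single: "u \<in> {1..n} \<Longrightarrow> tdeg n (single u 1) = 1"
  by (simp add: tdeg_def lookup_single when_def)

lemma tdeg_pos:
  assumes "m \<in> mons n" "m \<noteq> 0"
  obtains u m' where "u \<in> {1..n}" "m' \<in> mons n" "m = single u 1 + m'"
proof -
  have "keys m \<noteq> {}" using assms(2) by simp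
  then obtain u where u: "u \<in> keys m" by blast
  then have un: "u \<in> {1..n}" using assms(1) by (auto simp: mons_def)
  have "m = single u 1 + (m - single u 1)"
    using u by (intro poly_mapping_eqI) (auto simp: lookup_add lookup_minus lookup_single when_def in_keys_iff)
  moreover have "m - single u 1 \<in> mons n" using assms(1) un
    by (auto simp: mons_def in_keys_iff lookup_minus subset_iff)
  ultimately show thesis using that un by blast
qed

lemma tdeg_ge_1: "m \<in> mons n \<Longrightarrow> m \<noteq> 0 \<Longrightarrow> 1 \<le> tdeg n m"
  by (erule (1) tdeg_pos) (simp only: tdeg_add tdeg_single le_add1)

lemma max_sq_tdeg:
  fixes s :: "'k::field pol"
  assumes "s \<in> max_ideal n \<cdot>\<^bsub>pol_ring n\<^esub> max_ideal n"
  shows "\<forall>m\<in>keys s. 2 \<le> tdeg n m"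
  using assms
proof (induction s rule: ideal_prod.induct)
  case (prod i j)
  have 1: "1 \<le> tdeg n m" if "p \<in> max_ideal n" "m \<in> keys p" for p :: "'k pol" and m
  proof (rule tdeg_ge_1)
    show "m \<in> mons n" using max_ideal_lookup_0(2)[OF that(1)] that(2) by auto
    show "m \<noteq> 0" using max_ideal_lookup_0(1)[OF that(1)] that(2) by (auto simp: in_keys_iff)
  qed
  show ?case
  proof
    fix m assume "m \<in> keys (i \<otimes>\<^bsub>pol_ring n\<^esub> j)"
    then have "m \<in> keys (i * j)" by simp
    then obtain a b where "m = a + b" "a \<in> keys i" "b \<in> keys j" using keys_mult[of i j] by blast
    then show "2 \<le> tdeg n m" using 1[OF prod(1)] 1[OF prod(2)] by (fastforce simp: tdeg_add)
  qed
next
  case (sum s1 s2)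
  then show ?case using keys_add[of s1 s2] by auto
qed

text \<open>Total degree at least 2 allows two variables to be split off, one for each factor of the
  ideal product.\<close>

lemma single_in_max_sq:
  assumes "m \<in> mons n" "2 \<le> tdeg n m"
  shows "single m (c :: 'k::field) \<in> max_ideal n \<cdot>\<^bsub>pol_ring n\<^esub> max_ideal n"
proof -
  interpret I: ideal "max_ideal n :: 'k pol set" "pol_ring n" by (rule ideal_max_ideal)
  have "m \<noteq> 0" using assms(2) by (auto simp: tdeg_def)
  then obtain u m' where u: "u \<in> {1..n}" "m' \<in> mons n" "m = single u 1 + m'"
    using tdeg_pos assms(1) by blast
  then have "m' \<noteq> 0" using assms(2) tdeg_single[OF u(1)] by (auto simp: tdeg_add tdeg_def[of n 0])
  then obtain v m'' where v: "v \<in> {1..n}" "m'' \<in> mons n" "m' = single v 1 + m''"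
    using tdeg_pos u(2) by blast
  have "single m'' c * var v \<in> max_ideal n"
    using I.I_l_closed[OF var_in_max_ideal[OF v(1)], of "single m'' c"] v(2) by simp
  then have "var u \<otimes>\<^bsub>pol_ring n\<^esub> (single m'' c * var v) \<in> max_ideal n \<cdot>\<^bsub>pol_ring n\<^esub> max_ideal n"
    by (rule ideal_prod.prod[OF var_in_max_ideal[OF u(1)]])
  moreover have "var u \<otimes>\<^bsub>pol_ring n\<^esub> (single m'' c * var v) = single m c"
    using u(3) v(3) by (simp add: var_def mult_single add_ac del: One_nat_def)
  ultimately show ?thesis by simp
qed

text \<open>For a nonzero term, membership in the square of the maximal ideal is decided by its
  total degree. The zero term lies in the square as well, but there both sides are 0.\<close>

lemma lin_entry_single:
  assumes "m \<in> mons n" "m \<noteq> 0"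
  shows "lin_entry n (single m (c :: 'k::field)) = (if tdeg n m = 1 then single m c else 0)"
proof (cases "tdeg n m = 1")
  case True
  then have "c = 0" if "single m c \<in> max_ideal n \<cdot>\<^bsub>pol_ring n\<^esub> max_ideal n"
    using max_sq_tdeg[OF that] by (auto split: if_splits)
  then show ?thesis using True by (auto simp: lin_entry_def)
next
  case False
  then have "2 \<le> tdeg n m" using tdeg_ge_1[OF assms] by simp
  then show ?thesis using single_in_max_sq[OF assms(1), of c] False by (simp add: lin_entry_def)
qed

lemma tdeg_eq_1_iff:
  assumes g: "g \<in> mdegs n" "0 \<le> g"
  shows "tdeg n (mon_of g) = 1 \<longleftrightarrow> (\<exists>u\<in>{1..n}. g = sqfree_deg {u})"
proof
  have md: "mon_deg (mon_of g) = g" using mon_deg_mon_of g by blast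
  have s: "mon_of (sqfree_deg {u}) = single u 1" for u using mon_of_sqfree_deg[of "{u}"] by simp
  { assume "\<exists>u\<in>{1..n}. g = sqfree_deg {u}"
    then show "tdeg n (mon_of g) = 1" using s tdeg_single by metis }
  assume t: "tdeg n (mon_of g) = 1"
  then have "mon_of g \<in> mons n" "mon_of g \<noteq> 0" using g md by (auto simp: mons_iff_mon_deg tdeg_def)
  then obtain u m' where u: "u \<in> {1..n}" "m' \<in> mons n" "mon_of g = single u 1 + m'" using tdeg_pos by blast
  then have "tdeg n m' = 0" using t tdeg_single[OF u(1)] by (simp add: tdeg_add del: One_nat_def)
  then have "m' = 0" using tdeg_ge_1[OF u(2)] by fastforce
  then have "mon_of g = mon_of (sqfree_deg {u})" using u(3) s by simp
  moreover have "mon_deg (mon_of (sqfree_deg {u})) = sqfree_deg {u}"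
    using u(1) by (intro mon_deg_mon_of[of _ n] sqfree_deg_in_mdegs) (auto simp: sqfree_deg_def le_fun_def)
  ultimately have "g = sqfree_deg {u}" using md by metis
  then show "\<exists>u\<in>{1..n}. g = sqfree_deg {u}" using u(1) by blast
qed

section \<open>Graded free modules\<close>

definition hpart :: "'k::field pol \<Rightarrow> mdeg \<Rightarrow> 'k pol" where
  "hpart p g = (\<Sum>m\<in>{m \<in> keys p. mon_deg m = g}. single m (lookup p m))"

lemma lookup_hpart: "lookup (hpart p g) m = (if mon_deg m = g then lookup p m else 0)"
proof -
  have "lookup (hpart p g) m = (\<Sum>m'\<in>{m' \<in> keys p. mon_deg m' = g}. if m' = m then lookup p m else 0)"
    unfolding hpart_def lookup_sum lookup_single by (intro sum.cong) (auto simp: when_def)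
  also have "\<dots> = (if mon_deg m = g then lookup p m else 0)" by (auto simp: in_keys_iff)
  finally show ?thesis .
qed

lemma keys_hpart: "keys (hpart p g) = {m \<in> keys p. mon_deg m = g}"
  by (auto simp: in_keys_iff lookup_hpart split: if_splits)

locale graded_free =
  fixes n :: nat and N :: "('k::field pol, 'm) graded_module" (structure) and B :: "'m set"
  assumes graded: "is_graded_module n N" and basis: "homogeneous_basis n N B"

sublocale graded_free \<subseteq> module "pol_ring n" N
  using graded by (simp add: is_graded_module_def)

section \<open>Coordinates and homogeneous components in a graded free module\<close>

context graded_free
begin

abbreviation C where "C \<equiv> coords n N B"

definition dg :: "'m \<Rightarrow> mdeg" where
  "dg b = (SOME a. a \<in> mdegs n \<and> b \<in> hcomp N a)"

definition combo :: "('m \<Rightarrow> 'k pol) \<Rightarrow> 'm" where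
  "combo c = (\<Oplus>\<^bsub>N\<^esub> b\<in>B. c b \<odot>\<^bsub>N\<^esub> b)"

lemma finite_B: "finite B"
  using basis by (simp add: homogeneous_basis_def)

lemma dg: assumes "b \<in> B" shows "dg b \<in> mdegs n" "b \<in> hcomp N (dg b)"
proof -
  have "\<exists>a. a \<in> mdegs n \<and> b \<in> hcomp N a" using basis assms by (auto simp: homogeneous_basis_def)
  then have "dg b \<in> mdegs n \<and> b \<in> hcomp N (dg b)" unfolding dg_def by (rule someI_ex)
  then show "dg b \<in> mdegs n" "b \<in> hcomp N (dg b)" by auto
qed

lemma hcomp_subgroup: "a \<in> mdegs n \<Longrightarrow> subgroup (hcomp N a) (add_monoid N)"
  using graded by (simp add: is_graded_module_def)

lemma hcomp_carrier: "a \<in> mdegs n \<Longrightarrow> x \<in> hcomp N a \<Longrightarrow> x \<in> carrier N"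
  using subgroup.subset[OF hcomp_subgroup] by fastforce

lemma B_carrier: "b \<in> B \<Longrightarrow> b \<in> carrier N"
  using dg hcomp_carrier by blast

lemma combo_closed:
  assumes "\<And>b. b \<in> B \<Longrightarrow> c b \<in> carrier (pol_ring n)" shows "combo c \<in> carrier N"
  unfolding combo_def by (rule finsum_closed) (use assms B_carrier in blast)

lemma combo_cong: assumes "\<And>b. b \<in> B \<Longrightarrow> c b = c' b" "\<And>b. b \<in> B \<Longrightarrow> c b \<in> carrier (pol_ring n)"
  shows "combo c = combo c'"
  unfolding combo_def by (rule finsum_cong') (use assms B_carrier in auto)

lemma coords_props:
  assumes "x \<in> carrier N"
  shows "C x \<in> B \<rightarrow>\<^sub>E carrier (pol_ring n)" "combo (C x) = x"
proof -
  have "\<exists>!c. c \<in> B \<rightarrow>\<^sub>E carrier (pol_ring n) \<and> x = (\<Oplus>\<^bsub>N\<^esub> b\<in>B. c b \<odot>\<^bsub>N\<^esub> b)"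
    using basis assms by (simp add: homogeneous_basis_def)
  then have "C x \<in> B \<rightarrow>\<^sub>E carrier (pol_ring n) \<and> x = (\<Oplus>\<^bsub>N\<^esub> b\<in>B. C x b \<odot>\<^bsub>N\<^esub> b)"
    unfolding coords_def by (rule theI')
  then show "C x \<in> B \<rightarrow>\<^sub>E carrier (pol_ring n)" "combo (C x) = x" by (auto simp: combo_def)
qed

lemma coords_carrier: "x \<in> carrier N \<Longrightarrow> b \<in> B \<Longrightarrow> C x b \<in> carrier (pol_ring n)"
  using coords_props(1) by blast

lemma coords_keys: "x \<in> carrier N \<Longrightarrow> b \<in> B \<Longrightarrow> keys (C x b) \<subseteq> mons n"
  using coords_carrier by fastforce

lemma coords_combo:
  assumes c: "\<And>b. b \<in> B \<Longrightarrow> c b \<in> carrier (pol_ring n)" and b: "b \<in> B"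
  shows "C (combo c) b = c b"
proof -
  have x: "combo c \<in> carrier N" using c by (rule combo_closed)
  have "\<exists>!c'. c' \<in> B \<rightarrow>\<^sub>E carrier (pol_ring n) \<and> combo c = (\<Oplus>\<^bsub>N\<^esub> b\<in>B. c' b \<odot>\<^bsub>N\<^esub> b)"
    using basis x by (simp add: homogeneous_basis_def)
  moreover have "C (combo c) \<in> B \<rightarrow>\<^sub>E carrier (pol_ring n) \<and> combo c = (\<Oplus>\<^bsub>N\<^esub> b\<in>B. C (combo c) b \<odot>\<^bsub>N\<^esub> b)"
    using coords_props[OF x] by (simp add: combo_def)
  moreover have "restrict c B \<in> B \<rightarrow>\<^sub>E carrier (pol_ring n) \<and> combo c = (\<Oplus>\<^bsub>N\<^esub> b\<in>B. restrict c B b \<odot>\<^bsub>N\<^esub> b)"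
  proof -
    have "combo c = combo (restrict c B)" by (rule combo_cong) (use c in auto)
    then show ?thesis using c by (auto simp: combo_def)
  qed
  ultimately have "C (combo c) = restrict c B" by blast
  then show ?thesis using b by simp
qed

lemma coords_inject:
  assumes "x \<in> carrier N" "y \<in> carrier N" "\<And>b. b \<in> B \<Longrightarrow> C x b = C y b"
  shows "x = y"
proof -
  have "combo (C x) = combo (C y)" by (rule combo_cong) (use assms coords_carrier in auto)
  then show ?thesis using coords_props assms by simp
qed

lemma coords_add:
  assumes x: "x \<in> carrier N" and y: "y \<in> carrier N" and b: "b \<in> B"
  shows "C (x \<oplus>\<^bsub>N\<^esub> y) b = C x b + C y b"
proof -
  have cx: "C x b \<in> carrier (pol_ring n)" "C y b \<in> carrier (pol_ring n)" if "b \<in> B" for b using coords_carrier x y that by auto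
  have "combo (\<lambda>b. C x b + C y b) = (\<Oplus>\<^bsub>N\<^esub> b\<in>B. C x b \<odot>\<^bsub>N\<^esub> b \<oplus>\<^bsub>N\<^esub> C y b \<odot>\<^bsub>N\<^esub> b)"
    unfolding combo_def
  proof (rule finsum_cong')
    show "(C x b + C y b) \<odot>\<^bsub>N\<^esub> b = C x b \<odot>\<^bsub>N\<^esub> b \<oplus>\<^bsub>N\<^esub> C y b \<odot>\<^bsub>N\<^esub> b" if "b \<in> B" for b
      using smult_l_distr[OF cx[OF that] B_carrier[OF that]] by simp
  qed (use cx B_carrier in auto)
  also have "\<dots> = combo (C x) \<oplus>\<^bsub>N\<^esub> combo (C y)"
    unfolding combo_def by (rule finsum_addf) (use cx B_carrier in blast)+
  finally have "x \<oplus>\<^bsub>N\<^esub> y = combo (\<lambda>b. C x b + C y b)" using coords_props x y by simp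
  moreover have "C x b + C y b \<in> carrier (pol_ring n)" if "b \<in> B" for b
    using cx[OF that] keys_plus_mons by simp
  ultimately show ?thesis using coords_combo[of "\<lambda>b. C x b + C y b", OF _ b] by simp
qed

lemma coords_smult:
  assumes x: "x \<in> carrier N" and p: "p \<in> carrier (pol_ring n)" and b: "b \<in> B"
  shows "C (p \<odot>\<^bsub>N\<^esub> x) b = p * C x b"
proof -
  have cx: "C x b \<in> carrier (pol_ring n)" if "b \<in> B" for b using coords_carrier x that by auto
  have "p \<odot>\<^bsub>N\<^esub> combo (C x) = (\<Oplus>\<^bsub>N\<^esub> b\<in>B. p \<odot>\<^bsub>N\<^esub> (C x b \<odot>\<^bsub>N\<^esub> b))"
    unfolding combo_def by (rule finsum_smult_ldistr[OF finite_B p]) (use cx B_carrier in blast)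
  also have "\<dots> = combo (\<lambda>b. p * C x b)"
    unfolding combo_def
  proof (rule finsum_cong')
    show "p \<odot>\<^bsub>N\<^esub> (C x b \<odot>\<^bsub>N\<^esub> b) = (p * C x b) \<odot>\<^bsub>N\<^esub> b" if "b \<in> B" for b
      using smult_assoc1[OF p cx[OF that] B_carrier[OF that]] by simp
    show "(\<lambda>b. (p * C x b) \<odot>\<^bsub>N\<^esub> b) \<in> B \<rightarrow> carrier N"
      using cx p B_carrier keys_times_mons by (intro Pi_I smult_closed) (simp, blast)+
  qed simp
  finally have "p \<odot>\<^bsub>N\<^esub> x = combo (\<lambda>b. p * C x b)" using coords_props x by simp
  moreover have "p * C x b \<in> carrier (pol_ring n)" if "b \<in> B" for b
    using cx[OF that] p keys_times_mons by simp
  ultimately show ?thesis using coords_combo[of "\<lambda>b. p * C x b", OF _ b] by simp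
qed

lemma coords_zero: assumes "b \<in> B" shows "C \<zero>\<^bsub>N\<^esub> b = 0"
  using coords_add[OF zero_closed zero_closed assms] by (metis M.l_zero add_cancel_right_right zero_closed)

lemma coords_finsum:
  assumes "finite I" "\<And>i. i \<in> I \<Longrightarrow> f i \<in> carrier N" and b: "b \<in> B"
  shows "C (\<Oplus>\<^bsub>N\<^esub> i\<in>I. f i) b = (\<Sum>i\<in>I. C (f i) b)"
  using assms(1,2)
proof (induction I rule: finite_induct)
  case (insert i I)
  have "(\<Oplus>\<^bsub>N\<^esub> i\<in>insert i I. f i) = f i \<oplus>\<^bsub>N\<^esub> (\<Oplus>\<^bsub>N\<^esub> i\<in>I. f i)"
    by (rule finsum_insert) (use insert in auto)
  then show ?case using insert coords_add[OF _ _ b] by (simp add: finsum_closed Pi_def)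
qed (simp add: coords_zero b)

lemma hcomp_finsum:
  assumes a: "a \<in> mdegs n" and "finite I" "\<And>i. i \<in> I \<Longrightarrow> f i \<in> hcomp N a"
  shows "(\<Oplus>\<^bsub>N\<^esub> i\<in>I. f i) \<in> hcomp N a"
  using assms(2,3)
proof (induction I rule: finite_induct)
  case empty
  then show ?case using subgroup.one_closed[OF hcomp_subgroup[OF a]] by simp
next
  case (insert i I)
  have "(\<Oplus>\<^bsub>N\<^esub> i\<in>insert i I. f i) = f i \<oplus>\<^bsub>N\<^esub> (\<Oplus>\<^bsub>N\<^esub> i\<in>I. f i)"
    by (rule finsum_insert) (use insert hcomp_carrier[OF a] in auto)
  then show ?case using insert subgroup.m_closed[OF hcomp_subgroup[OF a]] by simp
qed

lemma hcomp_if_coords: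
  assumes x: "x \<in> carrier N" and a: "a \<in> mdegs n"
    and h: "\<And>b m. b \<in> B \<Longrightarrow> m \<in> keys (C x b) \<Longrightarrow> mon_deg m + dg b = a"
  shows "x \<in> hcomp N a"
proof -
  have "C x b \<odot>\<^bsub>N\<^esub> b \<in> hcomp N a" if b: "b \<in> B" for b
  proof -
    have d: "a - dg b \<in> mdegs n" using mdegs_diff[OF a dg(1)[OF b]] .
    have "mon_deg m = a - dg b" if "m \<in> keys (C x b)" for m
      using h[OF b that] by (simp add: eq_diff_eq)
    then have "C x b \<in> pol_comp n (a - dg b)" using coords_carrier[OF x b] by (simp add: pol_comp_def)
    then have "C x b \<odot>\<^bsub>N\<^esub> b \<in> hcomp N (deg_plus (a - dg b) (dg b))"
      using graded dg[OF b] d by (simp add: is_graded_module_def)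
    then show ?thesis by (simp add: deg_plus_eq)
  qed
  then have "combo (C x) \<in> hcomp N a" unfolding combo_def by (rule hcomp_finsum[OF a finite_B])
  then show ?thesis using coords_props[OF x] by simp
qed

text \<open>The abstract grading must agree with the one read off from coordinates. This follows
  from uniqueness of the decomposition into homogeneous components, applied to the decomposition
  built from coordinates.\<close>

lemma hcomp_coords:
  assumes a: "a \<in> mdegs n" and xa: "x \<in> hcomp N a" and b: "b \<in> B" and m: "m \<in> keys (C x b)"
  shows "mon_deg m + dg b = a"
proof -
  have x: "x \<in> carrier N" using hcomp_carrier a xa by blast
  \<comment> \<open>The candidate for the component of x in degree a': each coordinate contributes
    its part of degree a' - dg b.\<close>
  define h where "h a' = combo (\<lambda>b. hpart (C x b) (a' - dg b))" for a'
  have hc: "hpart (C x b) (a' - dg b) \<in> carrier (pol_ring n)" if "b \<in> B" for a' b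
    using coords_carrier[OF x that] by (auto simp: keys_hpart)
  have hC: "C (h a') b = hpart (C x b) (a' - dg b)" if "b \<in> B" for a' b
    unfolding h_def by (rule coords_combo[OF hc that])
  have hN: "h a' \<in> carrier N" for a' unfolding h_def by (rule combo_closed[OF hc])
  have hh: "h a' \<in> hcomp N a'" if "a' \<in> mdegs n" for a'
  proof (rule hcomp_if_coords[OF hN that])
    fix b m assume "b \<in> B" "m \<in> keys (C (h a') b)"
    then have "mon_deg m = a' - dg b" unfolding hC[OF \<open>b \<in> B\<close>] keys_hpart by blast
    then show "mon_deg m + dg b = a'" by simp
  qed
  let ?S = "{a' \<in> mdegs n. h a' \<noteq> \<zero>\<^bsub>N\<^esub>}"
  have S: "a' \<in> (\<Union>b\<in>B. (\<lambda>m. mon_deg m + dg b) ` keys (C x b))" if "h a' \<noteq> \<zero>\<^bsub>N\<^esub>" for a'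
  proof -
    have "\<exists>b\<in>B. C (h a') b \<noteq> C \<zero>\<^bsub>N\<^esub> b"
    proof (rule ccontr)
      assume "\<not> ?thesis"
      then have "h a' = \<zero>\<^bsub>N\<^esub>" by (intro coords_inject[OF hN zero_closed]) simp
      then show False using that by simp
    qed
    then obtain b where b: "b \<in> B" "C (h a') b \<noteq> C \<zero>\<^bsub>N\<^esub> b" by blast
    then have "hpart (C x b) (a' - dg b) \<noteq> 0" using hC coords_zero by simp
    then obtain m where "m \<in> keys (hpart (C x b) (a' - dg b))" by (metis ex_in_conv keys_eq_empty)
    then have "m \<in> keys (C x b)" "mon_deg m = a' - dg b" unfolding keys_hpart by blast+
    then have "m \<in> keys (C x b)" "a' = mon_deg m + dg b" by simp_all
    then show ?thesis using b by blast
  qed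
  have finS: "finite ?S"
    by (rule finite_subset[of _ "\<Union>b\<in>B. (\<lambda>m. mon_deg m + dg b) ` keys (C x b)"])
       (use S finite_B in auto)
  \<comment> \<open>Two decompositions of x are compared: the one by coordinates, and the trivial
    one with x itself placed in degree a.\<close>
  let ?c1 = "\<lambda>a'\<in>mdegs n. h a'"
  let ?c2 = "\<lambda>a'\<in>mdegs n. if a' = a then x else \<zero>\<^bsub>N\<^esub>"
  have sum1: "x = (\<Oplus>\<^bsub>N\<^esub> a'\<in>?S. h a')"
  proof (rule coords_inject[OF x])
    show "(\<Oplus>\<^bsub>N\<^esub> a'\<in>?S. h a') \<in> carrier N" using hN by (intro finsum_closed) blast
    fix b assume b: "b \<in> B"
    show "C x b = C (\<Oplus>\<^bsub>N\<^esub> a'\<in>?S. h a') b"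
    proof (rule poly_mapping_eqI)
      fix m
      have "lookup (C (\<Oplus>\<^bsub>N\<^esub> a'\<in>?S. h a') b) m = (\<Sum>a'\<in>?S. if a' = mon_deg m + dg b then lookup (C x b) m else 0)"
        unfolding coords_finsum[OF finS hN b] lookup_sum hC[OF b] lookup_hpart
        by (intro sum.cong) (auto simp: eq_diff_eq)
      also have "\<dots> = lookup (C x b) m"
      proof (cases "lookup (C x b) m = 0")
        case False
        let ?a = "mon_deg m + dg b"
        have "m \<in> mons n" using False coords_keys[OF x b] by (auto simp: in_keys_iff)
        then have "?a \<in> mdegs n" using dg[OF b] by (simp add: mons_iff_mon_deg mdegs_add)
        moreover have "lookup (C (h ?a) b) m \<noteq> 0" using False by (simp add: hC[OF b] lookup_hpart)
        then have "h ?a \<noteq> \<zero>\<^bsub>N\<^esub>" using coords_zero[OF b] by (metis lookup_zero)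
        ultimately have "?a \<in> ?S" by blast
        then show ?thesis using finS by simp
      qed (simp add: sum.neutral)
      finally show "lookup (C x b) m = lookup (C (\<Oplus>\<^bsub>N\<^esub> a'\<in>?S. h a') b) m" by simp
    qed
  qed
  have "?c1 = ?c2"
  proof -
    have u: "\<exists>!c. c \<in> (\<Pi>\<^sub>E a\<in>mdegs n. hcomp N a) \<and> finite {a \<in> mdegs n. c a \<noteq> \<zero>\<^bsub>N\<^esub>} \<and>
        x = (\<Oplus>\<^bsub>N\<^esub> a \<in> {a \<in> mdegs n. c a \<noteq> \<zero>\<^bsub>N\<^esub>}. c a)"
      using graded x by (simp add: is_graded_module_def)
    have e1: "{a \<in> mdegs n. ?c1 a \<noteq> \<zero>\<^bsub>N\<^esub>} = ?S" by auto
    have e2: "{a \<in> mdegs n. ?c2 a \<noteq> \<zero>\<^bsub>N\<^esub>} = (if x = \<zero>\<^bsub>N\<^esub> then {} else {a})" using a by auto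
    have s1: "(\<Oplus>\<^bsub>N\<^esub> a \<in> ?S. ?c1 a) = (\<Oplus>\<^bsub>N\<^esub> a'\<in>?S. h a')" by (rule finsum_cong') (use hN in auto)
    have s2: "(\<Oplus>\<^bsub>N\<^esub> a' \<in> (if x = \<zero>\<^bsub>N\<^esub> then {} else {a}). ?c2 a') = x"
      using a x by (simp add: finsum_insert Pi_def)
    have z: "\<zero>\<^bsub>N\<^esub> \<in> hcomp N a'" if "a' \<in> mdegs n" for a' using subgroup.one_closed[OF hcomp_subgroup[OF that]] by simp
    have 1: "?c1 \<in> (\<Pi>\<^sub>E a\<in>mdegs n. hcomp N a) \<and> finite {a \<in> mdegs n. ?c1 a \<noteq> \<zero>\<^bsub>N\<^esub>} \<and>
        x = (\<Oplus>\<^bsub>N\<^esub> a \<in> {a \<in> mdegs n. ?c1 a \<noteq> \<zero>\<^bsub>N\<^esub>}. ?c1 a)"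
      unfolding e1 s1 using finS hh sum1 by auto
    have 2: "?c2 \<in> (\<Pi>\<^sub>E a\<in>mdegs n. hcomp N a) \<and> finite {a \<in> mdegs n. ?c2 a \<noteq> \<zero>\<^bsub>N\<^esub>} \<and>
        x = (\<Oplus>\<^bsub>N\<^esub> a \<in> {a \<in> mdegs n. ?c2 a \<noteq> \<zero>\<^bsub>N\<^esub>}. ?c2 a)"
      unfolding e2 s2 using xa z by auto
    show ?thesis using u 1 2 by blast
  qed
  from fun_cong[OF this, of a] have "h a = x" using a by simp
  then have "C x b = hpart (C x b) (a - dg b)" using hC[OF b, of a] by simp
  then have "mon_deg m = a - dg b" using m keys_hpart[of "C x b" "a - dg b"] by auto
  then show ?thesis by simp
qed

text \<open>The scalars \<open>y b\<close> such that the degree \<open>a\<close> part of \<open>x\<close> is \<open>\<Sum>\<^sub>b y(b) x\<^bsup>a - dg b\<^esup> b\<close>.\<close>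

definition coef :: "mdeg \<Rightarrow> 'm \<Rightarrow> 'm \<Rightarrow> 'k" where
  "coef a x b = (if b \<in> B \<and> dg b \<le> a then lookup (C x b) (mon_of (a - dg b)) else 0)"

text \<open>The homogeneous element of degree a with prescribed scalars. It is a section of
  \<open>coef a\<close> on functions supported on basis elements of degree at most a.\<close>

definition lift :: "mdeg \<Rightarrow> ('m \<Rightarrow> 'k) \<Rightarrow> 'm" where
  "lift a y = combo (\<lambda>b. if dg b \<le> a then single (mon_of (a - dg b)) (y b) else 0)"

lemma lift:
  assumes a: "a \<in> mdegs n"
  shows "lift a y \<in> carrier N" "b \<in> B \<Longrightarrow> C (lift a y) b = (if dg b \<le> a then single (mon_of (a - dg b)) (y b) else 0)"
    "lift a y \<in> hcomp N a"
    "(\<And>b. y b \<noteq> 0 \<Longrightarrow> b \<in> B \<and> dg b \<le> a) \<Longrightarrow> coef a (lift a y) = y"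
proof -
  have md: "mon_deg (mon_of (a - dg b)) = a - dg b" if "b \<in> B" "dg b \<le> a" for b
    by (rule mon_deg_mon_of[OF mdegs_diff[OF a dg(1)[OF that(1)]]]) (use that(2) in \<open>simp add: le_fun_def\<close>)
  have c: "(if dg b \<le> a then single (mon_of (a - dg b)) (y b) else 0) \<in> carrier (pol_ring n)" if "b \<in> B" for b
    using md[OF that] mdegs_diff[OF a dg(1)[OF that]] by (auto simp: mons_iff_mon_deg)
  show l: "lift a y \<in> carrier N" unfolding lift_def by (rule combo_closed[OF c])
  show C: "b \<in> B \<Longrightarrow> C (lift a y) b = (if dg b \<le> a then single (mon_of (a - dg b)) (y b) else 0)" for b
    unfolding lift_def by (rule coords_combo[OF c])
  show "lift a y \<in> hcomp N a"
  proof (rule hcomp_if_coords[OF l a])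
    fix b m assume b: "b \<in> B" and "m \<in> keys (C (lift a y) b)"
    then have "dg b \<le> a" "m = mon_of (a - dg b)" unfolding C[OF b] by (simp_all split: if_splits)
    then show "mon_deg m + dg b = a" using md[OF b] by simp
  qed
  show "coef a (lift a y) = y" if "\<And>b. y b \<noteq> 0 \<Longrightarrow> b \<in> B \<and> dg b \<le> a"
    using that by (force simp: coef_def C)
qed

end

section \<open>From minimal free resolutions to scalar matrices\<close>

lemma mon_of_0: "mon_of 0 = 0"
  using mon_of_mon_deg[of 0] by (simp add: mon_deg_0)

lemma (in graded_free) coords_a_inv:
  assumes x: "x \<in> carrier N" and b: "b \<in> B"
  shows "C (\<ominus>\<^bsub>N\<^esub> x) b = - C x b"
proof -
  have "C x b + C (\<ominus>\<^bsub>N\<^esub> x) b = 0"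
    using coords_add[OF x M.a_inv_closed[OF x] b] coords_zero[OF b] M.r_neg[OF x] by simp
  then show ?thesis by (simp add: eq_neg_iff_add_eq_0 add.commute)
qed

lemma mon_add_eq_0: "a + b = 0 \<Longrightarrow> (a :: mon) = 0"
  by (metis add_is_0 lookup_add lookup_zero poly_mapping_eqI)

lemma lookup_times_0: "lookup (p * q) 0 = lookup p 0 * lookup (q :: 'k::field pol) 0"
proof -
  have "{a \<in> keys p. \<exists>b. 0 = a + b} = (if lookup p 0 \<noteq> 0 then {0} else {})"
  proof (rule Set.set_eqI)
    fix a :: mon
    have "(\<exists>b. 0 = a + b) \<longleftrightarrow> a = 0" using mon_add_eq_0[of a] by (metis add_0)
    then show "a \<in> {a \<in> keys p. \<exists>b. 0 = a + b} \<longleftrightarrow> a \<in> (if lookup p 0 \<noteq> 0 then {0} else {})"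
      by (auto simp: in_keys_iff)
  qed
  then show ?thesis by (simp add: lookup_times)
qed

text \<open>Each \<open>q b\<close> has at most one term, of degree dg b - g, so the coefficient of
  x^(a-g) in the product comes only from x^(a - dg b) in the coordinate at b. The differential is
  the case where g is the degree of a target basis element, the augmentation the case g = 0.\<close>

lemma (in graded_free) coef_sum:
  assumes a: "a \<in> mdegs n" and g: "g \<in> mdegs n" "g \<le> a" and x: "x \<in> carrier N"
    and q: "\<And>b m. b \<in> B \<Longrightarrow> m \<in> keys (q b) \<Longrightarrow> mon_deg m = dg b - g"
  shows "lookup (\<Sum>b\<in>B. C x b * q b) (mon_of (a - g)) =
    (\<Sum>b\<in>B. coef a x b * (if g \<le> dg b then lookup (q b) (mon_of (dg b - g)) else 0))"
  unfolding lookup_sum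
proof (intro sum.cong refl)
  fix b assume b: "b \<in> B"
  have le0: "0 \<le> u - v \<longleftrightarrow> v \<le> u" for u v :: mdeg by (simp add: le_fun_def)
  have dgb: "dg b - g \<in> mdegs n" "a - g \<in> mdegs n" "a - dg b \<in> mdegs n" using dg[OF b] a g mdegs_diff by blast+
  have qb: "q b = (if g \<le> dg b then single (mon_of (dg b - g)) (lookup (q b) (mon_of (dg b - g))) else 0)"
    using homogeneous_single[OF dgb(1), of "q b"] q[OF b] unfolding le0 by blast
  show "lookup (C x b * q b) (mon_of (a - g)) = coef a x b * (if g \<le> dg b then lookup (q b) (mon_of (dg b - g)) else 0)"
  proof (cases "g \<le> dg b")
    case False
    then show ?thesis using qb by simp
  next
    case True
    define s where "s = lookup (q b) (mon_of (dg b - g))"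
    have q': "q b = single (mon_of (dg b - g)) s" using qb True by (simp add: s_def)
    have m1: "mon_deg (mon_of (a - g)) = a - g" "mon_deg (mon_of (dg b - g)) = dg b - g"
      using mon_deg_mon_of[OF dgb(2)] mon_deg_mon_of[OF dgb(1)] True g(2) le0 by blast+
    have "lookup (C x b * q b) (mon_of (a - g)) =
      (if \<exists>k. mon_of (a - g) = mon_of (dg b - g) + k then s * lookup (C x b) (mon_of (a - g) - mon_of (dg b - g)) else 0)"
      unfolding q' mult.commute[of "C x b"] lookup_single_times ..
    also have "\<dots> = coef a x b * s"
    proof (cases "dg b \<le> a")
      case True
      then have m2: "mon_deg (mon_of (a - dg b)) = a - dg b" using mon_deg_mon_of[OF dgb(3)] le0 by blast
      have "mon_deg (mon_of (a - g)) = mon_deg (mon_of (dg b - g) + mon_of (a - dg b))"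
        by (simp add: m1 m2 mon_deg_add)
      then have "mon_of (a - g) = mon_of (dg b - g) + mon_of (a - dg b)" by (simp only: mon_deg_inj)
      then show ?thesis using True b by (auto simp: coef_def)
    next
      case False
      \<comment> \<open>A cofactor would have degree a - dg b, which has a negative entry
        here.\<close>
      have "\<nexists>k. mon_of (a - g) = mon_of (dg b - g) + k"
      proof
        assume "\<exists>k. mon_of (a - g) = mon_of (dg b - g) + k"
        then obtain k where "mon_of (a - g) = mon_of (dg b - g) + k" ..
        then have "a - g = (dg b - g) + mon_deg k" using m1 by (metis mon_deg_add)
        then have "a - dg b = mon_deg k" by (simp add: algebra_simps)
        then show False using mon_deg_ge_0[of k] False le0 by metis
      qed
      then show ?thesis using False by (simp add: coef_def)
    qed
    finally show ?thesis using True by (simp add: s_def)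
  qed
qed

lemma graded_hom_zero:
  assumes "module R N" "module R N'" "\<And>x y. x \<in> carrier N \<Longrightarrow> y \<in> carrier N \<Longrightarrow> f (x \<oplus>\<^bsub>N\<^esub> y) = f x \<oplus>\<^bsub>N'\<^esub> f y"
    "f \<in> carrier N \<rightarrow> carrier N'"
  shows "f \<zero>\<^bsub>N\<^esub> = \<zero>\<^bsub>N'\<^esub>"
proof -
  interpret N: module R N by fact
  interpret N': module R N' by fact
  have "f \<zero>\<^bsub>N\<^esub> \<oplus>\<^bsub>N'\<^esub> f \<zero>\<^bsub>N\<^esub> = f \<zero>\<^bsub>N\<^esub>" using assms(3)[of "\<zero>\<^bsub>N\<^esub>" "\<zero>\<^bsub>N\<^esub>"] by simp
  moreover have "f \<zero>\<^bsub>N\<^esub> \<in> carrier N'" using assms(4) by blast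
  ultimately show ?thesis using N'.add.l_cancel_one' by metis
qed

lemma graded_hom_coords:
  assumes "graded_free n N BN" "graded_free n N' BN'" and f: "f \<in> graded_hom n N N'"
    and x: "x \<in> carrier N" and c: "c \<in> BN'"
  shows "coords n N' BN' (f x) c = (\<Sum>b\<in>BN. coords n N BN x b * coords n N' BN' (f b) c)"
proof -
  interpret N: graded_free n N BN by fact
  interpret N': graded_free n N' BN' by fact
  have add: "f (x \<oplus>\<^bsub>N\<^esub> y) = f x \<oplus>\<^bsub>N'\<^esub> f y" if "x \<in> carrier N" "y \<in> carrier N" for x y
    using f that by (simp add: graded_hom_def)
  have smult: "f (p \<odot>\<^bsub>N\<^esub> x) = p \<odot>\<^bsub>N'\<^esub> f x" if "p \<in> carrier (pol_ring n)" "x \<in> carrier N" for p x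
    using f that by (simp only: graded_hom_def mem_Collect_eq)
  have fc: "f x \<in> carrier N'" if "x \<in> carrier N" for x using f that by (auto simp: graded_hom_def)
  have z: "f \<zero>\<^bsub>N\<^esub> = \<zero>\<^bsub>N'\<^esub>" using graded_hom_zero[OF N.module_axioms N'.module_axioms add] fc by blast
  have fs: "N'.C (f (\<Oplus>\<^bsub>N\<^esub> b\<in>I. g b)) c = (\<Sum>b\<in>I. N'.C (f (g b)) c)"
    if "finite I" "\<And>b. b \<in> I \<Longrightarrow> g b \<in> carrier N" for I and g :: "_ \<Rightarrow> _"
    using that
  proof (induction I rule: finite_induct)
    case (insert i I)
    have 1: "(\<Oplus>\<^bsub>N\<^esub> b\<in>I. g b) \<in> carrier N" using insert by (intro N.M.finsum_closed) auto
    have "(\<Oplus>\<^bsub>N\<^esub> b\<in>insert i I. g b) = g i \<oplus>\<^bsub>N\<^esub> (\<Oplus>\<^bsub>N\<^esub> b\<in>I. g b)"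
      by (rule N.M.finsum_insert) (use insert in auto)
    then have "f (\<Oplus>\<^bsub>N\<^esub> b\<in>insert i I. g b) = f (g i) \<oplus>\<^bsub>N'\<^esub> f (\<Oplus>\<^bsub>N\<^esub> b\<in>I. g b)"
      using add[OF _ 1] insert.prems by simp
    then show ?case using insert N'.coords_add[OF fc fc[OF 1] c] by simp
  qed (simp add: z N'.coords_zero c)
  have "x = (\<Oplus>\<^bsub>N\<^esub> b\<in>BN. N.C x b \<odot>\<^bsub>N\<^esub> b)" using N.coords_props(2)[OF x] by (simp add: N.combo_def)
  then have "N'.C (f x) c = N'.C (f (\<Oplus>\<^bsub>N\<^esub> b\<in>BN. N.C x b \<odot>\<^bsub>N\<^esub> b)) c" by simp
  also have "\<dots> = (\<Sum>b\<in>BN. N'.C (f (N.C x b \<odot>\<^bsub>N\<^esub> b)) c)"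
    by (rule fs[OF N.finite_B]) (intro N.smult_closed N.coords_carrier[OF x] N.B_carrier)
  also have "\<dots> = (\<Sum>b\<in>BN. N.C x b * N'.C (f b) c)"
  proof (intro sum.cong refl)
    fix b assume b: "b \<in> BN"
    show "N'.C (f (N.C x b \<odot>\<^bsub>N\<^esub> b)) c = N.C x b * N'.C (f b) c"
      using smult[OF N.coords_carrier[OF x b] N.B_carrier[OF b]]
        N'.coords_smult[OF fc[OF N.B_carrier[OF b]] N.coords_carrier[OF x b] c] by simp
  qed
  finally show ?thesis .
qed

lemma SR_module_simps:
  "carrier (SR_module n \<Delta>) = a_rcosets\<^bsub>pol_ring n\<^esub> (SR_ideal n \<Delta>)"
  "\<zero>\<^bsub>SR_module n \<Delta>\<^esub> = SR_ideal n \<Delta>"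
  "X \<oplus>\<^bsub>SR_module n \<Delta>\<^esub> Y = X <+>\<^bsub>pol_ring n\<^esub> Y"
  "r \<odot>\<^bsub>SR_module n \<Delta>\<^esub> X = rcoset_mult (pol_ring n) (SR_ideal n \<Delta>) (SR_ideal n \<Delta> +>\<^bsub>pol_ring n\<^esub> r) X"
  "hcomp (SR_module n \<Delta>) a = (\<lambda>p. SR_ideal n \<Delta> +>\<^bsub>pol_ring n\<^esub> p) ` pol_comp n a"
  by (simp_all add: SR_module_def with_grading_def SR_ring_def module.defs graded_module.defs ring.defs FactRing_def)

locale SR_resolution =
  fixes n :: nat and \<Delta> :: "nat set set"
    and F :: "nat \<Rightarrow> ('k::field pol, 'm) graded_module"
    and d :: "nat \<Rightarrow> 'm \<Rightarrow> 'm"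
    and \<epsilon> :: "'m \<Rightarrow> 'k pol set"
    and B :: "nat \<Rightarrow> 'm set"
  assumes complex: "simplicial_complex n \<Delta>"
    and res: "minimal_free_resolution n (SR_module n \<Delta>) F d \<epsilon>"
    and bases: "homogeneous_basis n (F i) (B i)"

sublocale SR_resolution \<subseteq> G: graded_free n "F i" "B i" for i
  using res bases by unfold_locales (simp_all add: minimal_free_resolution_def is_graded_complex_def)

section \<open>Differential and augmentation as scalar matrices\<close>

context SR_resolution
begin

lemma d_hom: "d i \<in> graded_hom n (F (Suc i)) (F i)"
  using res by (simp add: minimal_free_resolution_def is_graded_complex_def)

lemma d_closed: "x \<in> carrier (F (Suc i)) \<Longrightarrow> d i x \<in> carrier (F i)"
  using d_hom[of i] by (auto simp: graded_hom_def)

lemma d_hcomp: "a \<in> mdegs n \<Longrightarrow> x \<in> hcomp (F (Suc i)) a \<Longrightarrow> d i x \<in> hcomp (F i) a"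
  using d_hom[of i] unfolding graded_hom_def by blast

lemma dd: "x \<in> carrier (F (Suc (Suc i))) \<Longrightarrow> d i (d (Suc i) x) = \<zero>\<^bsub>F i\<^esub>"
  using res by (simp add: minimal_free_resolution_def is_graded_complex_def)

abbreviation cs where "cs i \<equiv> coords n (F i) (B i)"
abbreviation dgr where "dgr i \<equiv> graded_free.dg n (F i)"
abbreviation co where "co i \<equiv> graded_free.coef n (F i) (B i)"

definition entry :: "nat \<Rightarrow> 'm \<Rightarrow> 'm \<Rightarrow> 'k" where
  "entry i b c = (if b \<in> B (Suc i) then co i (dgr (Suc i) b) (d i b) c else 0)"

lemma entry_nz_le: "entry i b c \<noteq> 0 \<Longrightarrow> b \<in> B (Suc i) \<and> c \<in> B i \<and> dgr i c \<le> dgr (Suc i) b"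
  by (auto simp: entry_def G.coef_def split: if_splits)

lemma d_coords_keys:
  assumes b: "b \<in> B (Suc i)" and c: "c \<in> B i" and m: "m \<in> keys (cs i (d i b) c)"
  shows "mon_deg m = dgr (Suc i) b - dgr i c"
proof -
  have "d i b \<in> hcomp (F i) (dgr (Suc i) b)" using d_hcomp G.dg[OF b] by blast
  then have "mon_deg m + dgr i c = dgr (Suc i) b" using G.hcomp_coords[OF G.dg(1)[OF b] _ c m] by blast
  then show ?thesis by (simp add: eq_diff_eq)
qed

lemma d_coords:
  assumes b: "b \<in> B (Suc i)" and c: "c \<in> B i"
  shows "cs i (d i b) c = (if dgr i c \<le> dgr (Suc i) b then single (mon_of (dgr (Suc i) b - dgr i c)) (entry i b c) else 0)"
proof -
  have "dgr (Suc i) b - dgr i c \<in> mdegs n" using G.dg[OF b] G.dg[OF c] mdegs_diff by blast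
  moreover have "0 \<le> dgr (Suc i) b - dgr i c \<longleftrightarrow> dgr i c \<le> dgr (Suc i) b" by (simp add: le_fun_def)
  ultimately have "cs i (d i b) c = (if dgr i c \<le> dgr (Suc i) b then single (mon_of (dgr (Suc i) b - dgr i c))
      (lookup (cs i (d i b) c) (mon_of (dgr (Suc i) b - dgr i c))) else 0)"
    using homogeneous_single[of "dgr (Suc i) b - dgr i c" n "cs i (d i b) c"] d_coords_keys[OF b c] by simp
  then show ?thesis using b c by (simp add: entry_def G.coef_def split: if_splits)
qed

text \<open>The same scalar matrix \<open>entry i\<close> describes the differential in every degree
  a; only the set of available basis elements changes with a.\<close>

lemma coef_d:
  assumes a: "a \<in> mdegs n" and x: "x \<in> carrier (F (Suc i))"
  shows "co i a (d i x) c = (\<Sum>b\<in>B (Suc i). co (Suc i) a x b * entry i b c)"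
proof (cases "c \<in> B i \<and> dgr i c \<le> a")
  case True
  then have c: "c \<in> B i" "dgr i c \<le> a" by auto
  have "co i a (d i x) c = lookup (\<Sum>b\<in>B (Suc i). cs (Suc i) x b * cs i (d i b) c) (mon_of (a - dgr i c))"
    using True graded_hom_coords[OF G.graded_free_axioms G.graded_free_axioms d_hom x c(1)] by (simp add: G.coef_def)
  also have "\<dots> = (\<Sum>b\<in>B (Suc i). co (Suc i) a x b * (if dgr i c \<le> dgr (Suc i) b then lookup (cs i (d i b) c) (mon_of (dgr (Suc i) b - dgr i c)) else 0))"
    by (rule G.coef_sum[OF a G.dg(1)[OF c(1)] c(2) x]) (rule d_coords_keys[OF _ c(1)])
  also have "\<dots> = (\<Sum>b\<in>B (Suc i). co (Suc i) a x b * entry i b c)"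
    using c by (intro sum.cong) (auto simp: entry_def G.coef_def)
  finally show ?thesis .
next
  case False
  have "co (Suc i) a x b * entry i b c = 0" for b
  proof (rule ccontr)
    assume "co (Suc i) a x b * entry i b c \<noteq> 0"
    then have "dgr (Suc i) b \<le> a" "c \<in> B i" "dgr i c \<le> dgr (Suc i) b"
      using entry_nz_le[of i b c] by (auto simp: G.coef_def split: if_splits)
    then show False using False order_trans by blast
  qed
  then have "(\<Sum>b\<in>B (Suc i). co (Suc i) a x b * entry i b c) = 0" by (intro sum.neutral) blast
  moreover have "co i a (d i x) c = 0" using False by (auto simp: G.coef_def)
  ultimately show ?thesis by simp
qed

lemma coef_zero: "co i a \<zero>\<^bsub>F i\<^esub> c = 0"
  by (simp add: G.coef_def G.coords_zero)

lemma entry_entry: "(\<Sum>c'\<in>B (Suc i). entry (Suc i) b c' * entry i c' c) = 0"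
proof (cases "b \<in> B (Suc (Suc i))")
  case True
  have bc: "b \<in> carrier (F (Suc (Suc i)))" using G.B_carrier[OF True] .
  have "(\<Sum>c'\<in>B (Suc i). entry (Suc i) b c' * entry i c' c) = co i (dgr (Suc (Suc i)) b) (d i (d (Suc i) b)) c"
    using coef_d[OF G.dg(1)[OF True] d_closed[OF bc]] True by (simp add: entry_def)
  also have "\<dots> = 0" by (simp add: dd[OF bc] coef_zero)
  finally show ?thesis .
qed (simp add: entry_def)

text \<open>Constant coefficients of coordinates are additive and vanish on products r x with r in
  the maximal ideal, hence on all of m F.\<close>

lemma minimal_coords:
  assumes x: "x \<in> carrier (F (Suc i))" and c: "c \<in> B i"
  shows "lookup (cs i (d i x) c) 0 = 0"
proof -
  have "d i x \<in> ideal_times_module (max_ideal n) (F i)"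
    using res x unfolding minimal_free_resolution_def by blast
  moreover have "y \<in> carrier (F i) \<and> lookup (cs i y c) 0 = 0" if "y \<in> ideal_times_module (max_ideal n) (F i)" for y
    using that unfolding ideal_times_module_def
  proof (induction y rule: generate.induct)
    case one
    then show ?case by (simp add: G.coords_zero[OF c])
  next
    case (incl h)
    then obtain r x where h: "h = r \<odot>\<^bsub>F i\<^esub> x" "r \<in> max_ideal n" "x \<in> carrier (F i)" by blast
    have r: "r \<in> carrier (pol_ring n)" "lookup r 0 = 0" using max_ideal_lookup_0[OF h(2)] by auto
    show ?case using h(1) G.smult_closed[OF r(1) h(3)] G.coords_smult[OF h(3) r(1) c]
      by (simp add: lookup_times_0 r(2))
  next
    case (inv h)
    then obtain r x where h: "h = r \<odot>\<^bsub>F i\<^esub> x" "r \<in> max_ideal n" "x \<in> carrier (F i)" by blast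
    have r: "r \<in> carrier (pol_ring n)" "lookup r 0 = 0" using max_ideal_lookup_0[OF h(2)] by auto
    have hc: "h \<in> carrier (F i)" using h(1) G.smult_closed[OF r(1) h(3)] by simp
    have "lookup (cs i h c) 0 = 0" using h(1) G.coords_smult[OF h(3) r(1) c] by (simp add: lookup_times_0 r(2))
    then have "lookup (cs i (\<ominus>\<^bsub>F i\<^esub> h) c) 0 = 0" by (simp add: G.coords_a_inv[OF hc c])
    then show ?case using G.M.a_inv_closed[OF hc] by (simp add: a_inv_def)
  next
    case (eng h1 h2)
    then show ?case using G.coords_add[OF _ _ c] by (simp add: lookup_add)
  qed
  ultimately show ?thesis by blast
qed

text \<open>Between basis elements of equal degree the entry is the constant coefficient of a
  coordinate, which minimality makes zero.\<close>

lemma entry_nz: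
  assumes nz: "entry i b c \<noteq> 0"
  shows "b \<in> B (Suc i) \<and> c \<in> B i \<and> dgr i c \<le> dgr (Suc i) b \<and> dgr i c \<noteq> dgr (Suc i) b"
proof -
  have 1: "b \<in> B (Suc i)" "c \<in> B i" "dgr i c \<le> dgr (Suc i) b" using entry_nz_le[OF nz] by auto
  have "dgr i c \<noteq> dgr (Suc i) b"
  proof
    assume eq: "dgr i c = dgr (Suc i) b"
    then have "entry i b c = lookup (cs i (d i b) c) 0" using 1 by (simp add: entry_def G.coef_def mon_of_0)
    then show False using nz minimal_coords[OF G.B_carrier[OF 1(1)] 1(2)] by simp
  qed
  then show ?thesis using 1 by blast
qed

text \<open>The image of the homogeneous lift is homogeneous of degree a, so the vanishing of its
  scalars in that one degree makes it zero. This turns scalar cycles into cycles of the resolution,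
  to which exactness applies.\<close>

lemma d_lift:
  assumes a: "a \<in> mdegs n" and supp: "\<And>b. y b \<noteq> 0 \<Longrightarrow> b \<in> B (Suc i) \<and> dgr (Suc i) b \<le> a"
    and z: "\<And>c. (\<Sum>b\<in>B (Suc i). y b * entry i b c) = 0"
  shows "\<exists>x\<in>carrier (F (Suc i)). d i x = \<zero>\<^bsub>F i\<^esub> \<and> co (Suc i) a x = y"
proof (intro bexI conjI)
  let ?x = "graded_free.lift n (F (Suc i)) (B (Suc i)) a y"
  note L = G.lift[where i = "Suc i", OF a]
  show xc: "?x \<in> carrier (F (Suc i))" by (rule L(1))
  show co: "co (Suc i) a ?x = y" by (rule L(4)) (rule supp)
  have dh: "d i ?x \<in> hcomp (F i) a" by (rule d_hcomp[OF a L(3)])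
  show "d i ?x = \<zero>\<^bsub>F i\<^esub>"
  proof (rule G.coords_inject[OF d_closed[OF xc] G.M.zero_closed])
    fix c assume c: "c \<in> B i"
    have "lookup (cs i (d i ?x) c) m = 0" for m
    proof (rule ccontr)
      assume nz: "lookup (cs i (d i ?x) c) m \<noteq> 0"
      then have m: "mon_deg m + dgr i c = a" using G.hcomp_coords[OF a dh c, of m] by (simp add: in_keys_iff)
      then have "a - dgr i c = mon_deg m" by (simp add: eq_diff_eq[symmetric])
      moreover have "dgr i c \<le> a" using m mon_deg_ge_0[of m] by (auto simp: le_fun_def)
      ultimately have "co i a (d i ?x) c \<noteq> 0" using nz c by (simp add: G.coef_def)
      then show False using coef_d[OF a xc] co z by simp
    qed
    then show "cs i (d i ?x) c = cs i \<zero>\<^bsub>F i\<^esub> c" by (intro poly_mapping_eqI) (simp add: G.coords_zero c)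
  qed
qed

text \<open>Elements of k[\<Delta>] are cosets; a homogeneous representative of the image of each
  basis element makes the augmentation a matrix of polynomials.\<close>

definition aug :: "'m \<Rightarrow> 'k pol" where
  "aug b = (SOME q. q \<in> pol_comp n (dgr 0 b) \<and> \<epsilon> b = SR_ideal n \<Delta> +>\<^bsub>pol_ring n\<^esub> q)"

definition aug_coef :: "'m \<Rightarrow> 'k" where
  "aug_coef b = (if b \<in> B 0 \<and> 0 \<le> dgr 0 b then lookup (aug b) (mon_of (dgr 0 b)) else 0)"

definition aug_sum :: "'m \<Rightarrow> 'k pol" where
  "aug_sum x = (\<Sum>b\<in>B 0. cs 0 x b * aug b)"

lemma aug:
  assumes "b \<in> B 0"
  shows "aug b \<in> pol_comp n (dgr 0 b)" "\<epsilon> b = SR_ideal n \<Delta> +>\<^bsub>pol_ring n\<^esub> aug b"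
proof -
  have "\<epsilon> \<in> graded_hom n (F 0) (SR_module n \<Delta>)" using res by (simp add: minimal_free_resolution_def)
  then have "\<epsilon> ` hcomp (F 0) (dgr 0 b) \<subseteq> hcomp (SR_module n \<Delta>) (dgr 0 b)"
    using G.dg(1)[OF assms] unfolding graded_hom_def by blast
  then have "\<epsilon> b \<in> hcomp (SR_module n \<Delta>) (dgr 0 b)" using G.dg(2)[OF assms] by blast
  then have "\<exists>q. q \<in> pol_comp n (dgr 0 b) \<and> \<epsilon> b = SR_ideal n \<Delta> +>\<^bsub>pol_ring n\<^esub> q"
    by (auto simp: SR_module_simps)
  then have "aug b \<in> pol_comp n (dgr 0 b) \<and> \<epsilon> b = SR_ideal n \<Delta> +>\<^bsub>pol_ring n\<^esub> aug b"
    unfolding aug_def by (rule someI_ex)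
  then show "aug b \<in> pol_comp n (dgr 0 b)" "\<epsilon> b = SR_ideal n \<Delta> +>\<^bsub>pol_ring n\<^esub> aug b" by auto
qed

lemma aug_carrier: "b \<in> B 0 \<Longrightarrow> aug b \<in> carrier (pol_ring n)"
  using aug(1) by (auto simp: pol_comp_def)

lemma \<epsilon>_eq:
  assumes x: "x \<in> carrier (F 0)"
  shows "\<epsilon> x = SR_ideal n \<Delta> +>\<^bsub>pol_ring n\<^esub> aug_sum x" "aug_sum x \<in> carrier (pol_ring n)"
proof -
  interpret I: ideal "SR_ideal n \<Delta> :: 'k pol set" "pol_ring n" by (rule ideal_SR_ideal)
  let ?I = "SR_ideal n \<Delta> :: 'k pol set"
  have hom: "\<epsilon> \<in> graded_hom n (F 0) (SR_module n \<Delta>)" using res by (simp add: minimal_free_resolution_def)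
  have add: "\<epsilon> (x \<oplus>\<^bsub>F 0\<^esub> y) = \<epsilon> x <+>\<^bsub>pol_ring n\<^esub> \<epsilon> y" if "x \<in> carrier (F 0)" "y \<in> carrier (F 0)" for x y
    using hom that by (simp add: graded_hom_def SR_module_simps)
  have smult: "\<epsilon> (p \<odot>\<^bsub>F 0\<^esub> x) = rcoset_mult (pol_ring n) ?I (?I +>\<^bsub>pol_ring n\<^esub> p) (\<epsilon> x)"
    if "p \<in> carrier (pol_ring n)" "x \<in> carrier (F 0)" for x p
    using hom that by (simp only: graded_hom_def SR_module_simps mem_Collect_eq)
  have one: "\<epsilon> (p \<odot>\<^bsub>F 0\<^esub> b) = ?I +>\<^bsub>pol_ring n\<^esub> (p * aug b)" if "p \<in> carrier (pol_ring n)" "b \<in> B 0" for p b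
    using smult[OF that(1) G.B_carrier[OF that(2)]] aug(2)[OF that(2)] I.rcoset_mult_add[OF that(1) aug_carrier[OF that(2)]] by simp
  have pc: "(\<Sum>b\<in>J. cs 0 x b * aug b) \<in> carrier (pol_ring n)" if "J \<subseteq> B 0" for J
    unfolding pol_ring_simps
  proof (intro keys_sum_mons keys_times_mons)
    fix b assume "b \<in> J"
    then have b: "b \<in> B 0" using that by blast
    show "keys (cs 0 x b) \<subseteq> mons n" by (rule G.coords_keys[OF x b])
    show "keys (aug b) \<subseteq> mons n" using aug_carrier[OF b] by simp
  qed
  have "\<epsilon> (\<Oplus>\<^bsub>F 0\<^esub> b\<in>J. cs 0 x b \<odot>\<^bsub>F 0\<^esub> b) = ?I +>\<^bsub>pol_ring n\<^esub> (\<Sum>b\<in>J. cs 0 x b * aug b)"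
    if "finite J" "J \<subseteq> B 0" for J
    using that
  proof (induction J rule: finite_induct)
    case empty
    \<comment> \<open>Writing 0 as 0 times 0 evaluates the image of zero by coset multiplication,
      without appeal to module laws for \<open>SR_module\<close>.\<close>
    have z: "\<zero>\<^bsub>F 0\<^esub> = \<zero>\<^bsub>pol_ring n\<^esub> \<odot>\<^bsub>F 0\<^esub> \<zero>\<^bsub>F 0\<^esub>" by simp
    have z0: "\<zero>\<^bsub>pol_ring n\<^esub> \<in> carrier (pol_ring n :: 'k pol ring)" by simp
    obtain q where q: "q \<in> carrier (pol_ring n)" "\<epsilon> \<zero>\<^bsub>F 0\<^esub> = ?I +>\<^bsub>pol_ring n\<^esub> q"
    proof -
      have "\<epsilon> \<zero>\<^bsub>F 0\<^esub> \<in> a_rcosets\<^bsub>pol_ring n\<^esub> ?I"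
        using hom by (simp add: graded_hom_def SR_module_simps Pi_def)
      then show thesis using that by (auto simp: A_RCOSETS_def')
    qed
    have "\<epsilon> \<zero>\<^bsub>F 0\<^esub> = ?I +>\<^bsub>pol_ring n\<^esub> (\<zero>\<^bsub>pol_ring n\<^esub> \<otimes>\<^bsub>pol_ring n\<^esub> q)"
      using smult[OF z0 G.M.zero_closed] z I.rcoset_mult_add[OF z0 q(1)] q(2) by metis
    then show ?case by simp
  next
    case (insert b J)
    have bc: "cs 0 x b \<odot>\<^bsub>F 0\<^esub> b \<in> carrier (F 0)" if "b \<in> B 0" for b
      using G.smult_closed[OF G.coords_carrier[OF x that] G.B_carrier[OF that]] .
    have 1: "(\<Oplus>\<^bsub>F 0\<^esub> b\<in>J. cs 0 x b \<odot>\<^bsub>F 0\<^esub> b) \<in> carrier (F 0)" using insert bc by (intro G.M.finsum_closed) auto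
    have "(\<Oplus>\<^bsub>F 0\<^esub> b\<in>insert b J. cs 0 x b \<odot>\<^bsub>F 0\<^esub> b) = cs 0 x b \<odot>\<^bsub>F 0\<^esub> b \<oplus>\<^bsub>F 0\<^esub> (\<Oplus>\<^bsub>F 0\<^esub> b\<in>J. cs 0 x b \<odot>\<^bsub>F 0\<^esub> b)"
      by (rule G.M.finsum_insert) (use insert bc in auto)
    then have "\<epsilon> (\<Oplus>\<^bsub>F 0\<^esub> b\<in>insert b J. cs 0 x b \<odot>\<^bsub>F 0\<^esub> b) =
      (?I +>\<^bsub>pol_ring n\<^esub> (cs 0 x b * aug b)) <+>\<^bsub>pol_ring n\<^esub> (?I +>\<^bsub>pol_ring n\<^esub> (\<Sum>b\<in>J. cs 0 x b * aug b))"
      using add[OF bc 1] one[OF G.coords_carrier[OF x]] insert by simp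
    also have "\<dots> = ?I +>\<^bsub>pol_ring n\<^esub> (cs 0 x b * aug b + (\<Sum>b\<in>J. cs 0 x b * aug b))"
      using I.a_rcos_sum[OF pc[of "{b}"] pc[of J]] insert.prems by simp
    finally show ?case using insert by simp
  qed
  from this[OF G.finite_B[of 0] subset_refl] show "\<epsilon> x = SR_ideal n \<Delta> +>\<^bsub>pol_ring n\<^esub> aug_sum x"
    using G.coords_props(2)[OF x] by (simp add: aug_sum_def G.combo_def)
  show "aug_sum x \<in> carrier (pol_ring n)" using pc[of "B 0"] by (simp add: aug_sum_def)
qed

lemma \<epsilon>_zero_iff:
  assumes x: "x \<in> carrier (F 0)"
  shows "\<epsilon> x = \<zero>\<^bsub>SR_module n \<Delta>\<^esub> \<longleftrightarrow> aug_sum x \<in> SR_ideal n \<Delta>"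
proof -
  interpret I: ideal "SR_ideal n \<Delta> :: 'k pol set" "pol_ring n" by (rule ideal_SR_ideal)
  show ?thesis unfolding \<epsilon>_eq(1)[OF x] SR_module_simps
    using I.rcos_const_imp_mem[OF \<epsilon>_eq(2)[OF x]] ring.a_rcos_zero[OF cring.axioms(1)[OF cring_pol_ring] ideal_SR_ideal] by blast
qed

lemma lookup_aug_sum:
  assumes a: "a \<in> mdegs n" "0 \<le> a" and x: "x \<in> carrier (F 0)"
  shows "lookup (aug_sum x) (mon_of a) = (\<Sum>b\<in>B 0. co 0 a x b * aug_coef b)"
proof -
  have "lookup (aug_sum x) (mon_of (a - 0)) = (\<Sum>b\<in>B 0. co 0 a x b * (if 0 \<le> dgr 0 b then lookup (aug b) (mon_of (dgr 0 b - 0)) else 0))"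
    unfolding aug_sum_def
    by (rule G.coef_sum[OF a(1) mdegs_0 a(2) x]) (use aug(1) in \<open>simp add: pol_comp_def\<close>)
  also have "\<dots> = (\<Sum>b\<in>B 0. co 0 a x b * aug_coef b)" by (intro sum.cong) (auto simp: aug_coef_def)
  finally show ?thesis by simp
qed

lemma sr_degree_keys:
  assumes "a \<in> mdegs n" "0 \<le> a"
  shows "sr_degree \<Delta> a \<longleftrightarrow> keys (mon_of a) \<in> \<Delta>"
  using assms keys_mon_of[OF assms] by (simp add: sr_degree_def)

text \<open>The ideal is spanned by monomials, so membership is tested one coefficient at a time, in
  the degrees whose monomial survives in k[\<Delta>].\<close>

lemma aug_sum_in_ideal:
  assumes x: "x \<in> carrier (F 0)"
  shows "aug_sum x \<in> SR_ideal n \<Delta> \<longleftrightarrow> (\<forall>a\<in>mdegs n. sr_degree \<Delta> a \<longrightarrow> (\<Sum>b\<in>B 0. co 0 a x b * aug_coef b) = 0)"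
proof -
  have c: "aug_sum x \<in> carrier (pol_ring n)" using \<epsilon>_eq(2)[OF x] .
  have "aug_sum x \<in> SR_ideal n \<Delta> \<longleftrightarrow> (\<forall>m\<in>keys (aug_sum x). keys m \<notin> \<Delta>)"
    using SR_ideal_iff[OF complex] c by blast
  also have "\<dots> \<longleftrightarrow> (\<forall>a\<in>mdegs n. sr_degree \<Delta> a \<longrightarrow> lookup (aug_sum x) (mon_of a) = 0)"
  proof (intro iffI ballI impI)
    fix a assume h: "\<forall>m\<in>keys (aug_sum x). keys m \<notin> \<Delta>" "a \<in> mdegs n" "sr_degree \<Delta> a"
    then have "0 \<le> a" by (simp add: sr_degree_def)
    then have "keys (mon_of a) \<in> \<Delta>" using sr_degree_keys h by blast
    then show "lookup (aug_sum x) (mon_of a) = 0" using h(1) by (auto simp: in_keys_iff)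
  next
    fix m assume h: "\<forall>a\<in>mdegs n. sr_degree \<Delta> a \<longrightarrow> lookup (aug_sum x) (mon_of a) = 0" and m: "m \<in> keys (aug_sum x)"
    have "mon_deg m \<in> mdegs n" using c m by (auto simp: mons_iff_mon_deg)
    then show "keys m \<notin> \<Delta>"
      using h m sr_degree_keys[of "mon_deg m"] mon_deg_ge_0[of m] by (auto simp: in_keys_iff)
  qed
  also have "\<dots> \<longleftrightarrow> (\<forall>a\<in>mdegs n. sr_degree \<Delta> a \<longrightarrow> (\<Sum>b\<in>B 0. co 0 a x b * aug_coef b) = 0)"
    using lookup_aug_sum[OF _ _ x] by (auto simp: sr_degree_def)
  finally show ?thesis .
qed

lemma frame: "resolution_frame n \<Delta> B dgr entry aug_coef"
proof
  show "simplicial_complex n \<Delta>" by (rule complex)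
  show "finite (B i)" for i by (rule G.finite_B)
  show "dgr i b \<in> mdegs n" if "b \<in> B i" for b i using G.dg[OF that] by blast
  show "b \<in> B (Suc i) \<and> c \<in> B i \<and> dgr i c \<le> dgr (Suc i) b \<and> dgr i c \<noteq> dgr (Suc i) b" if "entry i b c \<noteq> 0" for i b c
    by (rule entry_nz[OF that])
  show "(\<Sum>c'\<in>B (Suc i). entry (Suc i) b c' * entry i c' c) = 0" for i b c by (rule entry_entry)
  show "0 \<le> dgr 0 b" if "aug_coef b \<noteq> 0" for b using that by (auto simp: aug_coef_def split: if_splits)
  show "(\<Sum>c\<in>B 0. entry 0 b c * aug_coef c) = 0"
    if a: "a \<in> mdegs n" "sr_degree \<Delta> a" and b: "b \<in> B (Suc 0)" "dgr (Suc 0) b \<le> a" for a b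
  proof (rule ccontr)
    \<comment> \<open>A nonzero term gives 0 \<le> dg c \<le> dg b \<le> a. The support of dg b is
      then a face, being contained in that of a, so the vanishing of the augmentation on
      \<open>d 0 b\<close> can be read in degree dg b.\<close>
    assume nz: "(\<Sum>c\<in>B 0. entry 0 b c * aug_coef c) \<noteq> 0"
    then obtain c where "entry 0 b c * aug_coef c \<noteq> 0" by (metis (no_types, lifting) sum.neutral)
    then have "0 \<le> dgr 0 c" "dgr 0 c \<le> dgr (Suc 0) b" using entry_nz_le[of 0 b c] by (auto simp: aug_coef_def split: if_splits)
    then have b0: "0 \<le> dgr (Suc 0) b" by (rule order_trans)
    have "{u. 0 < dgr (Suc 0) b u} \<subseteq> {u. 0 < a u}" using b(2) by (auto simp: le_fun_def intro: less_le_trans)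
    then have sb: "sr_degree \<Delta> (dgr (Suc 0) b)" using b0 a(2) complex by (auto simp: sr_degree_def simplicial_complex_def)
    have bc: "b \<in> carrier (F (Suc 0))" using G.B_carrier b by blast
    then have db: "d 0 b \<in> carrier (F 0)" by (rule d_closed)
    have "\<epsilon> (d 0 b) = \<zero>\<^bsub>SR_module n \<Delta>\<^esub>" using res bc db unfolding minimal_free_resolution_def by auto
    then have "(\<Sum>c\<in>B 0. co 0 (dgr (Suc 0) b) (d 0 b) c * aug_coef c) = 0"
      using \<epsilon>_zero_iff[OF db] aug_sum_in_ideal[OF db] sb G.dg[OF b(1)] by blast
    then show False using nz b by (simp add: entry_def)
  qed
  show "\<exists>y. (\<forall>b. y b \<noteq> 0 \<longrightarrow> b \<in> B 0 \<and> dgr 0 b \<le> a) \<and> (\<Sum>b\<in>B 0. y b * aug_coef b) = 1"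
    if a: "a \<in> mdegs n" "sr_degree \<Delta> a" for a
  proof -
    interpret I: ideal "SR_ideal n \<Delta> :: 'k pol set" "pol_ring n" by (rule ideal_SR_ideal)
    let ?p = "single (mon_of a) (1::'k)"
    have a0: "0 \<le> a" using a(2) by (simp add: sr_degree_def)
    have p: "?p \<in> carrier (pol_ring n)" using mon_deg_mon_of[OF a(1) a0] a(1) by (simp add: mons_iff_mon_deg)
    then have "SR_ideal n \<Delta> +>\<^bsub>pol_ring n\<^esub> ?p \<in> carrier (SR_module n \<Delta>)" unfolding SR_module_simps A_RCOSETS_def' by blast
    moreover have "\<epsilon> ` carrier (F 0) = carrier (SR_module n \<Delta>)" using res by (simp add: minimal_free_resolution_def)
    ultimately obtain x where x: "x \<in> carrier (F 0)" "\<epsilon> x = SR_ideal n \<Delta> +>\<^bsub>pol_ring n\<^esub> ?p"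
      by (smt (verit) imageE)
    have "?p \<in> SR_ideal n \<Delta> +>\<^bsub>pol_ring n\<^esub> aug_sum x" using x(2) \<epsilon>_eq[OF x(1)] I.a_rcos_self[OF p] by simp
    then obtain h where h: "h \<in> SR_ideal n \<Delta>" "?p = h + aug_sum x" by (auto simp: a_r_coset_def')
    \<comment> \<open>The preimage matches x^a only up to an element of the ideal, but no such
      element contains a monomial supported on a face.\<close>
    have "lookup h (mon_of a) = 0"
    proof (rule ccontr)
      assume "lookup h (mon_of a) \<noteq> 0"
      then have "keys (mon_of a) \<notin> \<Delta>" using h(1) SR_ideal_iff[OF complex, of h] by (simp add: in_keys_iff)
      then show False using sr_degree_keys[OF a(1) a0] a(2) by blast
    qed
    then have "lookup (aug_sum x) (mon_of a) = 1" using arg_cong[OF h(2), of "\<lambda>q. lookup q (mon_of a)"] by (simp add: lookup_add)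
    then have "(\<Sum>b\<in>B 0. co 0 a x b * aug_coef b) = 1" using lookup_aug_sum[OF a(1) a0 x(1)] by simp
    then show ?thesis by (intro exI[of _ "co 0 a x"]) (auto simp: G.coef_def split: if_splits)
  qed
  show "\<exists>y'. (\<forall>b. y' b \<noteq> 0 \<longrightarrow> b \<in> B (Suc 0) \<and> dgr (Suc 0) b \<le> a) \<and> (\<forall>c. (\<Sum>b\<in>B (Suc 0). y' b * entry 0 b c) = y c)"
    if a: "a \<in> mdegs n" and supp: "\<And>b. y b \<noteq> 0 \<Longrightarrow> b \<in> B 0 \<and> dgr 0 b \<le> a"
      and z: "sr_degree \<Delta> a \<Longrightarrow> (\<Sum>b\<in>B 0. y b * aug_coef b) = 0" for a y
  proof -
    let ?x = "graded_free.lift n (F 0) (B 0) a y"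
    note L = G.lift[where i = 0, OF a]
    have co: "co 0 a ?x = y" by (rule L(4)) (rule supp)
    have xc: "?x \<in> carrier (F 0)" by (rule L(1))
    \<comment> \<open>The hypothesis speaks of degree a alone; in all other degrees the homogeneous
      lift has no coefficients.\<close>
    have "(\<Sum>b\<in>B 0. co 0 a' ?x b * aug_coef b) = 0" if a': "a' \<in> mdegs n" "sr_degree \<Delta> a'" for a'
    proof (cases "a' = a")
      case True
      then show ?thesis using z a' co by simp
    next
      case False
      have "co 0 a' ?x b = 0" for b
      proof (rule ccontr)
        assume "co 0 a' ?x b \<noteq> 0"
        then have b: "b \<in> B 0" "dgr 0 b \<le> a'" "lookup (cs 0 ?x b) (mon_of (a' - dgr 0 b)) \<noteq> 0"
          by (auto simp: G.coef_def split: if_splits)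
        have "mon_deg (mon_of (a' - dgr 0 b)) + dgr 0 b = a"
          using G.hcomp_coords[OF a L(3) b(1)] b(3) by (simp add: in_keys_iff)
        moreover have "mon_deg (mon_of (a' - dgr 0 b)) = a' - dgr 0 b"
          by (rule mon_deg_mon_of[OF mdegs_diff[OF a'(1) G.dg(1)[OF b(1)]]]) (use b(2) in \<open>simp add: le_fun_def\<close>)
        ultimately show False using False by simp
      qed
      then show ?thesis by simp
    qed
    then have "\<epsilon> ?x = \<zero>\<^bsub>SR_module n \<Delta>\<^esub>" using \<epsilon>_zero_iff[OF xc] aug_sum_in_ideal[OF xc] by blast
    then obtain x' where x': "x' \<in> carrier (F 1)" "?x = d 0 x'"
    proof -
      have "?x \<in> {x \<in> carrier (F 0). \<epsilon> x = \<zero>\<^bsub>SR_module n \<Delta>\<^esub>}" using xc \<open>\<epsilon> ?x = \<zero>\<^bsub>SR_module n \<Delta>\<^esub>\<close> by simp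
      also have "\<dots> = d 0 ` carrier (F 1)" using res by (simp add: minimal_free_resolution_def)
      finally show thesis using that by blast
    qed
    have "(\<Sum>b\<in>B (Suc 0). co (Suc 0) a x' b * entry 0 b c) = y c" for c
      using coef_d[OF a, of x' 0] x' co by simp
    then show ?thesis by (intro exI[of _ "co (Suc 0) a x'"]) (auto simp: G.coef_def split: if_splits)
  qed
  show "\<exists>y'. (\<forall>b. y' b \<noteq> 0 \<longrightarrow> b \<in> B (Suc (Suc i)) \<and> dgr (Suc (Suc i)) b \<le> a) \<and> (\<forall>c. (\<Sum>b\<in>B (Suc (Suc i)). y' b * entry (Suc i) b c) = y c)"
    if a: "a \<in> mdegs n" and supp: "\<And>b. y b \<noteq> 0 \<Longrightarrow> b \<in> B (Suc i) \<and> dgr (Suc i) b \<le> a"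
      and z: "\<And>c. (\<Sum>b\<in>B (Suc i). y b * entry i b c) = 0" for a y i
  proof -
    obtain x where x: "x \<in> carrier (F (Suc i))" "d i x = \<zero>\<^bsub>F i\<^esub>" "co (Suc i) a x = y"
      using d_lift[OF a supp z] by blast
    have "{x \<in> carrier (F (Suc i)). d i x = \<zero>\<^bsub>F i\<^esub>} = d (Suc i) ` carrier (F (Suc (Suc i)))"
      using res by (simp add: minimal_free_resolution_def)
    then have "x \<in> d (Suc i) ` carrier (F (Suc (Suc i)))" using x by blast
    then obtain x' where x': "x' \<in> carrier (F (Suc (Suc i)))" "x = d (Suc i) x'" by blast
    have "(\<Sum>b\<in>B (Suc (Suc i)). co (Suc (Suc i)) a x' b * entry (Suc i) b c) = y c" for c
      using coef_d[OF a x'(1)] x' x(3) by simp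
    then show ?thesis by (intro exI[of _ "co (Suc (Suc i)) a x'"]) (auto simp: G.coef_def split: if_splits)
  qed
qed

end

sublocale SR_resolution \<subseteq> R: resolution_frame n \<Delta> B dgr entry aug_coef
  by (rule frame)

section \<open>The linear part\<close>

lemma finsum_hom:
  assumes "module R N" "module R N'" and z: "f \<zero>\<^bsub>N\<^esub> = \<zero>\<^bsub>N'\<^esub>"
    and add: "\<And>x y. x \<in> carrier N \<Longrightarrow> y \<in> carrier N \<Longrightarrow> f (x \<oplus>\<^bsub>N\<^esub> y) = f x \<oplus>\<^bsub>N'\<^esub> f y"
    and fc: "\<And>x. x \<in> carrier N \<Longrightarrow> f x \<in> carrier N'"
    and I: "finite I" "\<And>i. i \<in> I \<Longrightarrow> g i \<in> carrier N"
  shows "f (\<Oplus>\<^bsub>N\<^esub> i\<in>I. g i) = (\<Oplus>\<^bsub>N'\<^esub> i\<in>I. f (g i))"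
proof -
  interpret N: module R N by fact
  interpret N': module R N' by fact
  show ?thesis using I
  proof (induction I rule: finite_induct)
    case (insert i I)
    have 1: "(\<Oplus>\<^bsub>N\<^esub> j\<in>I. g j) \<in> carrier N" using insert by (intro N.M.finsum_closed) auto
    have "f (\<Oplus>\<^bsub>N\<^esub> j\<in>insert i I. g j) = f (g i \<oplus>\<^bsub>N\<^esub> (\<Oplus>\<^bsub>N\<^esub> j\<in>I. g j))"
      by (rule arg_cong[of _ _ f], rule N.M.finsum_insert) (use insert in auto)
    also have "\<dots> = f (g i) \<oplus>\<^bsub>N'\<^esub> (\<Oplus>\<^bsub>N'\<^esub> j\<in>I. f (g j))" using add[OF _ 1] insert by simp
    also have "\<dots> = (\<Oplus>\<^bsub>N'\<^esub> j\<in>insert i I. f (g j))"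
      by (rule N'.M.finsum_insert[symmetric]) (use insert fc in auto)
    finally show ?case .
  qed (simp add: z)
qed

text \<open>Since the resolution consists of graded modules, this replaces a direct verification of the module
  axioms for \<^const>\<open>coh_complex\<close>.\<close>

lemma transport_graded_module:
  fixes N :: "('k::field pol, 'm) graded_module" and N' :: "('k pol, 'l) graded_module"
  assumes gr: "is_graded_module n N" and bij: "bij_betw f (carrier N) (carrier N')"
    and z: "f \<zero>\<^bsub>N\<^esub> = \<zero>\<^bsub>N'\<^esub>"
    and add: "\<And>x y. x \<in> carrier N \<Longrightarrow> y \<in> carrier N \<Longrightarrow> f (x \<oplus>\<^bsub>N\<^esub> y) = f x \<oplus>\<^bsub>N'\<^esub> f y"
    and smult: "\<And>p x. p \<in> carrier (pol_ring n) \<Longrightarrow> x \<in> carrier N \<Longrightarrow> f (p \<odot>\<^bsub>N\<^esub> x) = p \<odot>\<^bsub>N'\<^esub> f x"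
    and hc: "\<And>a. a \<in> mdegs n \<Longrightarrow> f ` hcomp N a = hcomp N' a"
  shows "is_graded_module n N'"
proof -
  have modN: "module (pol_ring n) N" using gr by (simp add: is_graded_module_def)
  interpret N: module "pol_ring n" N by (rule modN)
  have fc: "f x \<in> carrier N'" if "x \<in> carrier N" for x using bij that by (auto simp: bij_betw_def)
  have surj: "\<exists>x\<in>carrier N. y = f x" if "y \<in> carrier N'" for y using bij that by (auto simp: bij_betw_def)
  have inj: "x = y" if "f x = f y" "x \<in> carrier N" "y \<in> carrier N" for x y
    using bij that by (auto simp: bij_betw_def inj_on_def)
  have modN': "module (pol_ring n) N'"
  proof (rule moduleI[OF cring_pol_ring])
    show "abelian_group N'"
    proof (rule abelian_groupI)
      show "\<zero>\<^bsub>N'\<^esub> \<in> carrier N'" using fc[OF N.M.zero_closed] z by simp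
      fix x' assume "x' \<in> carrier N'"
      then obtain x where x: "x \<in> carrier N" "x' = f x" using surj by blast
      show "\<zero>\<^bsub>N'\<^esub> \<oplus>\<^bsub>N'\<^esub> x' = x'" using add[OF N.M.zero_closed x(1)] x z by simp
      have "f (\<ominus>\<^bsub>N\<^esub> x) \<oplus>\<^bsub>N'\<^esub> x' = \<zero>\<^bsub>N'\<^esub>" using add[OF N.M.a_inv_closed[OF x(1)] x(1)] x z N.M.l_neg by simp
      then show "\<exists>y\<in>carrier N'. y \<oplus>\<^bsub>N'\<^esub> x' = \<zero>\<^bsub>N'\<^esub>" using fc[OF N.M.a_inv_closed[OF x(1)]] by blast
      fix y' assume "y' \<in> carrier N'"
      then obtain y where y: "y \<in> carrier N" "y' = f y" using surj by blast
      show "x' \<oplus>\<^bsub>N'\<^esub> y' \<in> carrier N'" using add[OF x(1) y(1)] fc[OF N.M.a_closed[OF x(1) y(1)]] x y by simp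
      show "x' \<oplus>\<^bsub>N'\<^esub> y' = y' \<oplus>\<^bsub>N'\<^esub> x'" using add x y N.M.a_comm by metis
      fix w' assume "w' \<in> carrier N'"
      then obtain w where w: "w \<in> carrier N" "w' = f w" using surj by blast
      show "x' \<oplus>\<^bsub>N'\<^esub> y' \<oplus>\<^bsub>N'\<^esub> w' = x' \<oplus>\<^bsub>N'\<^esub> (y' \<oplus>\<^bsub>N'\<^esub> w')"
        using add[OF x(1) y(1)] add[OF y(1) w(1)] add[OF N.M.a_closed[OF x(1) y(1)] w(1)]
          add[OF x(1) N.M.a_closed[OF y(1) w(1)]] N.M.a_assoc[OF x(1) y(1) w(1)] x y w by simp
    qed
    fix p x' assume p: "p \<in> carrier (pol_ring n :: 'k pol ring)" and "x' \<in> carrier N'"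
    then obtain x where x: "x \<in> carrier N" "x' = f x" using surj by blast
    show "p \<odot>\<^bsub>N'\<^esub> x' \<in> carrier N'" using smult[OF p x(1)] fc[OF N.smult_closed[OF p x(1)]] x by simp
    { fix q assume q: "q \<in> carrier (pol_ring n :: 'k pol ring)"
      show "(p \<oplus>\<^bsub>pol_ring n\<^esub> q) \<odot>\<^bsub>N'\<^esub> x' = p \<odot>\<^bsub>N'\<^esub> x' \<oplus>\<^bsub>N'\<^esub> q \<odot>\<^bsub>N'\<^esub> x'"
        using smult[OF p x(1)] smult[OF q x(1)] smult[OF N.R.a_closed[OF p q] x(1)] N.smult_l_distr[OF p q x(1)]
          add[OF N.smult_closed[OF p x(1)] N.smult_closed[OF q x(1)]] x(2) by metis
      show "(p \<otimes>\<^bsub>pol_ring n\<^esub> q) \<odot>\<^bsub>N'\<^esub> x' = p \<odot>\<^bsub>N'\<^esub> (q \<odot>\<^bsub>N'\<^esub> x')"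
        using smult[OF p N.smult_closed[OF q x(1)]] smult[OF q x(1)] smult[OF N.R.m_closed[OF p q] x(1)]
          N.smult_assoc1[OF p q x(1)] x(2) by metis }
    fix y' assume "y' \<in> carrier N'"
    then obtain y where y: "y \<in> carrier N" "y' = f y" using surj by blast
    show "p \<odot>\<^bsub>N'\<^esub> (x' \<oplus>\<^bsub>N'\<^esub> y') = p \<odot>\<^bsub>N'\<^esub> x' \<oplus>\<^bsub>N'\<^esub> p \<odot>\<^bsub>N'\<^esub> y'"
      using smult[OF p x(1)] smult[OF p y(1)] smult[OF p N.M.a_closed[OF x(1) y(1)]] N.smult_r_distr[OF p x(1) y(1)]
        add[OF N.smult_closed[OF p x(1)] N.smult_closed[OF p y(1)]] add[OF x(1) y(1)] x(2) y(2) by metis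
  next
    fix x' assume "x' \<in> carrier N'"
    then obtain x where x: "x \<in> carrier N" "x' = f x" using surj by blast
    show "\<one>\<^bsub>pol_ring n\<^esub> \<odot>\<^bsub>N'\<^esub> x' = x'" using smult[OF N.R.one_closed x(1)] N.smult_one[OF x(1)] x(2) by metis
  qed
  interpret N': module "pol_ring n" N' by (rule modN')
  have fs: "f (\<Oplus>\<^bsub>N\<^esub> i\<in>I. g i) = (\<Oplus>\<^bsub>N'\<^esub> i\<in>I. f (g i))" if "finite I" "\<And>i. i \<in> I \<Longrightarrow> g i \<in> carrier N"
    for I :: "mdeg set" and g by (rule finsum_hom[OF modN modN' z add fc that])
  have hcarr: "x \<in> carrier N" if "a \<in> mdegs n" "x \<in> hcomp N a" for a x
    using gr that subgroup.subset[of "hcomp N a" "add_monoid N"] by (auto simp: is_graded_module_def)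
  have sub: "subgroup (hcomp N' a) (add_monoid N')" if a: "a \<in> mdegs n" for a
  proof -
    have "group_hom (add_monoid N) (add_monoid N') f"
      by (rule group_hom.intro[OF N.M.a_group N'.M.a_group])
        (use add fc in \<open>auto simp: group_hom_axioms_def hom_def\<close>)
    then have "subgroup (f ` hcomp N a) (add_monoid N')"
      by (rule group_hom.subgroup_img_is_subgroup) (use gr a in \<open>simp add: is_graded_module_def\<close>)
    then show ?thesis using hc[OF a] by simp
  qed
  have dec: "\<exists>!c. c \<in> (\<Pi>\<^sub>E a\<in>mdegs n. hcomp N' a) \<and> finite {a \<in> mdegs n. c a \<noteq> \<zero>\<^bsub>N'\<^esub>} \<and>
      x' = (\<Oplus>\<^bsub>N'\<^esub> a \<in> {a \<in> mdegs n. c a \<noteq> \<zero>\<^bsub>N'\<^esub>}. c a)" (is "\<exists>!c. ?P' c") if x': "x' \<in> carrier N'" for x'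
  proof -
    obtain x where x: "x \<in> carrier N" "x' = f x" using surj[OF x'] by blast
    let ?P = "\<lambda>c. c \<in> (\<Pi>\<^sub>E a\<in>mdegs n. hcomp N a) \<and> finite {a \<in> mdegs n. c a \<noteq> \<zero>\<^bsub>N\<^esub>} \<and>
      x = (\<Oplus>\<^bsub>N\<^esub> a \<in> {a \<in> mdegs n. c a \<noteq> \<zero>\<^bsub>N\<^esub>}. c a)"
    have ex1: "\<exists>!c. ?P c" using gr x(1) by (simp add: is_graded_module_def)
    let ?t = "\<lambda>c. \<lambda>a\<in>mdegs n. f (c a)"
    have tP: "?P' (?t c) \<longleftrightarrow> ?P c" if c: "c \<in> (\<Pi>\<^sub>E a\<in>mdegs n. hcomp N a)" for c
    proof -
      have cc: "c a \<in> carrier N" if "a \<in> mdegs n" for a using hcarr[OF that] c that by blast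
      have "?t c \<in> (\<Pi>\<^sub>E a\<in>mdegs n. hcomp N' a)" using c hc by (auto simp: PiE_iff)
      moreover have S: "{a \<in> mdegs n. ?t c a \<noteq> \<zero>\<^bsub>N'\<^esub>} = {a \<in> mdegs n. c a \<noteq> \<zero>\<^bsub>N\<^esub>}"
        using inj[OF _ cc N.M.zero_closed] z by auto
      moreover have "(\<Oplus>\<^bsub>N'\<^esub> a \<in> {a \<in> mdegs n. c a \<noteq> \<zero>\<^bsub>N\<^esub>}. ?t c a) = f (\<Oplus>\<^bsub>N\<^esub> a \<in> {a \<in> mdegs n. c a \<noteq> \<zero>\<^bsub>N\<^esub>}. c a)"
        if "finite {a \<in> mdegs n. c a \<noteq> \<zero>\<^bsub>N\<^esub>}"
      proof -
        have "(\<Oplus>\<^bsub>N'\<^esub> a \<in> {a \<in> mdegs n. c a \<noteq> \<zero>\<^bsub>N\<^esub>}. ?t c a) = (\<Oplus>\<^bsub>N'\<^esub> a \<in> {a \<in> mdegs n. c a \<noteq> \<zero>\<^bsub>N\<^esub>}. f (c a))"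
          by (rule N'.M.finsum_cong') (use cc fc in auto)
        also have "\<dots> = f (\<Oplus>\<^bsub>N\<^esub> a \<in> {a \<in> mdegs n. c a \<noteq> \<zero>\<^bsub>N\<^esub>}. c a)"
          by (rule fs[symmetric, OF that]) (use cc in auto)
        finally show ?thesis .
      qed
      moreover have "(\<Oplus>\<^bsub>N\<^esub> a \<in> {a \<in> mdegs n. c a \<noteq> \<zero>\<^bsub>N\<^esub>}. c a) \<in> carrier N"
        by (rule N.M.finsum_closed) (use cc in auto)
      ultimately show ?thesis unfolding S using c x inj by (smt (verit, best))
    qed
    obtain c where c: "?P c" using ex1 by blast
    show ?thesis
    proof (rule ex1I[of _ "?t c"])
      show "?P' (?t c)" using tP c by blast
      fix c' assume c': "?P' c'"
      \<comment> \<open>For uniqueness an arbitrary decomposition in the target is pulled back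
        through f, degree by degree.\<close>
      define c0 where "c0 = (\<lambda>a\<in>mdegs n. inv_into (hcomp N a) f (c' a))"
      have 1: "c' a \<in> f ` hcomp N a" if "a \<in> mdegs n" for a using c' hc[OF that] that by (auto simp: PiE_iff)
      have c0: "c0 \<in> (\<Pi>\<^sub>E a\<in>mdegs n. hcomp N a)" using inv_into_into[OF 1] by (auto simp: c0_def PiE_iff)
      have t0: "?t c0 = c'"
      proof
        fix a show "?t c0 a = c' a" using f_inv_into_f[OF 1] c' by (cases "a \<in> mdegs n") (auto simp: c0_def PiE_iff extensional_def)
      qed
      then have "?P c0" using tP[OF c0] c' by simp
      then have "c0 = c" using ex1 c by blast
      then show "c' = ?t c" using t0 by simp
    qed
  qed
  have "p \<odot>\<^bsub>N'\<^esub> x' \<in> hcomp N' (deg_plus a b)"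
    if ab: "a \<in> mdegs n" "b \<in> mdegs n" and p: "p \<in> pol_comp n a" and x': "x' \<in> hcomp N' b" for a b p x'
  proof -
    obtain x where x: "x \<in> hcomp N b" "x' = f x" using x' hc[OF ab(2)] by blast
    have "p \<odot>\<^bsub>N\<^esub> x \<in> hcomp N (deg_plus a b)" using gr ab p x by (simp add: is_graded_module_def)
    moreover have "deg_plus a b \<in> mdegs n" using ab by (simp add: deg_plus_eq mdegs_add)
    moreover have "p \<in> carrier (pol_ring n)" using p by (simp add: pol_comp_def)
    ultimately show ?thesis using hc smult[of p x] hcarr[OF ab(2) x(1)] x(2) by (metis imageI)
  qed
  then show ?thesis unfolding is_graded_module_def by (intro conjI ballI modN' sub dec)
qed

section \<open>The linearized differential\<close>

context SR_resolution
begin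

abbreviation lin where "lin \<equiv> lin_diff n F d B"

definition lent :: "nat \<Rightarrow> 'm \<Rightarrow> 'm \<Rightarrow> 'k pol" where
  "lent i b c = lin_entry n (cs i (d i b) c)"

lemma mon_of_diff:
  assumes "b \<in> B j" "c \<in> B i" "dgr i c \<le> dgr j b"
  shows "mon_deg (mon_of (dgr j b - dgr i c)) = dgr j b - dgr i c" "mon_of (dgr j b - dgr i c) \<in> mons n"
proof -
  have 1: "dgr j b - dgr i c \<in> mdegs n" using G.dg(1)[OF assms(1)] G.dg(1)[OF assms(2)] mdegs_diff by blast
  show "mon_deg (mon_of (dgr j b - dgr i c)) = dgr j b - dgr i c"
    by (rule mon_deg_mon_of[OF 1]) (use assms in \<open>simp add: le_fun_def\<close>)
  then show "mon_of (dgr j b - dgr i c) \<in> mons n" using 1 by (simp add: mons_iff_mon_deg)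
qed

lemma lin_entry_0: "lin_entry n 0 = 0"
  by (simp add: lin_entry_def)

lemma lent_eq:
  assumes b: "b \<in> B (Suc i)" and c: "c \<in> B i"
  shows "lent i b c = (if entry i b c \<noteq> 0 \<and> tdeg n (mon_of (dgr (Suc i) b - dgr i c)) = 1
    then single (mon_of (dgr (Suc i) b - dgr i c)) (entry i b c) else 0)"
proof (cases "entry i b c = 0")
  case True
  then have "cs i (d i b) c = 0" using d_coords[OF b c] by simp
  then show ?thesis using True by (simp add: lent_def lin_entry_0)
next
  case False
  then have le: "dgr i c \<le> dgr (Suc i) b" "dgr i c \<noteq> dgr (Suc i) b" using entry_nz by blast+
  note m = mon_of_diff[OF b c le(1)]
  have "mon_of (dgr (Suc i) b - dgr i c) \<noteq> 0"
    using m(1) le(2) by (metis mon_deg_0 right_minus_eq)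
  then show ?thesis using lin_entry_single[OF m(2), of "entry i b c"] False le(1) d_coords[OF b c] by (simp add: lent_def)
qed

lemma lent_keys: "b \<in> B (Suc i) \<Longrightarrow> c \<in> B i \<Longrightarrow> keys (lent i b c) \<subseteq> mons n"
  using mon_of_diff(2) entry_nz_le[of i b c] by (auto simp: lent_eq)

lemma lin_closed_coords:
  assumes x: "x \<in> carrier (F (Suc i))"
  shows "lin i x \<in> carrier (F i)"
    "c \<in> B i \<Longrightarrow> cs i (lin i x) c = (\<Sum>b\<in>B (Suc i). lent i b c * cs (Suc i) x b)"
proof -
  have eq: "lin i x = graded_free.combo (F i) (B i) (\<lambda>c. \<Sum>b\<in>B (Suc i). lent i b c * cs (Suc i) x b)"
    by (simp add: lin_diff_def G.combo_def lent_def)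
  have k: "(\<Sum>b\<in>B (Suc i). lent i b c * cs (Suc i) x b) \<in> carrier (pol_ring n)" if "c \<in> B i" for c
    unfolding pol_ring_simps by (intro keys_sum_mons keys_times_mons lent_keys that G.coords_keys[OF x])
  show "lin i x \<in> carrier (F i)" unfolding eq by (rule G.combo_closed[OF k])
  show "c \<in> B i \<Longrightarrow> cs i (lin i x) c = (\<Sum>b\<in>B (Suc i). lent i b c * cs (Suc i) x b)"
    unfolding eq by (rule G.coords_combo[OF k])
qed

lemma lin_hom: "lin i \<in> graded_hom n (F (Suc i)) (F i)"
  unfolding graded_hom_def
proof (intro CollectI conjI ballI)
  show "lin i \<in> carrier (F (Suc i)) \<rightarrow> carrier (F i)" using lin_closed_coords(1) by blast
  fix x assume x: "x \<in> carrier (F (Suc i))"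
  { fix y assume y: "y \<in> carrier (F (Suc i))"
    show "lin i (x \<oplus>\<^bsub>F (Suc i)\<^esub> y) = lin i x \<oplus>\<^bsub>F i\<^esub> lin i y"
    proof (rule G.coords_inject)
      fix c assume c: "c \<in> B i"
      show "cs i (lin i (x \<oplus>\<^bsub>F (Suc i)\<^esub> y)) c = cs i (lin i x \<oplus>\<^bsub>F i\<^esub> lin i y) c"
        using x y c by (simp add: lin_closed_coords G.coords_add distrib_left sum.distrib)
    qed (use x y lin_closed_coords(1) in auto) }
next
  fix p x assume p: "p \<in> carrier (pol_ring n :: 'k pol ring)" and x: "x \<in> carrier (F (Suc i))"
  have px: "p \<odot>\<^bsub>F (Suc i)\<^esub> x \<in> carrier (F (Suc i))" by (rule G.smult_closed[OF p x])
  show "lin i (p \<odot>\<^bsub>F (Suc i)\<^esub> x) = p \<odot>\<^bsub>F i\<^esub> lin i x"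
  proof (rule G.coords_inject[OF lin_closed_coords(1)[OF px] G.smult_closed[OF p lin_closed_coords(1)[OF x]]])
    fix c assume c: "c \<in> B i"
    have "cs i (lin i (p \<odot>\<^bsub>F (Suc i)\<^esub> x)) c = (\<Sum>b\<in>B (Suc i). lent i b c * (p * cs (Suc i) x b))"
      unfolding lin_closed_coords(2)[OF px c] by (intro sum.cong refl) (simp only: G.coords_smult[OF x p])
    also have "\<dots> = p * (\<Sum>b\<in>B (Suc i). lent i b c * cs (Suc i) x b)" by (simp add: sum_distrib_left mult_ac)
    also have "\<dots> = cs i (p \<odot>\<^bsub>F i\<^esub> lin i x) c"
      unfolding G.coords_smult[OF lin_closed_coords(1)[OF x] p c] lin_closed_coords(2)[OF x c] ..
    finally show "cs i (lin i (p \<odot>\<^bsub>F (Suc i)\<^esub> x)) c = cs i (p \<odot>\<^bsub>F i\<^esub> lin i x) c" .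
  qed
next
  fix a assume a: "a \<in> mdegs n"
  show "lin i ` hcomp (F (Suc i)) a \<subseteq> hcomp (F i) a"
  proof clarify
    fix x assume xh: "x \<in> hcomp (F (Suc i)) a"
    then have x: "x \<in> carrier (F (Suc i))" using G.hcomp_carrier[OF a] by blast
    show "lin i x \<in> hcomp (F i) a"
    proof (rule G.hcomp_if_coords[OF lin_closed_coords(1)[OF x] a])
      fix c m assume c: "c \<in> B i" and "m \<in> keys (cs i (lin i x) c)"
      then have "lookup (\<Sum>b\<in>B (Suc i). lent i b c * cs (Suc i) x b) m \<noteq> 0" by (simp add: in_keys_iff lin_closed_coords(2)[OF x c])
      then obtain b where b: "b \<in> B (Suc i)" "lookup (lent i b c * cs (Suc i) x b) m \<noteq> 0"
        unfolding lookup_sum by (meson sum.not_neutral_contains_not_neutral)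
      then have "m \<in> keys (lent i b c * cs (Suc i) x b)" by (simp add: in_keys_iff)
      then obtain m1 m2 where m: "m = m1 + m2" "m1 \<in> keys (lent i b c)" "m2 \<in> keys (cs (Suc i) x b)"
        using keys_mult by blast
      then have "entry i b c \<noteq> 0" "m1 = mon_of (dgr (Suc i) b - dgr i c)" using lent_eq[OF b(1) c] by (auto split: if_splits)
      then have "mon_deg m1 = dgr (Suc i) b - dgr i c" using mon_of_diff(1)[OF b(1) c] entry_nz_le by blast
      then have "mon_deg m + dgr i c = mon_deg m2 + dgr (Suc i) b" by (simp add: m(1) mon_deg_add)
      then show "mon_deg m + dgr i c = a" using G.hcomp_coords[OF a xh b(1) m(3)] by simp
    qed
  qed
qed

text \<open>In degrees of total size 2 every nonzero product of two scalar entries comes from two linear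
  entries by minimality, so that \<open>d \<circ> d = 0\<close> applies.\<close>

lemma lent_lent:
  assumes b: "b \<in> B (Suc (Suc i))" and e: "e \<in> B i"
  shows "(\<Sum>c\<in>B (Suc i). lent i c e * lent (Suc i) b c) = 0"
proof -
  let ?m = "mon_of (dgr (Suc (Suc i)) b - dgr i e)"
  have "(\<Sum>c\<in>B (Suc i). lent i c e * lent (Suc i) b c) =
    (\<Sum>c\<in>B (Suc i). if tdeg n ?m = 2 then single ?m (entry (Suc i) b c * entry i c e) else 0)"
  proof (intro sum.cong refl)
    fix c assume c: "c \<in> B (Suc i)"
    show "lent i c e * lent (Suc i) b c = (if tdeg n ?m = 2 then single ?m (entry (Suc i) b c * entry i c e) else 0)"
    proof (cases "entry (Suc i) b c = 0 \<or> entry i c e = 0")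
      case True
      then show ?thesis by (auto simp: lent_eq[OF b c] lent_eq[OF c e])
    next
      case False
      let ?m1 = "mon_of (dgr (Suc (Suc i)) b - dgr (Suc i) c)" and ?m2 = "mon_of (dgr (Suc i) c - dgr i e)"
      have le: "dgr (Suc i) c \<le> dgr (Suc (Suc i)) b" "dgr (Suc i) c \<noteq> dgr (Suc (Suc i)) b"
        "dgr i e \<le> dgr (Suc i) c" "dgr i e \<noteq> dgr (Suc i) c" using False entry_nz by blast+
      note m1 = mon_of_diff[OF b c le(1)] and m2 = mon_of_diff[OF c e le(3)]
      have "mon_deg ?m = mon_deg (?m1 + ?m2)"
        using mon_of_diff(1)[OF b e] le order_trans by (simp add: mon_deg_add m1 m2)
      then have m: "?m = ?m1 + ?m2" by (simp only: mon_deg_inj)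
      have "?m1 \<noteq> 0" "?m2 \<noteq> 0" using m1(1) m2(1) le by (metis mon_deg_0 right_minus_eq)+
      then have "1 \<le> tdeg n ?m1" "1 \<le> tdeg n ?m2" using tdeg_ge_1 m1(2) m2(2) by blast+
      moreover have "tdeg n ?m = tdeg n ?m1 + tdeg n ?m2" by (simp only: m tdeg_add)
      ultimately have "tdeg n ?m = 2 \<longleftrightarrow> tdeg n ?m1 = 1 \<and> tdeg n ?m2 = 1" by arith
      then show ?thesis using False unfolding lent_eq[OF b c] lent_eq[OF c e] m
        by (auto simp: mult_single add.commute mult.commute)
    qed
  qed
  also have "\<dots> = 0"
  proof (cases "tdeg n ?m = 2")
    case True
    have "(\<Sum>c\<in>B (Suc i). single ?m (entry (Suc i) b c * entry i c e)) =
      single ?m (\<Sum>c\<in>B (Suc i). entry (Suc i) b c * entry i c e)"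
      by (rule poly_mapping_eqI) (simp add: lookup_sum lookup_single when_def)
    then show ?thesis using True entry_entry[of i b e] by simp
  qed simp
  finally show ?thesis .
qed

lemma lin_lin:
  assumes x: "x \<in> carrier (F (Suc (Suc i)))"
  shows "lin i (lin (Suc i) x) = \<zero>\<^bsub>F i\<^esub>"
proof (rule G.coords_inject)
  note lx = lin_closed_coords(1)[OF x]
  show "lin i (lin (Suc i) x) \<in> carrier (F i)" using lin_closed_coords(1)[OF lx] .
  fix e assume e: "e \<in> B i"
  have "cs i (lin i (lin (Suc i) x)) e = (\<Sum>c\<in>B (Suc i). \<Sum>b\<in>B (Suc (Suc i)). lent i c e * lent (Suc i) b c * cs (Suc (Suc i)) x b)"
    by (simp add: lin_closed_coords(2)[OF lx e] lin_closed_coords(2)[OF x] sum_distrib_left mult.assoc)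
  also have "\<dots> = (\<Sum>b\<in>B (Suc (Suc i)). \<Sum>c\<in>B (Suc i). lent i c e * lent (Suc i) b c * cs (Suc (Suc i)) x b)"
    by (rule sum.swap)
  also have "\<dots> = (\<Sum>b\<in>B (Suc (Suc i)). (\<Sum>c\<in>B (Suc i). lent i c e * lent (Suc i) b c) * cs (Suc (Suc i)) x b)"
    by (simp add: sum_distrib_right)
  also have "\<dots> = 0" using lent_lent[OF _ e] by (intro sum.neutral) simp
  finally show "cs i (lin i (lin (Suc i) x)) e = cs i \<zero>\<^bsub>F i\<^esub> e" by (simp add: G.coords_zero[OF e])
qed simp

end

section \<open>The isomorphism\<close>

lemma coh_complex_simps:
  fixes f :: "nat set \<Rightarrow> mon \<Rightarrow> (nat set \<Rightarrow> 'k::field) set"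
  shows "f \<in> carrier (coh_complex n \<Delta> i) \<longleftrightarrow> f \<in> extensional (Pow {1..n}) \<and>
    (\<forall>U\<in>Pow {1..n}. (\<forall>m. f U m \<in> carrier (coh \<Delta> i U)) \<and> {m. f U m \<noteq> \<zero>\<^bsub>coh \<Delta> i U\<^esub>} \<subseteq> mons n \<and>
      finite {m. f U m \<noteq> \<zero>\<^bsub>coh \<Delta> i U\<^esub>})" (is ?A)
    "\<zero>\<^bsub>coh_complex n \<Delta> i\<^esub> = (\<lambda>U\<in>Pow {1..n}. \<lambda>_. \<zero>\<^bsub>coh \<Delta> i U :: ('k, _) module\<^esub>)" (is ?B)
    "f \<oplus>\<^bsub>coh_complex n \<Delta> i\<^esub> g = (\<lambda>U\<in>Pow {1..n}. \<lambda>m. f U m \<oplus>\<^bsub>coh \<Delta> i U\<^esub> g U m)" (is ?C)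
    "p \<odot>\<^bsub>coh_complex n \<Delta> i\<^esub> f = (\<lambda>U\<in>Pow {1..n}. \<lambda>m. \<Oplus>\<^bsub>coh \<Delta> i U\<^esub> a \<in> {a \<in> keys p. \<exists>b. m = a + b}.
        lookup p a \<odot>\<^bsub>coh \<Delta> i U\<^esub> f U (m - a))" (is ?D)
    "hcomp (coh_complex n \<Delta> i) a = {f \<in> carrier (coh_complex n \<Delta> i). \<forall>U\<in>Pow {1..n}. \<forall>m.
        f U m \<noteq> \<zero>\<^bsub>coh \<Delta> i U :: ('k, _) module\<^esub> \<longrightarrow> mon_deg m + sqfree_deg U = a}" (is ?E)
proof -
  \<comment> \<open>There are finitely many U, so the finite-support condition of
    \<open>direct_sum\<close> holds automatically.\<close>
  have fin: "finite {U \<in> Pow {1..n}. Q U}" for Q by simp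
  show ?A using fin
    by (simp add: coh_complex_def Let_def with_grading_def module.defs graded_module.defs direct_sum_def mk_module_def tensor_S_def PiE_def Pi_def) blast
  show ?B ?C ?D ?E
    by (simp_all add: coh_complex_def Let_def with_grading_def module.defs graded_module.defs direct_sum_def mk_module_def tensor_S_def deg_plus_eq)
qed

section \<open>Additive structure of cohomology, transported along \<open>\<Psi>\<close>\<close>

context resolution_frame
begin

lemma P_0: "0 \<in> P a i"
  by (simp add: P_def)

lemma P_add: "y \<in> P a i \<Longrightarrow> y' \<in> P a i \<Longrightarrow> y + y' \<in> P a i"
  unfolding P_def by (simp add: fun_eq_iff) (metis add_0)

lemma P_smult: "y \<in> P a i \<Longrightarrow> (\<lambda>b. r * y b) \<in> P a i"
  by (simp add: P_def)

lemma \<Psi>_zero: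
  assumes U: "U \<subseteq> {1..n}"
  shows "\<Psi> i U 0 = \<zero>\<^bsub>coh \<Delta> i U\<^esub>"
proof -
  obtain c where "tor (sqfree_deg U) i 0 c" using tor_P_total[OF sqfree_deg_in_mdegs[OF U] P_0] by blast
  from tor_diff[OF this this] have "tor (sqfree_deg U) i 0 0" by simp
  then show ?thesis using \<Psi>_eq[OF U] by (simp add: coh_def cohomology_zero to_cochain_0)
qed

lemma \<Psi>_closed: "U \<subseteq> {1..n} \<Longrightarrow> y \<in> P (sqfree_deg U) i \<Longrightarrow> \<Psi> i U y \<in> carrier (coh \<Delta> i U)"
  using \<Psi>_bij unfolding bij_betw_def by blast

lemma \<Psi>_surj:
  assumes "U \<subseteq> {1..n}" "\<omega> \<in> carrier (coh \<Delta> i U)"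
  obtains y where "y \<in> P (sqfree_deg U) i" "\<omega> = \<Psi> i U y"
  using assms \<Psi>_bij unfolding bij_betw_def by blast

lemma \<Psi>_eq_zero:
  assumes "U \<subseteq> {1..n}" "y \<in> P (sqfree_deg U) i"
  shows "\<Psi> i U y = \<zero>\<^bsub>coh \<Delta> i U\<^esub> \<longleftrightarrow> y = 0"
  using \<Psi>_diff[OF assms P_0] \<Psi>_zero[OF assms(1)] by auto

text \<open>Every class is a value of \<open>\<Psi>\<close>, which is additive, so the laws come
  from addition of functions. A commutative monoid is what finite sums of classes require.\<close>

lemma coh_abelian_monoid:
  assumes U: "U \<subseteq> {1..n}"
  shows "abelian_monoid (coh \<Delta> i U :: ('k, _) module)"
proof (rule abelian_monoidI)
  show "\<zero>\<^bsub>coh \<Delta> i U\<^esub> \<in> carrier (coh \<Delta> i U :: ('k, _) module)" using \<Psi>_closed[OF U P_0] \<Psi>_zero[OF U] by metis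
  fix x :: "(nat set \<Rightarrow> 'k) set" assume "x \<in> carrier (coh \<Delta> i U)"
  then obtain x' where x: "x' \<in> P (sqfree_deg U) i" "x = \<Psi> i U x'" by (rule \<Psi>_surj[OF U])
  show "\<zero>\<^bsub>coh \<Delta> i U\<^esub> \<oplus>\<^bsub>coh \<Delta> i U\<^esub> x = x" using \<Psi>_add[OF U P_0 x(1)] x(2) \<Psi>_zero[OF U] by simp
  fix y :: "(nat set \<Rightarrow> 'k) set" assume "y \<in> carrier (coh \<Delta> i U)"
  then obtain y' where y: "y' \<in> P (sqfree_deg U) i" "y = \<Psi> i U y'" by (rule \<Psi>_surj[OF U])
  show "x \<oplus>\<^bsub>coh \<Delta> i U\<^esub> y \<in> carrier (coh \<Delta> i U)"
    using \<Psi>_add[OF U x(1) y(1)] \<Psi>_closed[OF U P_add[OF x(1) y(1)]] x(2) y(2) by simp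
  show "x \<oplus>\<^bsub>coh \<Delta> i U\<^esub> y = y \<oplus>\<^bsub>coh \<Delta> i U\<^esub> x"
    using \<Psi>_add[OF U x(1) y(1)] \<Psi>_add[OF U y(1) x(1)] x(2) y(2) by (simp add: add.commute)
  fix z :: "(nat set \<Rightarrow> 'k) set" assume "z \<in> carrier (coh \<Delta> i U)"
  then obtain z' where z: "z' \<in> P (sqfree_deg U) i" "z = \<Psi> i U z'" by (rule \<Psi>_surj[OF U])
  show "x \<oplus>\<^bsub>coh \<Delta> i U\<^esub> y \<oplus>\<^bsub>coh \<Delta> i U\<^esub> z = x \<oplus>\<^bsub>coh \<Delta> i U\<^esub> (y \<oplus>\<^bsub>coh \<Delta> i U\<^esub> z)"
    using \<Psi>_add[OF U x(1) y(1)] \<Psi>_add[OF U y(1) z(1)] \<Psi>_add[OF U P_add[OF x(1) y(1)] z(1)]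
      \<Psi>_add[OF U x(1) P_add[OF y(1) z(1)]] x(2) y(2) z(2) by (simp add: add.assoc)
qed

lemma \<Psi>_finsum:
  assumes U: "U \<subseteq> {1..n}" and I: "finite I" "\<And>j. j \<in> I \<Longrightarrow> y j \<in> P (sqfree_deg U) i"
  shows "(\<Oplus>\<^bsub>coh \<Delta> i U\<^esub> j\<in>I. \<Psi> i U (y j)) = \<Psi> i U (\<Sum>j\<in>I. y j)" "(\<Sum>j\<in>I. y j) \<in> P (sqfree_deg U) i"
proof -
  interpret A: abelian_monoid "coh \<Delta> i U :: ('k, _) module" by (rule coh_abelian_monoid[OF U])
  have "(\<Oplus>\<^bsub>coh \<Delta> i U\<^esub> j\<in>I. \<Psi> i U (y j)) = \<Psi> i U (\<Sum>j\<in>I. y j) \<and> (\<Sum>j\<in>I. y j) \<in> P (sqfree_deg U) i"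
    using I
  proof (induction I rule: finite_induct)
    case empty
    show ?case unfolding sum.empty A.finsum_empty by (intro conjI \<Psi>_zero[OF U, symmetric] P_0)
  next
    case (insert j I)
    have "(\<Oplus>\<^bsub>coh \<Delta> i U\<^esub> j\<in>insert j I. \<Psi> i U (y j)) = \<Psi> i U (y j) \<oplus>\<^bsub>coh \<Delta> i U\<^esub> (\<Oplus>\<^bsub>coh \<Delta> i U\<^esub> j\<in>I. \<Psi> i U (y j))"
      by (rule A.finsum_insert) (use insert \<Psi>_closed[OF U] in auto)
    moreover have yj: "y j \<in> P (sqfree_deg U) i" and IH: "(\<Oplus>\<^bsub>coh \<Delta> i U\<^esub> j\<in>I. \<Psi> i U (y j)) = \<Psi> i U (\<Sum>j\<in>I. y j)"
      "(\<Sum>j\<in>I. y j) \<in> P (sqfree_deg U) i" using insert by simp_all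
    ultimately show ?case
      unfolding sum.insert[OF insert.hyps] \<Psi>_add[OF U yj IH(2)] IH(1) using P_add[OF yj IH(2)] by blast
  qed
  then show "(\<Oplus>\<^bsub>coh \<Delta> i U\<^esub> j\<in>I. \<Psi> i U (y j)) = \<Psi> i U (\<Sum>j\<in>I. y j)" "(\<Sum>j\<in>I. y j) \<in> P (sqfree_deg U) i" by auto
qed

end

lemma sum_fun_apply: "(\<Sum>j\<in>I. g j) b = (\<Sum>j\<in>I. g j b)"
  by (induction I rule: infinite_finite_induct) simp_all

lemma sqfree_deg_inject: "sqfree_deg U = sqfree_deg V \<Longrightarrow> U = V"
  by (auto simp: sqfree_deg_def fun_eq_iff split: if_splits)

context SR_resolution
begin

text \<open>The coefficient of the monomial m in the U-summand of F_i, viewed as the sum over U of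
  (F_i / m F_i)_U tensored with S(-U).\<close>

definition slice :: "nat \<Rightarrow> nat set \<Rightarrow> 'm \<Rightarrow> mon \<Rightarrow> 'm \<Rightarrow> 'k" where
  "slice i U x m b = (if b \<in> B i \<and> dgr i b = sqfree_deg U then lookup (cs i x b) m else 0)"

definition phi :: "nat \<Rightarrow> 'm \<Rightarrow> nat set \<Rightarrow> mon \<Rightarrow> (nat set \<Rightarrow> 'k) set" where
  "phi i x = (\<lambda>U\<in>Pow {1..n}. \<lambda>m. R.\<Psi> i U (slice i U x m))"

lemma slice_P: "slice i U x m \<in> R.P (sqfree_deg U) i"
  by (simp add: R.P_def slice_def)

lemma phi_zero_iff:
  assumes "U \<subseteq> {1..n}"
  shows "phi i x U m = \<zero>\<^bsub>coh \<Delta> i U\<^esub> \<longleftrightarrow> slice i U x m = 0"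
  using R.\<Psi>_eq_zero[OF assms slice_P] assms by (simp add: phi_def)

lemma slice_nz: "slice i U x m \<noteq> 0 \<longleftrightarrow> (\<exists>b\<in>B i. dgr i b = sqfree_deg U \<and> m \<in> keys (cs i x b))"
  by (auto simp: slice_def fun_eq_iff in_keys_iff)

lemma phi_closed:
  assumes x: "x \<in> carrier (F i)"
  shows "phi i x \<in> carrier (coh_complex n \<Delta> i)"
  unfolding coh_complex_simps
proof (intro conjI ballI allI)
  show "phi i x \<in> extensional (Pow {1..n})" by (simp add: phi_def)
  fix U assume "U \<in> Pow {1..n}"
  then have U: "U \<subseteq> {1..n}" by simp
  show "phi i x U m \<in> carrier (coh \<Delta> i U)" for m using R.\<Psi>_closed[OF U slice_P] U by (simp add: phi_def)
  have S: "{m. phi i x U m \<noteq> \<zero>\<^bsub>coh \<Delta> i U\<^esub>} \<subseteq> (\<Union>b\<in>B i. keys (cs i x b))"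
    unfolding phi_zero_iff[OF U] slice_nz by blast
  then show "{m. phi i x U m \<noteq> \<zero>\<^bsub>coh \<Delta> i U\<^esub>} \<subseteq> mons n" using G.coords_keys[OF x] by blast
  show "finite {m. phi i x U m \<noteq> \<zero>\<^bsub>coh \<Delta> i U\<^esub>}" by (rule finite_subset[OF S]) (simp add: G.finite_B)
qed

lemma phi_add:
  assumes x: "x \<in> carrier (F i)" and y: "y \<in> carrier (F i)"
  shows "phi i (x \<oplus>\<^bsub>F i\<^esub> y) = phi i x \<oplus>\<^bsub>coh_complex n \<Delta> i\<^esub> phi i y"
proof -
  have "slice i U (x \<oplus>\<^bsub>F i\<^esub> y) m = slice i U x m + slice i U y m" for U m
    using G.coords_add[OF x y] by (auto simp: slice_def fun_eq_iff lookup_add)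
  then show ?thesis unfolding coh_complex_simps phi_def
    by (intro restrict_ext ext) (simp add: R.\<Psi>_add[OF _ slice_P slice_P])
qed

lemma phi_zero: "phi i \<zero>\<^bsub>F i\<^esub> = \<zero>\<^bsub>coh_complex n \<Delta> i\<^esub>"
proof -
  have "slice i U \<zero>\<^bsub>F i\<^esub> m = 0" for U m using G.coords_zero by (auto simp: slice_def fun_eq_iff)
  then show ?thesis unfolding coh_complex_simps phi_def by (intro restrict_ext ext) (simp add: R.\<Psi>_zero)
qed

lemma phi_smult:
  assumes p: "p \<in> carrier (pol_ring n)" and x: "x \<in> carrier (F i)"
  shows "phi i (p \<odot>\<^bsub>F i\<^esub> x) = p \<odot>\<^bsub>coh_complex n \<Delta> i\<^esub> phi i x"
  unfolding coh_complex_simps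
proof
  fix U
  show "phi i (p \<odot>\<^bsub>F i\<^esub> x) U = (\<lambda>U\<in>Pow {1..n}. \<lambda>m. \<Oplus>\<^bsub>coh \<Delta> i U\<^esub> a \<in> {a \<in> keys p. \<exists>b. m = a + b}.
        lookup p a \<odot>\<^bsub>coh \<Delta> i U\<^esub> phi i x U (m - a)) U"
  proof (cases "U \<subseteq> {1..n}")
    case False
    then show ?thesis by (simp add: phi_def)
  next
    case U: True
    show ?thesis
    proof
      fix m
      let ?S = "{a \<in> keys p. \<exists>b. m = a + b}"
      have sl: "slice i U (p \<odot>\<^bsub>F i\<^esub> x) m = (\<Sum>a\<in>?S. (\<lambda>b. lookup p a * slice i U x (m - a) b))"
      proof
        fix b
        have "slice i U (p \<odot>\<^bsub>F i\<^esub> x) m b = (\<Sum>a\<in>?S. lookup p a * slice i U x (m - a) b)"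
          using G.coords_smult[OF x p, of b]
          by (cases "b \<in> B i \<and> dgr i b = sqfree_deg U") (auto simp: slice_def lookup_times)
        also have "\<dots> = (\<Sum>a\<in>?S. (\<lambda>b. lookup p a * slice i U x (m - a) b)) b"
          by (rule sum_fun_apply[symmetric])
        finally show "slice i U (p \<odot>\<^bsub>F i\<^esub> x) m b = (\<Sum>a\<in>?S. (\<lambda>b. lookup p a * slice i U x (m - a) b)) b" .
      qed
      have "(\<Oplus>\<^bsub>coh \<Delta> i U\<^esub> a \<in> ?S. lookup p a \<odot>\<^bsub>coh \<Delta> i U\<^esub> phi i x U (m - a)) =
        (\<Oplus>\<^bsub>coh \<Delta> i U\<^esub> a \<in> ?S. R.\<Psi> i U (\<lambda>b. lookup p a * slice i U x (m - a) b))"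
        using U by (simp add: phi_def R.\<Psi>_smult[OF U slice_P])
      also have "\<dots> = R.\<Psi> i U (slice i U (p \<odot>\<^bsub>F i\<^esub> x) m)"
        unfolding sl by (rule R.\<Psi>_finsum(1)[OF U]) (auto intro: R.P_smult slice_P)
      finally show "phi i (p \<odot>\<^bsub>F i\<^esub> x) U m = (\<lambda>U\<in>Pow {1..n}. \<lambda>m. \<Oplus>\<^bsub>coh \<Delta> i U\<^esub> a \<in> {a \<in> keys p. \<exists>b. m = a + b}.
        lookup p a \<odot>\<^bsub>coh \<Delta> i U\<^esub> phi i x U (m - a)) U m" using U by (simp add: phi_def)
    qed
  qed
qed

text \<open>By \<open>degrees_squarefree\<close> every basis element belongs to some U, so the
  slices together see all coordinates.\<close>

lemma phi_inj: "inj_on (phi i) (carrier (F i))"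
proof (rule inj_onI, rule G.coords_inject)
  fix x y b assume x: "x \<in> carrier (F i)" and y: "y \<in> carrier (F i)" and eq: "phi i x = phi i y" and b: "b \<in> B i"
  obtain U where U: "U \<subseteq> {1..n}" "dgr i b = sqfree_deg U" using R.degrees_squarefree[OF b] by blast
  show "cs i x b = cs i y b"
  proof (rule poly_mapping_eqI)
    fix m
    have "phi i x U m = phi i y U m" using eq by simp
    then have "R.\<Psi> i U (slice i U x m) = R.\<Psi> i U (slice i U y m)" using U by (simp add: phi_def)
    then have "slice i U x m = slice i U y m" by (rule R.\<Psi>_diff[OF U(1) slice_P slice_P])
    from fun_cong[OF this, of b] show "lookup (cs i x b) m = lookup (cs i y b) m" using b U by (simp add: slice_def)
  qed
qed

lemma phi_surj:
  assumes f: "f \<in> carrier (coh_complex n \<Delta> i)"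
  shows "\<exists>x\<in>carrier (F i). phi i x = f"
proof -
  have fU: "\<And>m. f U m \<in> carrier (coh \<Delta> i U)" "{m. f U m \<noteq> \<zero>\<^bsub>coh \<Delta> i U\<^esub>} \<subseteq> mons n" "finite {m. f U m \<noteq> \<zero>\<^bsub>coh \<Delta> i U\<^esub>}"
    if "U \<subseteq> {1..n}" for U using f that unfolding coh_complex_simps by blast+
  have "\<exists>y. y \<in> R.P (sqfree_deg U) i \<and> f U m = R.\<Psi> i U y" if "U \<subseteq> {1..n}" for U m
    using R.\<Psi>_surj[OF that fU(1)[OF that]] by metis
  then obtain y where y: "\<And>U m. U \<subseteq> {1..n} \<Longrightarrow> y U m \<in> R.P (sqfree_deg U) i" "\<And>U m. U \<subseteq> {1..n} \<Longrightarrow> f U m = R.\<Psi> i U (y U m)"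
    by metis
  have y0: "y U m = 0 \<longleftrightarrow> f U m = \<zero>\<^bsub>coh \<Delta> i U\<^esub>" if "U \<subseteq> {1..n}" for U m
    using R.\<Psi>_eq_zero[OF that y(1)[OF that]] y(2)[OF that] by metis
  \<comment> \<open>The squarefree degree of b, which is unique by
    \<open>sqfree_deg_inject\<close>.\<close>
  define V where "V b = (SOME U. U \<subseteq> {1..n} \<and> dgr i b = sqfree_deg U)" for b
  have V: "V b \<subseteq> {1..n}" "dgr i b = sqfree_deg (V b)" if "b \<in> B i" for b
    using someI_ex[of "\<lambda>U. U \<subseteq> {1..n} \<and> dgr i b = sqfree_deg U"] R.degrees_squarefree[OF that] unfolding V_def by blast+
  \<comment> \<open>The coordinate at b collects the values at b over all monomials m; its support
    is finite because that of f at \<open>V b\<close> is.\<close>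
  define p where "p b = Abs_poly_mapping (\<lambda>m. y (V b) m b)" for b
  have sub: "{m. y (V b) m b \<noteq> 0} \<subseteq> {m. f (V b) m \<noteq> \<zero>\<^bsub>coh \<Delta> i (V b)\<^esub>}" if "b \<in> B i" for b
    using y0[OF V(1)[OF that]] by (auto simp: fun_eq_iff)
  have lp: "lookup (p b) m = y (V b) m b" if "b \<in> B i" for b m
    unfolding p_def using finite_subset[OF sub[OF that] fU(3)[OF V(1)[OF that]]] by simp
  have pc: "p b \<in> carrier (pol_ring n)" if "b \<in> B i" for b
  proof -
    have "keys (p b) \<subseteq> {m. y (V b) m b \<noteq> 0}" using lp[OF that] by (auto simp: in_keys_iff)
    then show ?thesis using sub[OF that] fU(2)[OF V(1)[OF that]] by (simp only: pol_ring_simps)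
  qed
  let ?x = "graded_free.combo (F i) (B i) p"
  have x: "?x \<in> carrier (F i)" by (rule G.combo_closed[OF pc])
  have sl: "slice i U ?x m = y U m" if U: "U \<subseteq> {1..n}" for U m
  proof
    fix b
    show "slice i U ?x m b = y U m b"
    proof (cases "b \<in> B i \<and> dgr i b = sqfree_deg U")
      case True
      then have "V b = U" using V(2) sqfree_deg_inject by metis
      then show ?thesis using True G.coords_combo[OF pc] lp by (simp add: slice_def)
    next
      case False
      then show ?thesis using y(1)[OF U, of m] by (auto simp: slice_def R.P_def)
    qed
  qed
  have "phi i ?x = f"
  proof
    fix U show "phi i ?x U = f U"
    proof (cases "U \<subseteq> {1..n}")
      case True
      then show ?thesis using sl y(2) by (auto simp: phi_def)
    next
      case False
      then show ?thesis using f unfolding coh_complex_simps by (simp add: phi_def extensional_def)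
    qed
  qed
  then show ?thesis using x by blast
qed

lemma phi_bij: "bij_betw (phi i) (carrier (F i)) (carrier (coh_complex n \<Delta> i))"
  unfolding bij_betw_def using phi_inj phi_closed phi_surj by blast

lemma phi_hcomp_iff:
  assumes x: "x \<in> carrier (F i)" and a: "a \<in> mdegs n"
  shows "phi i x \<in> hcomp (coh_complex n \<Delta> i) a \<longleftrightarrow> x \<in> hcomp (F i) a"
proof -
  have "phi i x \<in> hcomp (coh_complex n \<Delta> i) a \<longleftrightarrow>
    (\<forall>U\<in>Pow {1..n}. \<forall>m. phi i x U m \<noteq> \<zero>\<^bsub>coh \<Delta> i U\<^esub> \<longrightarrow> mon_deg m + sqfree_deg U = a)"
    using phi_closed[OF x] by (simp add: coh_complex_simps(5))
  also have "\<dots> \<longleftrightarrow> (\<forall>U\<in>Pow {1..n}. \<forall>m. (\<exists>b\<in>B i. dgr i b = sqfree_deg U \<and> m \<in> keys (cs i x b)) \<longrightarrow> mon_deg m + sqfree_deg U = a)"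
    by (intro ball_cong refl) (simp add: phi_zero_iff slice_nz)
  also have "\<dots> \<longleftrightarrow> (\<forall>b\<in>B i. \<forall>m\<in>keys (cs i x b). mon_deg m + dgr i b = a)"
  proof (intro iffI ballI allI impI)
    fix b m assume h: "\<forall>U\<in>Pow {1..n}. \<forall>m. (\<exists>b\<in>B i. dgr i b = sqfree_deg U \<and> m \<in> keys (cs i x b)) \<longrightarrow> mon_deg m + sqfree_deg U = a"
      and b: "b \<in> B i" and m: "m \<in> keys (cs i x b)"
    obtain U where "U \<subseteq> {1..n}" "dgr i b = sqfree_deg U" using R.degrees_squarefree[OF b] by blast
    then show "mon_deg m + dgr i b = a" using h b m by auto
  next
    fix U m assume h: "\<forall>b\<in>B i. \<forall>m\<in>keys (cs i x b). mon_deg m + dgr i b = a"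
      and "\<exists>b\<in>B i. dgr i b = sqfree_deg U \<and> m \<in> keys (cs i x b)"
    then show "mon_deg m + sqfree_deg U = a" by metis
  qed
  also have "\<dots> \<longleftrightarrow> x \<in> hcomp (F i) a"
    using G.hcomp_coords[OF a] G.hcomp_if_coords[OF x a] by blast
  finally show ?thesis .
qed

lemma phi_hcomp:
  assumes a: "a \<in> mdegs n"
  shows "phi i ` hcomp (F i) a = hcomp (coh_complex n \<Delta> i) a"
proof (intro Set.set_eqI iffI)
  fix f :: "nat set \<Rightarrow> mon \<Rightarrow> (nat set \<Rightarrow> 'k) set" assume "f \<in> phi i ` hcomp (F i) a"
  then obtain x where "x \<in> hcomp (F i) a" "f = phi i x" by blast
  then show "f \<in> hcomp (coh_complex n \<Delta> i) a" using phi_hcomp_iff[OF G.hcomp_carrier[OF a] a] by blast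
next
  fix f :: "nat set \<Rightarrow> mon \<Rightarrow> (nat set \<Rightarrow> 'k) set" assume f: "f \<in> hcomp (coh_complex n \<Delta> i) a"
  then have "f \<in> carrier (coh_complex n \<Delta> i)" by (simp only: coh_complex_simps(5) mem_Collect_eq)
  then obtain x where x: "x \<in> carrier (F i)" "phi i x = f" using phi_surj by blast
  then show "f \<in> phi i ` hcomp (F i) a" using phi_hcomp_iff[OF x(1) a] f by blast
qed

lemma coh_graded: "is_graded_module n (coh_complex n \<Delta> i :: ('k pol, _) graded_module)"
  by (rule transport_graded_module[OF G.graded phi_bij phi_zero phi_add phi_smult phi_hcomp])

lemma coh_module: "module (pol_ring n) (coh_complex n \<Delta> i :: ('k pol, _) graded_module)"
  using coh_graded by (simp add: is_graded_module_def)

text \<open>The counterpart in F_i of the pure tensor of y and s; \<open>single 0 r\<close> is the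
  constant polynomial r.\<close>

definition elem :: "nat \<Rightarrow> ('m \<Rightarrow> 'k) \<Rightarrow> 'k pol \<Rightarrow> 'm" where
  "elem i y s = graded_free.combo (F i) (B i) (\<lambda>b. single 0 (y b) * s)"

lemma elem:
  assumes s: "s \<in> carrier (pol_ring n)"
  shows "elem i y s \<in> carrier (F i)" "b \<in> B i \<Longrightarrow> cs i (elem i y s) b = single 0 (y b) * s"
proof -
  have c: "single 0 (y b) * s \<in> carrier (pol_ring n)" for b
    using s unfolding pol_ring_simps by (intro keys_times_mons) (auto simp: zero_in_mons)
  show "elem i y s \<in> carrier (F i)" unfolding elem_def by (rule G.combo_closed[OF c])
  show "b \<in> B i \<Longrightarrow> cs i (elem i y s) b = single 0 (y b) * s"
    unfolding elem_def by (rule G.coords_combo[OF c])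
qed

lemma lookup_single_0_times: "lookup (single 0 r * (s :: 'k pol)) m = r * lookup s m"
  by (simp add: lookup_single_times)

lemma phi_elem:
  assumes U: "U \<subseteq> {1..n}" and y: "y \<in> R.P (sqfree_deg U) i" and s: "s \<in> carrier (pol_ring n)"
  shows "phi i (elem i y s) = coh_elem n \<Delta> i U (R.\<Psi> i U y) s"
proof
  fix V
  have sl: "slice i V (elem i y s) m = (if V = U then (\<lambda>b. lookup s m * y b) else 0)" for m
  proof
    fix b
    show "slice i V (elem i y s) m b = (if V = U then (\<lambda>b. lookup s m * y b) else 0) b"
    proof (cases "y b = 0")
      case True
      then show ?thesis using elem(2)[OF s, of b i y] by (simp add: slice_def)
    next
      case False
      then have "b \<in> B i" "dgr i b = sqfree_deg U" using y by (auto simp: R.P_def)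
      then show ?thesis using elem(2)[OF s, of b i y] sqfree_deg_inject[of U V]
        by (auto simp: slice_def lookup_single_0_times)
    qed
  qed
  show "phi i (elem i y s) V = coh_elem n \<Delta> i U (R.\<Psi> i U y) s V"
  proof (cases "V \<subseteq> {1..n}")
    case False
    then show ?thesis by (simp add: phi_def coh_elem_def summand_inj_def)
  next
    case V: True
    then have "phi i (elem i y s) V = (\<lambda>m. if V = U then R.\<Psi> i U (\<lambda>b. lookup s m * y b) else \<zero>\<^bsub>coh \<Delta> i V\<^esub>)"
      by (intro ext) (simp add: phi_def sl R.\<Psi>_zero)
    also have "\<dots> = coh_elem n \<Delta> i U (R.\<Psi> i U y) s V"
      using V by (auto simp: coh_elem_def summand_inj_def pure_tensor_def R.\<Psi>_smult[OF U y] tensor_S_def mk_module_def)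
    finally show ?thesis .
  qed
qed

text \<open>An entry survives linearization exactly when it is nonzero and the degrees differ by one
  variable. As basis degrees are squarefree, this variable lies in U and the target degree is U -
  {u}.\<close>

lemma lin_elem:
  assumes U: "U \<subseteq> {1..n}" and y: "y \<in> R.P (sqfree_deg U) (Suc i)" and s: "s \<in> carrier (pol_ring n)"
  defines "yr \<equiv> \<lambda>u b. if dgr i b = sqfree_deg (U - {u}) then \<Sum>b'\<in>B (Suc i). y b' * entry i b' b else 0"
  shows "lin i (elem (Suc i) y s) = (\<Oplus>\<^bsub>F i\<^esub> u\<in>U. elem i (yr u) (var u * s))"
proof (rule G.coords_inject)
  have finU: "finite U" using U finite_subset by blast
  have vs: "var u * s \<in> carrier (pol_ring n)" if "u \<in> U" for u
  proof -
    have "u \<in> {1..n}" using that U by blast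
    then show ?thesis using var_carrier[of u n] s unfolding pol_ring_simps by (intro keys_times_mons)
  qed
  show "lin i (elem (Suc i) y s) \<in> carrier (F i)" by (rule lin_closed_coords(1)[OF elem(1)[OF s]])
  show "(\<Oplus>\<^bsub>F i\<^esub> u\<in>U. elem i (yr u) (var u * s)) \<in> carrier (F i)"
    using elem(1)[OF vs] by (intro G.M.finsum_closed) blast
  fix c assume c: "c \<in> B i"
  have t: "lent i b c * (single 0 (y b) * s) =
      (\<Sum>u\<in>U. if dgr i c = sqfree_deg (U - {u}) then single 0 (y b * entry i b c) * (var u * s) else 0)"
    if b: "b \<in> B (Suc i)" for b
  proof (cases "y b = 0 \<or> entry i b c = 0")
    case True
    then have 0: "y b * entry i b c = 0" by auto
    have z: "lent i b c * (single 0 (y b) * s) = 0" using True by (auto simp: lent_eq[OF b c])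
    show ?thesis unfolding 0 z by (intro sum.neutral[symmetric] ballI) simp
  next
    case False
    have db: "dgr (Suc i) b = sqfree_deg U" using False y by (auto simp: R.P_def)
    have le: "dgr i c \<le> dgr (Suc i) b" using False entry_nz_le by blast
    have diff: "sqfree_deg U - sqfree_deg {u} = sqfree_deg (U - {u})" if "u \<in> U" for u
      using that by (auto simp: sqfree_deg_def)
    show ?thesis
    proof (cases "\<exists>u\<in>U. dgr i c = sqfree_deg (U - {u})")
      case True
      then obtain u where u: "u \<in> U" "dgr i c = sqfree_deg (U - {u})" by blast
      have uniq: "dgr i c = sqfree_deg (U - {v}) \<longleftrightarrow> v = u" if "v \<in> U" for v
        using u that sqfree_deg_inject[of "U - {u}" "U - {v}"] by auto
      have e: "dgr (Suc i) b - dgr i c = sqfree_deg {u}" using diff[OF u(1)] u(2) db by (simp add: algebra_simps)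
      have m: "mon_of (dgr (Suc i) b - dgr i c) = single u 1"
        using mon_of_sqfree_deg[of "{u}"] unfolding e by simp
      have "lent i b c = single (single u 1) (entry i b c)"
        unfolding lent_eq[OF b c] m using False tdeg_single[of u n] u(1) U by auto
      then have "lent i b c * (single 0 (y b) * s) = single 0 (y b * entry i b c) * (var u * s)"
        by (simp add: var_def mult_single mult.commute flip: mult.assoc)
      also have "\<dots> = (\<Sum>v\<in>U. if v = u then single 0 (y b * entry i b c) * (var v * s) else 0)"
        using finU u(1) by simp
      also have "\<dots> = (\<Sum>v\<in>U. if dgr i c = sqfree_deg (U - {v}) then single 0 (y b * entry i b c) * (var v * s) else 0)"
        using uniq by (intro sum.cong refl) simp
      finally show ?thesis .
    next
      case no: False
      have "tdeg n (mon_of (dgr (Suc i) b - dgr i c)) \<noteq> 1"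
      proof
        assume "tdeg n (mon_of (dgr (Suc i) b - dgr i c)) = 1"
        moreover have "dgr (Suc i) b - dgr i c \<in> mdegs n" using G.dg(1)[OF b] G.dg(1)[OF c] mdegs_diff by blast
        moreover have "0 \<le> dgr (Suc i) b - dgr i c" using le by (simp add: le_fun_def)
        ultimately obtain u where u: "dgr (Suc i) b - dgr i c = sqfree_deg {u}" using tdeg_eq_1_iff by blast
        then have dc: "dgr i c = sqfree_deg U - sqfree_deg {u}" using db by (simp add: algebra_simps)
        \<comment> \<open>For u outside U the target degree would be -1 at u, which is impossible
          for a squarefree degree.\<close>
        obtain W where W: "W \<subseteq> {1..n}" "dgr i c = sqfree_deg W" using R.degrees_squarefree[OF c] by blast
        have "sqfree_deg W u = sqfree_deg U u - sqfree_deg {u} u" using dc W(2) by simp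
        then have "u \<in> U" by (auto simp: sqfree_deg_def split: if_splits)
        then show False using no dc diff by auto
      qed
      then have "lent i b c = 0" by (simp add: lent_eq[OF b c])
      then show ?thesis using no by (auto intro!: sum.neutral[symmetric])
    qed
  qed
  have "cs i (lin i (elem (Suc i) y s)) c = (\<Sum>b\<in>B (Suc i). lent i b c * (single 0 (y b) * s))"
    unfolding lin_closed_coords(2)[OF elem(1)[OF s] c] by (intro sum.cong refl) (simp only: elem(2)[OF s])
  also have "\<dots> = (\<Sum>b\<in>B (Suc i). \<Sum>u\<in>U. if dgr i c = sqfree_deg (U - {u}) then single 0 (y b * entry i b c) * (var u * s) else 0)"
    using t by simp
  also have "\<dots> = (\<Sum>u\<in>U. \<Sum>b\<in>B (Suc i). if dgr i c = sqfree_deg (U - {u}) then single 0 (y b * entry i b c) * (var u * s) else 0)"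
    by (rule sum.swap)
  also have "\<dots> = (\<Sum>u\<in>U. single 0 (yr u c) * (var u * s))"
  proof (intro sum.cong refl)
    fix u
    have "single 0 (\<Sum>b\<in>B (Suc i). y b * entry i b c) = (\<Sum>b\<in>B (Suc i). single (0::mon) (y b * entry i b c))"
      by (rule poly_mapping_eqI) (simp add: lookup_sum lookup_single when_def)
    then show "(\<Sum>b\<in>B (Suc i). if dgr i c = sqfree_deg (U - {u}) then single 0 (y b * entry i b c) * (var u * s) else 0) =
      single 0 (yr u c) * (var u * s)"
      by (simp add: yr_def sum_distrib_right)
  qed
  also have "\<dots> = (\<Sum>u\<in>U. cs i (elem i (yr u) (var u * s)) c)"
    by (intro sum.cong refl) (simp only: elem(2)[OF vs c])
  also have "\<dots> = cs i (\<Oplus>\<^bsub>F i\<^esub> u\<in>U. elem i (yr u) (var u * s)) c"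
    by (rule G.coords_finsum[symmetric, OF finU elem(1)[OF vs] c])
  finally show "cs i (lin i (elem (Suc i) y s)) c = cs i (\<Oplus>\<^bsub>F i\<^esub> u\<in>U. elem i (yr u) (var u * s)) c" .
qed

text \<open>The differential is transported from the linear part along \<open>phi\<close>, so it is
  a complex isomorphic to the linear part by construction; the content lies in its values on pure
  tensors.\<close>

definition Dmap :: "nat \<Rightarrow> (nat set \<Rightarrow> mon \<Rightarrow> (nat set \<Rightarrow> 'k) set) \<Rightarrow> nat set \<Rightarrow> mon \<Rightarrow> (nat set \<Rightarrow> 'k) set" where
  "Dmap i f = phi i (lin i (inv_into (carrier (F (Suc i))) (phi (Suc i)) f))"

lemma Dmap_phi: "x \<in> carrier (F (Suc i)) \<Longrightarrow> Dmap i (phi (Suc i) x) = phi i (lin i x)"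
  by (simp add: Dmap_def inv_into_f_f[OF phi_inj])

lemma Dmap_hom: "Dmap i \<in> graded_hom n (coh_complex n \<Delta> (Suc i)) (coh_complex n \<Delta> i)"
  unfolding graded_hom_def
proof (intro CollectI conjI ballI)
  have lin: "lin i x \<in> carrier (F i)" if "x \<in> carrier (F (Suc i))" for x using lin_closed_coords(1)[OF that] .
  note h = lin_hom[of i, unfolded graded_hom_def mem_Collect_eq]
  show "Dmap i \<in> carrier (coh_complex n \<Delta> (Suc i)) \<rightarrow> carrier (coh_complex n \<Delta> i)"
  proof
    fix f :: "nat set \<Rightarrow> mon \<Rightarrow> (nat set \<Rightarrow> 'k) set" assume "f \<in> carrier (coh_complex n \<Delta> (Suc i))"
    then obtain x where "x \<in> carrier (F (Suc i))" "phi (Suc i) x = f" using phi_surj by blast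
    then show "Dmap i f \<in> carrier (coh_complex n \<Delta> i)" using Dmap_phi phi_closed lin by metis
  qed
  fix f :: "nat set \<Rightarrow> mon \<Rightarrow> (nat set \<Rightarrow> 'k) set" assume "f \<in> carrier (coh_complex n \<Delta> (Suc i))"
  then obtain x where x: "x \<in> carrier (F (Suc i))" "phi (Suc i) x = f" using phi_surj by blast
  { fix g :: "nat set \<Rightarrow> mon \<Rightarrow> (nat set \<Rightarrow> 'k) set" assume "g \<in> carrier (coh_complex n \<Delta> (Suc i))"
    then obtain y where y: "y \<in> carrier (F (Suc i))" "phi (Suc i) y = g" using phi_surj by blast
    have "Dmap i (f \<oplus>\<^bsub>coh_complex n \<Delta> (Suc i)\<^esub> g) = phi i (lin i (x \<oplus>\<^bsub>F (Suc i)\<^esub> y))"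
      using Dmap_phi[OF G.M.a_closed[OF x(1) y(1)]] phi_add[OF x(1) y(1)] x(2) y(2) by simp
    also have "lin i (x \<oplus>\<^bsub>F (Suc i)\<^esub> y) = lin i x \<oplus>\<^bsub>F i\<^esub> lin i y" using h x(1) y(1) by blast
    finally show "Dmap i (f \<oplus>\<^bsub>coh_complex n \<Delta> (Suc i)\<^esub> g) = Dmap i f \<oplus>\<^bsub>coh_complex n \<Delta> i\<^esub> Dmap i g"
      using phi_add[OF lin[OF x(1)] lin[OF y(1)]] Dmap_phi x y by auto }
next
  note h = lin_hom[of i, unfolded graded_hom_def mem_Collect_eq]
  fix p and f :: "nat set \<Rightarrow> mon \<Rightarrow> (nat set \<Rightarrow> 'k) set" assume p: "p \<in> carrier (pol_ring n :: 'k pol ring)" and "f \<in> carrier (coh_complex n \<Delta> (Suc i))"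
  then obtain x where x: "x \<in> carrier (F (Suc i))" "phi (Suc i) x = f" using phi_surj by blast
  have "Dmap i (p \<odot>\<^bsub>coh_complex n \<Delta> (Suc i)\<^esub> f) = phi i (lin i (p \<odot>\<^bsub>F (Suc i)\<^esub> x))"
    using Dmap_phi[OF G.smult_closed[OF p x(1)]] phi_smult[OF p x(1)] x(2) by simp
  also have "lin i (p \<odot>\<^bsub>F (Suc i)\<^esub> x) = p \<odot>\<^bsub>F i\<^esub> lin i x" using h x(1) p by blast
  finally show "Dmap i (p \<odot>\<^bsub>coh_complex n \<Delta> (Suc i)\<^esub> f) = p \<odot>\<^bsub>coh_complex n \<Delta> i\<^esub> Dmap i f"
    using phi_smult[OF p lin_closed_coords(1)[OF x(1)]] Dmap_phi[OF x(1)] x(2) by simp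
next
  note h = lin_hom[of i, unfolded graded_hom_def mem_Collect_eq]
  fix a assume a: "a \<in> mdegs n"
  show "Dmap i ` hcomp (coh_complex n \<Delta> (Suc i)) a \<subseteq> hcomp (coh_complex n \<Delta> i) a"
  proof clarify
    fix f :: "nat set \<Rightarrow> mon \<Rightarrow> (nat set \<Rightarrow> 'k) set" assume "f \<in> hcomp (coh_complex n \<Delta> (Suc i)) a"
    then obtain x where x: "x \<in> hcomp (F (Suc i)) a" "f = phi (Suc i) x" using phi_hcomp[OF a] by blast
    then have "lin i x \<in> hcomp (F i) a" using h a by blast
    then show "Dmap i f \<in> hcomp (coh_complex n \<Delta> i) a"
      using phi_hcomp[OF a] Dmap_phi[OF G.hcomp_carrier[OF a x(1)]] x(2) by auto
  qed
qed

lemma Dmap_complex: "is_graded_complex n (coh_complex n \<Delta>) Dmap"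
  unfolding is_graded_complex_def
proof (intro conjI allI ballI coh_graded Dmap_hom)
  fix i and f :: "nat set \<Rightarrow> mon \<Rightarrow> (nat set \<Rightarrow> 'k) set" assume "f \<in> carrier (coh_complex n \<Delta> (Suc (Suc i)))"
  then obtain x where x: "x \<in> carrier (F (Suc (Suc i)))" "phi (Suc (Suc i)) x = f" using phi_surj by blast
  then have "Dmap i (Dmap (Suc i) f) = phi i (lin i (lin (Suc i) x))"
    using Dmap_phi[OF x(1)] Dmap_phi[OF lin_closed_coords(1)[OF x(1)]] by simp
  then show "Dmap i (Dmap (Suc i) f) = \<zero>\<^bsub>coh_complex n \<Delta> i\<^esub>" by (simp add: lin_lin[OF x(1)] phi_zero)
qed

text \<open>Represent the class as \<Psi> of some y. The linear part splits into its x_u-components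
  by \<open>lin_elem\<close>, and \<open>R.\<Psi>_restrict\<close> recognizes each as the signed
  restriction.\<close>

lemma Dmap_components: "has_restriction_components n \<Delta> Dmap"
  unfolding has_restriction_components_def
proof (intro allI ballI)
  fix i U and \<omega> :: "(nat set \<Rightarrow> 'k) set" and s :: "'k pol"
  assume "U \<in> Pow {1..n}" and \<omega>: "\<omega> \<in> carrier (coh \<Delta> (Suc i) U)" and s: "s \<in> carrier (pol_ring n)"
  then have U: "U \<subseteq> {1..n}" by simp
  have finU: "finite U" using U finite_subset by blast
  obtain y where y: "y \<in> R.P (sqfree_deg U) (Suc i)" "\<omega> = R.\<Psi> (Suc i) U y" by (rule R.\<Psi>_surj[OF U \<omega>])
  define yr where "yr u b = (if dgr i b = sqfree_deg (U - {u}) then \<Sum>b'\<in>B (Suc i). y b' * entry i b' b else 0)" for u b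
  interpret N: module "pol_ring n" "coh_complex n \<Delta> i :: ('k pol, _) graded_module" by (rule coh_module)
  have vs: "var u * s \<in> carrier (pol_ring n)" if "u \<in> U" for u
  proof -
    have "u \<in> {1..n}" using that U by blast
    then show ?thesis using var_carrier[of u n] s unfolding pol_ring_simps by (intro keys_times_mons)
  qed
  have yrP: "yr u \<in> R.P (sqfree_deg (U - {u})) i" for u
    unfolding R.P_def
  proof clarify
    fix b assume nz: "yr u b \<noteq> 0"
    then have "(\<Sum>b'\<in>B (Suc i). y b' * entry i b' b) \<noteq> 0" "dgr i b = sqfree_deg (U - {u})" by (auto simp: yr_def split: if_splits)
    then obtain b' where "entry i b' b \<noteq> 0" by (metis (no_types, lifting) mult_zero_right sum.neutral)
    then show "b \<in> B i \<and> dgr i b = sqfree_deg (U - {u})" using entry_nz_le \<open>dgr i b = _\<close> by blast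
  qed
  have "Dmap i (coh_elem n \<Delta> (Suc i) U \<omega> s) = phi i (lin i (elem (Suc i) y s))"
    using phi_elem[OF U y(1) s] Dmap_phi[OF elem(1)[OF s]] y(2) by metis
  also have "\<dots> = phi i (\<Oplus>\<^bsub>F i\<^esub> u\<in>U. elem i (yr u) (var u * s))"
    using lin_elem[OF U y(1) s] unfolding yr_def by simp
  also have "\<dots> = (\<Oplus>\<^bsub>coh_complex n \<Delta> i\<^esub> u\<in>U. phi i (elem i (yr u) (var u * s)))"
    by (rule finsum_hom[OF G.module_axioms coh_module phi_zero phi_add phi_closed finU elem(1)[OF vs]])
  also have "\<dots> = (\<Oplus>\<^bsub>coh_complex n \<Delta> i\<^esub> u\<in>U. coh_elem n \<Delta> i (U - {u})
             ((-1) ^ alpha u U \<odot>\<^bsub>coh \<Delta> i (U - {u})\<^esub>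
                restrict_class (restriction \<Delta> (U - {u})) (int (card U) - int i - 2) \<omega>)
             (var u * s))"
  proof (rule N.M.finsum_cong'[OF refl, symmetric])
    show "(\<lambda>u. phi i (elem i (yr u) (var u * s))) \<in> U \<rightarrow> carrier (coh_complex n \<Delta> i)"
      using phi_closed elem(1)[OF vs] by blast
    fix u assume u: "u \<in> U"
    have "U - {u} \<subseteq> {1..n}" using U by blast
    from phi_elem[OF this yrP vs[OF u]]
    show "coh_elem n \<Delta> i (U - {u}) ((-1) ^ alpha u U \<odot>\<^bsub>coh \<Delta> i (U - {u})\<^esub>
                restrict_class (restriction \<Delta> (U - {u})) (int (card U) - int i - 2) \<omega>) (var u * s) =
        phi i (elem i (yr u) (var u * s))"
      using R.\<Psi>_restrict[OF U u y(1)] y(2) unfolding yr_def by simp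
  qed
  finally show "Dmap i (coh_elem n \<Delta> (Suc i) U \<omega> s) = \<dots>" .
qed

lemma Dmap_iso: "complexes_isomorphic n F lin (coh_complex n \<Delta>) Dmap"
  unfolding complexes_isomorphic_def
proof (intro exI[of _ phi] conjI allI ballI phi_bij phi_hcomp)
  show "phi i \<in> graded_hom n (F i) (coh_complex n \<Delta> i)" for i
    unfolding graded_hom_def
    by (intro CollectI conjI ballI phi_add phi_smult) (use phi_closed phi_hcomp in auto)
  show "phi i (lin i x) = Dmap i (phi (Suc i) x)" if "x \<in> carrier (F (Suc i))" for i x
    using Dmap_phi[OF that] by simp
qed

end

theorem theorem1p1:
  fixes n :: nat
    and \<Delta> :: "nat set set"
    and F :: "nat \<Rightarrow> ('k::field pol, 'm) graded_module"
    and d :: "nat \<Rightarrow> 'm \<Rightarrow> 'm"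
    and \<epsilon> :: "'m \<Rightarrow> 'k pol set"
    and B :: "nat \<Rightarrow> 'm set"
  assumes "simplicial_complex n \<Delta>"
    and "minimal_free_resolution n (SR_module n \<Delta>) F d \<epsilon>"
    and "\<And>i. homogeneous_basis n (F i) (B i)"
  shows "\<exists>D. is_graded_complex n (coh_complex n \<Delta>) D \<and>
             has_restriction_components n \<Delta> D \<and>
             complexes_isomorphic n F (lin_diff n F d B) (coh_complex n \<Delta>) D"
proof -
  interpret SR_resolution n \<Delta> F d \<epsilon> B by unfold_locales (fact assms)+
  show ?thesis using Dmap_complex Dmap_components Dmap_iso by blast
qed

end
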